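(* Let $p,q,r\in\mathbb{N}$ and let $b_i:\mathbb{R}^p\to\mathbb{R}$, $i=1,\ldots,p$, and $c_k,d_j:\mathbb{R}^{p+r}\to\mathbb{R}$, $k=p+1,\ldots,p+q$, $j=p+1,\ldots,p+r$, be bounded, real-valued and continuous functions satisfying, for some constant $A$, the Lipschitz conditions $$|b_i(y_1)-b_i(y_2)|\le A\|y_1-y_2\|,\quad i=1,\ldots,p,$$ $$|c_k(y_1,z_1)-c_k(y_2,z_2)|\le A\|(y_1,z_1)-(y_2,z_2)\|,\quad k=p+1,\ldots,p+q,$$ $$|d_j(y_1,z_1)-d_j(y_2,z_2)|\le A\|(y_1,z_1)-(y_2,z_2)\|,\quad j=p+1,\ldots,p+r,$$ for every $y_1,y_2\in\mathbb{R}^p$ and $z_1,z_2\in\mathbb{R}^r$. Moreover, let $\sigma_i:\mathbb{R}\to\mathbb{R}$, $i=1,\ldots,p$, be bounded Borel functions such that $$|\sigma_i(x)-\sigma_i(y)|^2\le\rho_i(|x-y|),\quad x,y\in\mathbb{R},\ x\neq y,$$ where $\rho_i:(0,\infty)\to(0,\infty)$ are Borel functions such that $\int_{0^+}\rho_i^{-1}(x)\,dx=\infty$. Then pathwise uniqueness holds for the following system of stochastic differential equations: $$dY_i=\sigma_i(Y_i)\,dB_i+b_i(Y)\,dt,\quad i=1,\ldots,p,$$ $$dZ_j=\sum_{k=p+1}^{p+q}c_k(Y,Z)\,dB_k+d_j(Y,Z)\,dt,\quad j=p+1,\ldots,p+r,$$ where $Y=(Y_1,\ldots,Y_p)$, $Z=(Z_{p+1},\ldots,Z_{p+r})$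 and $B_1,\ldots,B_{p+q}$ are independent (one-dimensional, standard) Brownian motions.
   Context: $\|\cdot\|$ denotes the Euclidean norm. $\rho_i^{-1}(x)$ means $1/\rho_i(x)$, and $\int_{0^+}\rho_i^{-1}(x)dx=\infty$ means $\int_0^{\varepsilon}\frac{dx}{\rho_i(x)}=\infty$ for every $\varepsilon>0$. Pathwise uniqueness means: if $(Y,Z)$ and $(\tilde Y,\tilde Z)$ are two solutions on the same filtered probability space, with respect to the same Brownian motion $(B_i)_{i\le p+q}$, with $Y(0)=\tilde Y(0)$ and $Z(0)=\tilde Z(0)$ a.s., then a.s. $(Y(t),Z(t))=(\tilde Y(t),\tilde Z(t))$ for all $t\ge 0$. *)

theory Defs
  imports "HOL-Probability.Probability"
begin

text \<open>Time is the half-line \<open>{0..}\<close> inside \<^typ>\<open>real\<close>; values of filtrations and processes at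
  negative times are never inspected. No completeness or right-continuity of the filtration is
  assumed.\<close>

definition filtered_prob_space :: "'w measure \<Rightarrow> (real \<Rightarrow> 'w measure) \<Rightarrow> bool" where
  "filtered_prob_space M F \<longleftrightarrow>
     prob_space M \<and>
     (\<forall>t\<ge>0. subalgebra M (F t)) \<and>
     (\<forall>s t. 0 \<le> s \<and> s \<le> t \<longrightarrow> subalgebra (F t) (F s))"

definition adapted_process ::
    "(real \<Rightarrow> 'w measure) \<Rightarrow> (real \<Rightarrow> 'w \<Rightarrow> 'x::topological_space) \<Rightarrow> bool" where
  "adapted_process F X \<longleftrightarrow> (\<forall>t\<ge>0. X t \<in> borel_measurable (F t))"

definition progressively_measurable ::
    "(real \<Rightarrow> 'w measure) \<Rightarrow> (real \<Rightarrow> 'w \<Rightarrow> 'x::topological_space) \<Rightarrow> bool" where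
  "progressively_measurable F X \<longleftrightarrow>
     (\<forall>T\<ge>0. (\<lambda>(s, \<omega>). X s \<omega>) \<in> borel_measurable (restrict_space borel {0..T} \<Otimes>\<^sub>M F T))"

text \<open>One-dimensional standard Brownian motion relative to the filtration \<open>F\<close>.\<close>

definition brownian_motion ::
    "'w measure \<Rightarrow> (real \<Rightarrow> 'w measure) \<Rightarrow> (real \<Rightarrow> 'w \<Rightarrow> real) \<Rightarrow> bool" where
  "brownian_motion M F W \<longleftrightarrow>
     adapted_process F W \<and>
     (AE \<omega> in M. W 0 \<omega> = 0) \<and>
     (AE \<omega> in M. continuous_on {0..} (\<lambda>t. W t \<omega>)) \<and>
     (\<forall>s t. 0 \<le> s \<and> s < t \<longrightarrow>
        distributed M lborel (\<lambda>\<omega>. W t \<omega> - W s \<omega>) (normal_density 0 (sqrt (t - s))) \<and>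
        prob_space.indep_set M (sets (F s))
          (sets (vimage_algebra (space M) (\<lambda>\<omega>. W t \<omega> - W s \<omega>) borel)))"

text \<open>The components are independent as processes, i.e. as random elements of the space of
  real functions on \<open>{0..}\<close> with the product \<open>\<sigma>\<close>-algebra.\<close>

definition independent_brownian_motions ::
    "'w measure \<Rightarrow> (real \<Rightarrow> 'w measure) \<Rightarrow> ('i \<Rightarrow> real \<Rightarrow> 'w \<Rightarrow> real) \<Rightarrow> bool" where
  "independent_brownian_motions M F B \<longleftrightarrow>
     (\<forall>i. brownian_motion M F (B i)) \<and>
     prob_space.indep_vars M (\<lambda>_. Pi\<^sub>M {0..} (\<lambda>_. borel)) (\<lambda>i \<omega>. \<lambda>t\<in>{0..}. B i t \<omega>) UNIV"

text \<open>The data \<open>(n, \<tau>, \<xi>)\<close> stand for the simple process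
  \<open>\<Sum>k<n. \<xi> k \<cdot> indicator {\<tau> k<..\<tau> (k + 1)}\<close> with bounded \<open>F (\<tau> k)\<close>-measurable \<open>\<xi> k\<close>.\<close>

definition simple_data ::
    "'w measure \<Rightarrow> (real \<Rightarrow> 'w measure) \<Rightarrow> nat \<Rightarrow> (nat \<Rightarrow> real) \<Rightarrow> (nat \<Rightarrow> 'w \<Rightarrow> real) \<Rightarrow> bool" where
  "simple_data M F n \<tau> \<xi> \<longleftrightarrow>
     0 \<le> \<tau> 0 \<and>
     (\<forall>k<n. \<tau> k \<le> \<tau> (Suc k) \<and> \<xi> k \<in> borel_measurable (F (\<tau> k)) \<and> bounded (\<xi> k ` space M))"

definition simple_process ::
    "nat \<Rightarrow> (nat \<Rightarrow> real) \<Rightarrow> (nat \<Rightarrow> 'w \<Rightarrow> real) \<Rightarrow> real \<Rightarrow> 'w \<Rightarrow> real" where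
  "simple_process n \<tau> \<xi> s \<omega> = (\<Sum>k<n. \<xi> k \<omega> * indicator {\<tau> k<..\<tau> (Suc k)} s)"

definition simple_integral ::
    "(real \<Rightarrow> 'w \<Rightarrow> real) \<Rightarrow> nat \<Rightarrow> (nat \<Rightarrow> real) \<Rightarrow> (nat \<Rightarrow> 'w \<Rightarrow> real) \<Rightarrow> real \<Rightarrow> 'w \<Rightarrow> real" where
  "simple_integral W n \<tau> \<xi> t \<omega> =
     (\<Sum>k<n. \<xi> k \<omega> * (W (min (\<tau> (Suc k)) t) \<omega> - W (min (\<tau> k) t) \<omega>))"

text \<open>\<open>has_ito_integral M F W H I\<close>: the process \<open>I\<close> is (a continuous version of) the Ito integral
  \<open>I t = \<integral>\<^sub>0\<^sup>t H dW\<close>, defined as the \<open>L\<^sup>2\<close> limit of the integrals of simple processes converging to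
  \<open>H\<close> in \<open>L\<^sup>2([0,T] \<times> M)\<close> for every \<open>T\<close>. The limit determines \<open>I\<close> up to indistinguishability. This
  is the \<open>L\<^sup>2\<close> integral, without localization, so \<open>H\<close> must be square integrable on each
  \<open>[0,T] \<times> M\<close>; in particular it covers all bounded progressively measurable \<open>H\<close>.\<close>

definition has_ito_integral ::
    "'w measure \<Rightarrow> (real \<Rightarrow> 'w measure) \<Rightarrow> (real \<Rightarrow> 'w \<Rightarrow> real) \<Rightarrow>
     (real \<Rightarrow> 'w \<Rightarrow> real) \<Rightarrow> (real \<Rightarrow> 'w \<Rightarrow> real) \<Rightarrow> bool" where
  "has_ito_integral M F W H I \<longleftrightarrow>
     progressively_measurable F H \<and>
     (\<forall>t\<ge>0. I t \<in> borel_measurable M) \<and>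
     (AE \<omega> in M. continuous_on {0..} (\<lambda>t. I t \<omega>)) \<and>
     (\<exists>n \<tau> \<xi>.
        (\<forall>m. simple_data M F (n m) (\<tau> m) (\<xi> m)) \<and>
        (\<forall>T\<ge>0. (\<lambda>m. \<integral>\<^sup>+\<omega>. (\<integral>\<^sup>+s\<in>{0..T}.
             ennreal ((simple_process (n m) (\<tau> m) (\<xi> m) s \<omega> - H s \<omega>)\<^sup>2) \<partial>lborel) \<partial>M)
           \<longlonglongrightarrow> 0) \<and>
        (\<forall>t\<ge>0. (\<lambda>m. \<integral>\<^sup>+\<omega>.
             ennreal ((simple_integral W (n m) (\<tau> m) (\<xi> m) t \<omega> - I t \<omega>)\<^sup>2) \<partial>M)
           \<longlonglongrightarrow> 0))"

text \<open>The driving Brownian motions are indexed by the disjoint sum of the index types, \<open>B (Inl i)\<close>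
  driving \<open>Y\<^sub>i\<close> and the \<open>B (Inr k)\<close> driving \<open>Z\<close>. The product norm on
  \<^typ>\<open>(real ^ 'p) \<times> (real ^ 'r)\<close> is the Euclidean norm of the concatenated vector.\<close>

definition sde_solution ::
    "'w measure \<Rightarrow> (real \<Rightarrow> 'w measure) \<Rightarrow> ('p + 'q \<Rightarrow> real \<Rightarrow> 'w \<Rightarrow> real) \<Rightarrow>
     ('p::finite \<Rightarrow> real \<Rightarrow> real) \<Rightarrow> ('p \<Rightarrow> real ^ 'p \<Rightarrow> real) \<Rightarrow>
     ('q::finite \<Rightarrow> (real ^ 'p) \<times> (real ^ 'r) \<Rightarrow> real) \<Rightarrow>
     ('r::finite \<Rightarrow> (real ^ 'p) \<times> (real ^ 'r) \<Rightarrow> real) \<Rightarrow>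
     (real \<Rightarrow> 'w \<Rightarrow> real ^ 'p) \<Rightarrow> (real \<Rightarrow> 'w \<Rightarrow> real ^ 'r) \<Rightarrow> bool" where
  "sde_solution M F B \<sigma> b c d Y Z \<longleftrightarrow>
     adapted_process F Y \<and> (\<forall>\<omega>\<in>space M. continuous_on {0..} (\<lambda>t. Y t \<omega>)) \<and>
     adapted_process F Z \<and> (\<forall>\<omega>\<in>space M. continuous_on {0..} (\<lambda>t. Z t \<omega>)) \<and>
     (\<exists>I J.
        (\<forall>i. has_ito_integral M F (B (Inl i)) (\<lambda>t \<omega>. \<sigma> i (Y t \<omega> $ i)) (I i)) \<and>
        (\<forall>k. has_ito_integral M F (B (Inr k)) (\<lambda>t \<omega>. c k (Y t \<omega>, Z t \<omega>)) (J k)) \<and>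
        (\<forall>i. AE \<omega> in M. \<forall>t\<ge>0.
           Y t \<omega> $ i = Y 0 \<omega> $ i + I i t \<omega> + (LINT s:{0..t}|lborel. b i (Y s \<omega>))) \<and>
        (\<forall>j. AE \<omega> in M. \<forall>t\<ge>0.
           Z t \<omega> $ j = Z 0 \<omega> $ j + (\<Sum>k\<in>UNIV. J k t \<omega>)
             + (LINT s:{0..t}|lborel. d j (Y s \<omega>, Z s \<omega>))))"

text \<open>HOL cannot quantify over types inside a formula, so the type \<^typ>\<open>'w\<close> of elementary outcomes
  is a parameter.\<close>

definition pathwise_uniqueness ::
    "'w itself \<Rightarrow> ('p::finite \<Rightarrow> real \<Rightarrow> real) \<Rightarrow> ('p \<Rightarrow> real ^ 'p \<Rightarrow> real) \<Rightarrow>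
     ('q::finite \<Rightarrow> (real ^ 'p) \<times> (real ^ 'r) \<Rightarrow> real) \<Rightarrow>
     ('r::finite \<Rightarrow> (real ^ 'p) \<times> (real ^ 'r) \<Rightarrow> real) \<Rightarrow> bool" where
  "pathwise_uniqueness (_ :: 'w itself) \<sigma> b c d \<longleftrightarrow>
     (\<forall>(M :: 'w measure) F B Y Z Y' Z'.
        filtered_prob_space M F \<longrightarrow>
        independent_brownian_motions M F B \<longrightarrow>
        sde_solution M F B \<sigma> b c d Y Z \<longrightarrow>
        sde_solution M F B \<sigma> b c d Y' Z' \<longrightarrow>
        (AE \<omega> in M. Y 0 \<omega> = Y' 0 \<omega> \<and> Z 0 \<omega> = Z' 0 \<omega>) \<longrightarrow>
        (AE \<omega> in M. \<forall>t\<ge>0. (Y t \<omega>, Z t \<omega>) = (Y' t \<omega>, Z' t \<omega>)))"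

end

theory Submission
  imports Defs
begin

text \<open>The argument is that of Yamada and Watanabe, carried out on a time grid instead of through the Ito
  formula. As \<open>\<rho>\<close> is only Borel, it is replaced first: Osgood's condition forces \<open>{\<rho> \<le> \<delta>}\<close> to have
  positive measure near \<open>0\<close>, so by Steinhaus' argument \<open>\<sigma>\<close> is uniformly continuous, and
  \<open>s r = (SUP x. \<bar>\<sigma> (x + r) - \<sigma> x\<bar>)\<close> is a continuous modulus of \<open>\<sigma>\<close> with \<open>s\<^sup>2 \<le> \<rho>\<close>. Integrating a cut-off
  of \<open>1 / (s\<^sup>2 + \<epsilon>)\<close> twice gives a convex \<open>\<phi>\<close> with \<open>\<bar>\<phi>'\<bar> \<le> 1\<close>, \<open>\<phi>'' x * (s \<bar>x\<bar>)\<^sup>2 \<le> \<kappa>\<close> and \<open>\<phi> x \<ge> \<bar>x\<bar> - \<kappa>\<close>.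

  For a coordinate \<open>X = Y\<^sub>i - Y'\<^sub>i\<close> with diffusion difference \<open>a = \<sigma> Y\<^sub>i - \<sigma> Y'\<^sub>i\<close> and drift difference \<open>\<beta>\<close>,
  write an increment of \<open>X\<close> over a grid interval as \<open>a \<Delta>W + e\<close> with \<open>a\<close> frozen at the left end point. By
  continuity of the paths the errors satisfy \<open>\<Sum> E e\<^sup>2 \<longrightarrow> 0\<close>, so summing a second-order Taylor bound for
  \<open>\<phi>\<close> gives \<open>E (\<phi> X\<^sub>T) \<le> E (\<integral>\<bar>\<beta>\<bar>) + \<kappa> T / 2\<close>, hence \<open>E \<bar>X\<^sub>T\<bar> \<le> E (\<integral>\<bar>\<beta>\<bar>)\<close>, and Gronwall yields \<open>Y = Y'\<close>.
  Given that, the coefficients of the second equation are Lipschitz in \<open>Z\<close> alone, and Gronwall applies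
  to \<open>E \<parallel>Z - Z'\<parallel>\<^sup>2\<close>.\<close>

section \<open>Osgood moduli and test functions\<close>

text \<open>The Ito integral is given only as an \<open>L\<^sup>2\<close> limit of simple integrals,
  and integral processes are merely \<open>M\<close>-measurable. Two facts about increments carry
  the grid argument: a comparison of an Ito increment with a frozen coefficient times the Brownian
  increment, and orthogonality to bounded \<open>F s\<close>-measurable variables. The latter is
  applied to \<open>\<phi>' (X s)\<close>, which is \<open>F s\<close>-measurable because
  \<open>X\<close> is adapted. The first-order Taylor term keeps the true Ito increments, so its
  noise part has mean exactly 0 and freezing costs only a squared error. That this error vanishes
  rests on the continuity of \<sigma> along paths, a second use of Steinhaus' argument. The limits
  are nested: the mesh tends to 0 for a fixed tolerance \<eta>, since the constant \<open>C\<close>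
  of the Taylor bound depends on \<eta>; then \<eta> and finally \<kappa> tend to 0. As
  \<open>\<sigma> i\<close> sees only coordinate \<open>i\<close>, the test function stays
  one-dimensional, and the coordinates of \<open>Y\<close> are coupled by the Lipschitz drifts
  alone. The modulus of \<sigma> gives no Lipschitz bound for the noise, hence
  \<open>L\<^sup>1\<close> for \<open>Y\<close>; for \<open>Z\<close> the noise is Lipschitz and the
  square norm works.\<close>

text \<open>Squeeze a compact \<open>K\<close> inside \<open>E\<close> and an open \<open>U\<close>
  around \<open>K\<close> with \<open>U - K\<close> of smaller measure than \<open>K\<close>. A
  shift shorter than the distance from \<open>K\<close> to the complement of \<open>U\<close> keeps
  \<open>K\<close> inside \<open>U\<close>; if it missed \<open>K\<close> altogether,
  \<open>U - K\<close> would contain a set as large as \<open>K\<close>.\<close>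

lemma positive_measure_shift_meets:
  fixes E :: "real set"
  assumes E: "E \<in> lmeasurable" and pos: "measure lebesgue E > 0" and bd: "bounded E"
  obtains d where "d > 0" "\<And>h. \<bar>h\<bar> < d \<Longrightarrow> \<exists>u\<in>E. u + h \<in> E"
proof -
  obtain K where K: "closed K" "K \<subseteq> E" "E - K \<in> lmeasurable" "emeasure lebesgue (E - K) < ennreal (measure lebesgue E)"
    using sets_lebesgue_inner_closed[of E "measure lebesgue E"] E pos by blast
  have cK: "compact K"
    using K bd by (meson bounded_subset compact_eq_bounded_closed)
  have Km: "K \<in> lmeasurable" using cK by (rule lmeasurable_compact)
  have "measure lebesgue (E - K) < measure lebesgue E"
    using K(3,4) by (simp add: emeasure_eq_measure2 pos ennreal_less_iff)
  moreover have "measure lebesgue (E - K) = measure lebesgue E - measure lebesgue K"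
    using E Km K(2) by (intro measurable_measure_Diff) auto
  ultimately have Kpos: "measure lebesgue K > 0" by simp
  obtain U where U: "open U" "K \<subseteq> U" "U - K \<in> lmeasurable" "emeasure lebesgue (U - K) < ennreal (measure lebesgue K)"
    using sets_lebesgue_outer_open[of K "measure lebesgue K"] Km Kpos by blast
  have UK: "measure lebesgue (U - K) < measure lebesgue K"
    using U(3,4) by (simp add: emeasure_eq_measure2 Kpos ennreal_less_iff)
  obtain d where d: "d > 0" "\<And>x y. x \<in> K \<Longrightarrow> y \<in> - U \<Longrightarrow> d \<le> dist x y"
    using separate_compact_closed[OF cK, of "- U"] U(1,2) by (metis Compl_disjoint2 closed_Compl disjoint_eq_subset_Compl double_compl)
  show thesis
  proof (rule that[OF d(1)])
    fix h :: real assume h: "\<bar>h\<bar> < d"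
    show "\<exists>u\<in>E. u + h \<in> E"
    proof (rule ccontr)
      assume no: "\<not> (\<exists>u\<in>E. u + h \<in> E)"
      have "(+) h ` K \<subseteq> U - K"
      proof
        fix y assume "y \<in> (+) h ` K"
        then obtain x where x: "x \<in> K" "y = h + x" by auto
        have "y \<in> U" using d(2)[OF x(1), of y] h x by (force simp: dist_real_def)
        moreover have "y \<notin> K" using no x K(2) by (metis add.commute subsetD)
        ultimately show "y \<in> U - K" by simp
      qed
      moreover have "(+) h ` K \<in> lmeasurable"
        using cK by (intro lmeasurable_compact compact_translation)
      ultimately have "measure lebesgue ((+) h ` K) \<le> measure lebesgue (U - K)"
        using U(3) by (intro measure_mono_fmeasurable) auto
      then show False using UK by (simp add: measure_translation)
    qed
  qed
qed

text \<open>A Borel \<rho> may be large at arbitrarily small arguments, so the modulus alone gives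
  no continuity. If \<open>\<rho> > dl\<close> held almost everywhere on (0, 1), then
  \<open>1 / \<rho>\<close> would have a finite integral there. So the good increments
  \<open>E\<close> have positive measure, and every small shift is a difference of two of
  them.\<close>

lemma uniformly_continuous_of_Osgood_modulus:
  fixes \<sigma> \<rho> :: "real \<Rightarrow> real"
  assumes mod: "\<And>x y. x \<noteq> y \<Longrightarrow> \<bar>\<sigma> x - \<sigma> y\<bar>\<^sup>2 \<le> \<rho> \<bar>x - y\<bar>"
    and pos: "\<And>x. \<rho> x > 0" and [measurable]: "\<rho> \<in> borel_measurable borel"
    and Osgood: "(\<integral>\<^sup>+x\<in>{0<..<1}. ennreal (1 / \<rho> x) \<partial>lborel) = \<infinity>"
    and e: "e > 0"
  obtains d where "d > 0" "\<And>x y. \<bar>x - y\<bar> < d \<Longrightarrow> \<bar>\<sigma> x - \<sigma> y\<bar> < e"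
proof -
  \<comment> \<open>Two points will be joined through a third one, each time at cost
    \<open>e / 3\<close>; this leaves room for the strict inequality.\<close>
  define dl where "dl = (e / 3)\<^sup>2"
  have dl: "dl > 0" using e by (simp add: dl_def)
  define E where "E = {x. 0 < x \<and> x < 1 \<and> \<rho> x \<le> dl}"
  have Em[measurable]: "E \<in> sets borel" unfolding E_def by measurable
  have bE: "bounded E" by (rule bounded_subset[of "{0..1}"]) (auto simp: E_def)
  have lE: "E \<in> lmeasurable"
    using Em bE by (intro bounded_set_imp_lmeasurable) auto
  have "measure lebesgue E > 0"
  proof (rule ccontr)
    assume "\<not> measure lebesgue E > 0"
    then have "emeasure lebesgue E = 0"
      using lE by (simp add: zero_less_measure_iff emeasure_eq_measure2)
    then have "emeasure lborel E = 0"
      using Em by (simp add: main_part_sets)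
    then have "AE x in lborel. x \<notin> E"
      by (intro AE_I[of _ _ E]) auto
    then have "AE x in lborel. ennreal (1 / \<rho> x) * indicator {0<..<1} x \<le> ennreal (1 / dl) * indicator {0<..<1} x"
    proof eventually_elim
      fix x assume "x \<notin> E"
      then show "ennreal (1 / \<rho> x) * indicator {0<..<1} x \<le> ennreal (1 / dl) * indicator {0<..<1} x"
        using pos[of x] dl by (auto simp: E_def split: split_indicator intro!: ennreal_leI divide_left_mono)
    qed
    then have "(\<integral>\<^sup>+x\<in>{0<..<1}. ennreal (1 / \<rho> x) \<partial>lborel) \<le> (\<integral>\<^sup>+x\<in>{0<..<1::real}. ennreal (1 / dl) \<partial>lborel)"
      by (rule nn_integral_mono_AE)
    also have "\<dots> = ennreal (1 / dl)" by (simp add: nn_integral_cmult_indicator)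
    finally show False using Osgood by (simp add: top_unique)
  qed
  then obtain d where d: "d > 0" "\<And>h. \<bar>h\<bar> < d \<Longrightarrow> \<exists>u\<in>E. u + h \<in> E"
    using positive_measure_shift_meets[OF lE _ bE] by metis
  have small: "\<bar>\<sigma> x - \<sigma> y\<bar> \<le> e / 3" if "\<bar>x - y\<bar> \<in> E" for x y
  proof -
    have "x \<noteq> y" using that by (auto simp: E_def)
    then have "\<bar>\<sigma> x - \<sigma> y\<bar>\<^sup>2 \<le> (e/3)\<^sup>2" using mod[of x y] that by (auto simp: E_def dl_def)
    then show ?thesis using e by (metis abs_le_square_iff abs_of_pos abs_abs divide_pos_pos zero_less_numeral power2_abs)
  qed
  show thesis
  proof (rule that[OF d(1)])
    fix x y :: real assume "\<bar>x - y\<bar> < d"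
    then obtain u where u: "u \<in> E" "u + (x - y) \<in> E" using d(2) by blast
    then have "u > 0" "u + (x - y) > 0" by (auto simp: E_def)
    \<comment> \<open>The intermediate point \<open>y - u\<close> lies at distance \<open>u\<close>
      from \<open>y\<close> and \<open>u + (x - y)\<close> from \<open>x\<close>, both in
      \<open>E\<close>.\<close>
    then have "\<bar>\<sigma> x - \<sigma> (y - u)\<bar> \<le> e/3" "\<bar>\<sigma> y - \<sigma> (y - u)\<bar> \<le> e/3"
      using u small[of x "y - u"] small[of y "y - u"] by (simp_all add: algebra_simps)
    then show "\<bar>\<sigma> x - \<sigma> y\<bar> < e" using e by linarith
  qed
qed

text \<open>The supremum over all base points is the least modulus that depends only on the
  displacement, hence it stays below \<open>sqrt (\<rho> r)\<close>. Its values at two displacements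
  differ by at most the oscillation of \<sigma> over their distance, so it inherits uniform
  continuity from \<sigma>.\<close>

lemma continuous_modulus_below:
  fixes \<sigma> \<rho> :: "real \<Rightarrow> real"
  assumes mod: "\<And>x y. x \<noteq> y \<Longrightarrow> \<bar>\<sigma> x - \<sigma> y\<bar>\<^sup>2 \<le> \<rho> \<bar>x - y\<bar>"
    and pos: "\<And>x. \<rho> x > 0" and meas: "\<rho> \<in> borel_measurable borel"
    and Osgood: "(\<integral>\<^sup>+x\<in>{0<..<1}. ennreal (1 / \<rho> x) \<partial>lborel) = \<infinity>"
    and bd: "bounded (range \<sigma>)"
  obtains s where "continuous_on UNIV s" "\<And>r. r > 0 \<Longrightarrow> (s r)\<^sup>2 \<le> \<rho> r"
    "\<And>x y. \<bar>\<sigma> x - \<sigma> y\<bar> \<le> s \<bar>x - y\<bar>"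
proof -
  obtain K where K: "\<And>x. \<bar>\<sigma> x\<bar> \<le> K" using bd by (auto simp: bounded_iff)
  define s where "s r = (SUP x. \<bar>\<sigma> (x + r) - \<sigma> x\<bar>)" for r
  have up: "\<bar>\<sigma> (x + r) - \<sigma> x\<bar> \<le> s r" for x r
    unfolding s_def
  proof (rule cSUP_upper)
    show "bdd_above (range (\<lambda>x. \<bar>\<sigma> (x + r) - \<sigma> x\<bar>))"
    proof (rule bdd_aboveI2)
      show "\<bar>\<sigma> (x + r) - \<sigma> x\<bar> \<le> 2 * K" for x using K[of "x+r"] K[of x] by linarith
    qed
  qed simp
  have le: "s r \<le> c" if "\<And>x. \<bar>\<sigma> (x + r) - \<sigma> x\<bar> \<le> c" for r c
    unfolding s_def using that by (intro cSUP_least) auto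
  show thesis
  proof (rule that)
    show "\<bar>\<sigma> x - \<sigma> y\<bar> \<le> s \<bar>x - y\<bar>" for x y
      using up[of y "x - y"] up[of x "y - x"] by (cases "x \<ge> y") (auto simp: abs_minus_commute)
    show "(s r)\<^sup>2 \<le> \<rho> r" if "r > 0" for r
    proof -
      have "s r \<le> sqrt (\<rho> r)"
      proof (rule le)
        show "\<bar>\<sigma> (x + r) - \<sigma> x\<bar> \<le> sqrt (\<rho> r)" for x
          using mod[of "x + r" x] that by (intro real_le_rsqrt) auto
      qed
      then have "(s r)\<^sup>2 \<le> (sqrt (\<rho> r))\<^sup>2" using up[of 0 r] by (intro power_mono) linarith+
      then show ?thesis using pos[of r] by simp
    qed
    show "continuous_on UNIV s"
      unfolding continuous_on_iff
    proof (intro ballI allI impI)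
      fix r e :: real assume e: "0 < e"
      obtain d where d: "d > 0" "\<And>x y. \<bar>x - y\<bar> < d \<Longrightarrow> \<bar>\<sigma> x - \<sigma> y\<bar> < e/2"
        using uniformly_continuous_of_Osgood_modulus[OF mod pos meas Osgood, of "e/2"] e by auto
      have "s r1 \<le> s r2 + e/2" if "\<bar>r1 - r2\<bar> < d" for r1 r2
      proof (rule le)
        fix x show "\<bar>\<sigma> (x + r1) - \<sigma> x\<bar> \<le> s r2 + e/2"
          using d(2)[of "x + r1" "x + r2"] up[of x r2] that by (auto simp: abs_if field_simps split: if_splits)
      qed
      then have "dist (s r') (s r) < e" if "dist r' r < d" for r'
        using that e by (force simp: dist_real_def abs_less_iff abs_minus_commute)
      then show "\<exists>d>0. \<forall>r'\<in>UNIV. dist r' r < d \<longrightarrow> dist (s r') (s r) < e" using d(1) by blast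
    qed
  qed
qed

section \<open>Convex test functions and second-order Taylor bounds\<close>

lemma antiderivative_UNIV:
  fixes f :: "real \<Rightarrow> real"
  assumes "continuous_on UNIV f"
  obtains F where "\<And>x. (F has_real_derivative f x) (at x)" "F 0 = 0"
proof -
  obtain F where F: "\<And>x. (F has_vector_derivative f x) (at x)"
    using einterval_antiderivative[of "-\<infinity>" "\<infinity>" f] assms
    by (auto simp: continuous_on_eq_continuous_at)
  have "((\<lambda>x. F x - F 0) has_real_derivative f x) (at x)" for x
    using F[of x] by (auto simp: has_real_derivative_iff_has_vector_derivative[symmetric] intro!: derivative_eq_intros)
  then show thesis by (intro that[of "\<lambda>x. F x - F 0"]) auto
qed

text \<open>Monotone convergence along \<open>e = 1 / (n + 1)\<close>. The shift keeps the
  reciprocal bounded, also after \<rho> is replaced by the square of a modulus that may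
  vanish.\<close>

lemma Osgood_regularized:
  fixes \<rho> :: "real \<Rightarrow> real"
  assumes pos: "\<And>x. \<rho> x > 0" and [measurable]: "\<rho> \<in> borel_measurable borel"
    and Osgood: "(\<integral>\<^sup>+x\<in>{0<..<d}. ennreal (1 / \<rho> x) \<partial>lborel) = \<infinity>"
  obtains e where "e > 0" "(\<integral>\<^sup>+x\<in>{0<..<d}. ennreal (1 / (\<rho> x + e)) \<partial>lborel) > ennreal R"
proof -
  let ?f = "\<lambda>n x. ennreal (1 / (\<rho> x + 1 / real (Suc n))) * indicator {0<..<d} x"
  have nz: "\<rho> x + 1 / real (Suc n) > 0" for x n
    using pos[of x] by (simp add: add_pos_pos)
  have lim: "(\<lambda>n. ?f n x) \<longlonglongrightarrow> ennreal (1 / \<rho> x) * indicator {0<..<d} x" for x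
  proof (cases "x \<in> {0<..<d}")
    case True
    have "(\<lambda>n. 1 / (\<rho> x + 1 / real (Suc n))) \<longlonglongrightarrow> 1 / (\<rho> x + 0)"
      using pos[of x] by (intro tendsto_intros LIMSEQ_Suc[OF lim_1_over_n]) auto
    then show ?thesis using True by (simp add: tendsto_ennrealI del: of_nat_Suc)
  qed simp
  have "(\<lambda>n. integral\<^sup>N lborel (?f n)) \<longlonglongrightarrow> (\<integral>\<^sup>+x\<in>{0<..<d}. ennreal (1 / \<rho> x) \<partial>lborel)"
  proof (rule nn_integral_LIMSEQ[OF _ _ lim])
    show "incseq ?f"
    proof (intro incseq_SucI le_funI)
      fix n x
      have "1 / (\<rho> x + 1 / real (Suc n)) \<le> 1 / (\<rho> x + 1 / real (Suc (Suc n)))"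
        using nz[of x n] nz[of x "Suc n"] by (intro divide_left_mono mult_pos_pos add_left_mono) (auto simp: frac_le simp del: of_nat_Suc)
      then show "?f n x \<le> ?f (Suc n) x"
        by (auto intro!: mult_right_mono ennreal_leI simp del: of_nat_Suc)
    qed
  qed measurable
  then have "(\<lambda>n. integral\<^sup>N lborel (?f n)) \<longlonglongrightarrow> top" using Osgood by (simp add: infinity_ennreal_def)
  then have "eventually (\<lambda>n. integral\<^sup>N lborel (?f n) > ennreal R) sequentially"
    by (rule order_tendstoD) simp
  then obtain n where "integral\<^sup>N lborel (?f n) > ennreal R" by (auto simp: eventually_sequentially)
  then show thesis by (intro that[of "1 / real (Suc n)"]) auto
qed

text \<open>Increments shorter than \<open>d\<close> cost at most \<open>e\<close>; for longer ones
  the total range \<open>L\<close> is below \<open>L / d\<close> times the increment. In the Taylor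
  bound this turns the oscillation of the second derivative into a cubic term, which can be traded
  for a quartic one.\<close>

lemma uniform_modulus_linear:
  fixes f :: "real \<Rightarrow> real"
  assumes uc: "uniformly_continuous_on UNIV f" and L: "\<And>x. 0 \<le> f x \<and> f x \<le> L" and e: "e > 0"
  obtains D where "D \<ge> 0" "\<And>x y. f y \<le> f x + e + D * \<bar>y - x\<bar>"
proof -
  obtain d where d: "d > 0" "\<And>x y. dist x y < d \<Longrightarrow> dist (f x) (f y) < e"
    using uc e unfolding uniformly_continuous_on_def by (metis UNIV_I)
  have L0: "L \<ge> 0" using L[of 0] by linarith
  have "f y \<le> f x + e + (L / d) * \<bar>y - x\<bar>" for x y
  proof (cases "\<bar>y - x\<bar> < d")
    case True
    then have "\<bar>f y - f x\<bar> < e" using d(2)[of y x] by (simp add: dist_real_def)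
    moreover have "(L / d) * \<bar>y - x\<bar> \<ge> 0" using L0 d(1) by simp
    ultimately show ?thesis by linarith
  next
    case False
    have "(L / d) * \<bar>y - x\<bar> \<ge> (L / d) * d" using False L0 d(1) by (intro mult_left_mono) auto
    then have "(L / d) * \<bar>y - x\<bar> \<ge> L" using d(1) by simp
    then show ?thesis using L[of y] L[of x] e by linarith
  qed
  then show thesis using L0 d(1) by (intro that[of "L / d"]) auto
qed

lemma Taylor2:
  fixes f f' f'' :: "real \<Rightarrow> real"
  assumes f: "\<And>x. (f has_real_derivative f' x) (at x)" and f': "\<And>x. (f' has_real_derivative f'' x) (at x)"
  obtains t where "\<bar>t - x\<bar> \<le> \<bar>h\<bar>" "f (x + h) = f x + f' x * h + f'' t * h\<^sup>2 / 2"
proof (cases "h = 0")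
  case False
  define diff where "diff m = (if m = 0 then f else if m = 1 then f' else f'')" for m :: nat
  have "\<exists>t. (if x + h < x then x + h < t \<and> t < x else x < t \<and> t < x + h) \<and>
      f (x + h) = (\<Sum>m<2. (diff m x / fact m) * (x + h - x)^m) + (diff 2 t / fact 2) * (x + h - x)^2"
    by (rule Taylor[where a = "x - \<bar>h\<bar>" and b = "x + \<bar>h\<bar>"])
       (use False f f' in \<open>auto simp: diff_def less_2_cases_iff\<close>)
  then obtain t where t: "if x + h < x then x + h < t \<and> t < x else x < t \<and> t < x + h"
      "f (x + h) = (\<Sum>m<2. (diff m x / fact m) * (x + h - x)^m) + (diff 2 t / fact 2) * (x + h - x)^2"
    by blast
  show thesis
  proof (rule that[of t])
    show "\<bar>t - x\<bar> \<le> \<bar>h\<bar>" using t(1) by (auto split: if_splits)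
    show "f (x + h) = f x + f' x * h + f'' t * h\<^sup>2 / 2"
      using t(2) by (simp add: diff_def numeral_2_eq_2)
  qed
qed (use that[of x] in auto)

text \<open>In the application \<open>g\<close> is the increment with frozen coefficient and \<open>e\<close> the discretization error,
  which must enter beyond first order only through its square.\<close>

lemma Taylor_upper_bound:
  fixes \<phi> \<phi>' \<psi> :: "real \<Rightarrow> real"
  assumes d: "\<And>x. (\<phi> has_real_derivative \<phi>' x) (at x)" "\<And>x. (\<phi>' has_real_derivative \<psi> x) (at x)"
    and uc: "uniformly_continuous_on UNIV \<psi>" and L: "\<And>x. 0 \<le> \<psi> x \<and> \<psi> x \<le> L" and \<eta>: "\<eta> > 0"
  obtains C where "C \<ge> 0" "\<And>x g e. \<phi> (x + (g + e)) \<le> \<phi> x + \<phi>' x * (g + e) + \<psi> x * g\<^sup>2 / 2 + \<eta> * g\<^sup>2 + C * g^4 + C * e\<^sup>2"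
proof -
  have L0: "L \<ge> 0" using L[of 0] by linarith
  obtain D where D: "D \<ge> 0" "\<And>x y. \<psi> y \<le> \<psi> x + \<eta>/2 + D * \<bar>y - x\<bar>"
    using uniform_modulus_linear[OF uc L, of "\<eta>/2"] \<eta> by auto
  \<comment> \<open>The three summands pay for the oscillation of \<psi> (times \<open>g^4\<close>),
    for the cross term between \<open>g\<close> and \<open>e\<close>, and for the second-order
    remainder in \<open>e\<close>.\<close>
  define C where "C = D\<^sup>2 / \<eta> + L\<^sup>2 / \<eta> + L"
  have amgm: "u * v \<le> \<eta> / 4 * u\<^sup>2 + v\<^sup>2 / \<eta>" for u v :: real
  proof -
    have "0 \<le> (\<eta> * u / 2 - v)\<^sup>2 / \<eta>" using \<eta> by simp
    also have "\<dots> = \<eta> / 4 * u\<^sup>2 + v\<^sup>2 / \<eta> - u * v"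
      using \<eta> by (simp add: power2_eq_square field_simps)
    finally show ?thesis by simp
  qed
  have "\<phi> (x + (g + e)) \<le> \<phi> x + \<phi>' x * (g + e) + \<psi> x * g\<^sup>2 / 2 + \<eta> * g\<^sup>2 + C * g^4 + C * e\<^sup>2" for x g e
  proof -
    \<comment> \<open>The expansion goes first by \<open>e\<close> around \<open>x + g\<close>, then
      by \<open>g\<close> around \<open>x\<close>. Replacing \<open>\<phi>' (x + g)\<close> by
      \<open>\<phi>' x\<close> produces the cross term, bounded by the Lipschitz constant
      \<open>L\<close> of \<open>\<phi>'\<close> and Young's inequality \<open>amgm\<close>.\<close>
    obtain t where t: "\<phi> ((x + g) + e) = \<phi> (x + g) + \<phi>' (x + g) * e + \<psi> t * e\<^sup>2 / 2"
      by (rule Taylor2[OF d])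
    obtain r where r: "\<bar>r - x\<bar> \<le> \<bar>g\<bar>" "\<phi> (x + g) = \<phi> x + \<phi>' x * g + \<psi> r * g\<^sup>2 / 2"
      by (rule Taylor2[OF d])
    have lip: "\<bar>\<phi>' (x + g) - \<phi>' x\<bar> \<le> L * \<bar>g\<bar>"
    proof -
      have "norm (\<phi>' (x + g) - \<phi>' x) \<le> L * norm (x + g - x)"
        by (rule field_differentiable_bound[of UNIV \<phi>' \<psi>]) (use d(2) L in auto)
      then show ?thesis by simp
    qed
    have 1: "\<psi> t * e\<^sup>2 \<le> L * e\<^sup>2" using L[of t] by (intro mult_right_mono) auto
    have "(\<phi>' (x + g) - \<phi>' x) * e \<le> \<bar>\<phi>' (x + g) - \<phi>' x\<bar> * \<bar>e\<bar>" by (metis abs_ge_self abs_mult)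
    also have "\<dots> \<le> (L * \<bar>g\<bar>) * \<bar>e\<bar>" using lip by (intro mult_right_mono) auto
    also have "\<dots> = \<bar>g\<bar> * (L * \<bar>e\<bar>)" by simp
    also have "\<dots> \<le> \<eta> / 4 * \<bar>g\<bar>\<^sup>2 + (L * \<bar>e\<bar>)\<^sup>2 / \<eta>" by (rule amgm)
    finally have 2: "(\<phi>' (x + g) - \<phi>' x) * e \<le> \<eta> / 4 * g\<^sup>2 + L\<^sup>2 / \<eta> * e\<^sup>2" by (simp add: power_mult_distrib)
    have "\<psi> r \<le> \<psi> x + \<eta>/2 + D * \<bar>g\<bar>" using D(2)[where x=x and y=r] r(1) D(1)
      by (smt (verit) mult_left_mono)
    then have "\<psi> r * g\<^sup>2 \<le> (\<psi> x + \<eta>/2 + D * \<bar>g\<bar>) * g\<^sup>2" by (intro mult_right_mono) auto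
    moreover have "D * \<bar>g\<bar> * g\<^sup>2 \<le> \<eta> / 4 * g\<^sup>2 + D\<^sup>2 / \<eta> * g^4"
      using amgm[of "\<bar>g\<bar>" "D * g\<^sup>2"] by (simp add: power_mult_distrib mult_ac flip: power_mult)
    ultimately have 3: "\<psi> r * g\<^sup>2 \<le> \<psi> x * g\<^sup>2 + \<eta> * g\<^sup>2 + D\<^sup>2 / \<eta> * g^4"
      using mult_nonneg_nonneg[OF less_imp_le[OF \<eta>] zero_le_power2[of g]]
      unfolding distrib_right by linarith
    have "\<phi> (x + (g + e)) = \<phi> x + \<phi>' x * (g + e) + \<psi> r * g\<^sup>2 / 2 + (\<phi>' (x + g) - \<phi>' x) * e + \<psi> t * e\<^sup>2 / 2"
      using t r(2) by (simp add: algebra_simps)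
    also have "\<dots> \<le> \<phi> x + \<phi>' x * (g + e) + (\<psi> x * g\<^sup>2 + \<eta> * g\<^sup>2 + D\<^sup>2 / \<eta> * g^4)/2 + (\<eta> / 4 * g\<^sup>2 + L\<^sup>2 / \<eta> * e\<^sup>2) + L * e\<^sup>2 / 2"
      using 1 2 3 by (intro add_mono divide_right_mono order_refl) simp_all
    also have "\<dots> \<le> \<phi> x + \<phi>' x * (g + e) + \<psi> x * g\<^sup>2 / 2 + \<eta> * g\<^sup>2 + C * g^4 + C * e\<^sup>2"
    proof -
      have gen: "a + (p0 + h + p) / 2 + (h' + q2) + l2 / 2 \<le> a + p0 / 2 + h + (p + q + l) + (p2 + q2 + l2)"
        if "0 \<le> p" "0 \<le> q" "0 \<le> l" "0 \<le> p2" "0 \<le> l2" "h' \<le> h / 2" for a p0 h p h' q2 l2 q l p2 :: real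
        using that by (simp add: field_simps)
      show ?thesis
        unfolding C_def distrib_right by (rule gen) (use \<eta> L0 in auto)
    qed
    finally show ?thesis .
  qed
  then show thesis using \<eta> L0 by (intro that[of C]) (auto simp: C_def)
qed

text \<open>The second derivative is a tent function times
  \<open>1 / (s\<^sup>2 + \<epsilon>)\<close>, divided by its mass \<open>D\<close> on the positive
  half-line. The product with \<open>s\<^sup>2\<close> is then at most \<open>1 / D\<close>, and
  Osgood's condition makes \<open>D\<close> as large as desired; the tent confines all curvature to
  distance \<kappa> from 0, so the slope is 1 beyond.\<close>

lemma Yamada_Watanabe_function:
  fixes \<rho> s :: "real \<Rightarrow> real"
  assumes pos: "\<And>x. \<rho> x > 0" and [measurable]: "\<rho> \<in> borel_measurable borel"
    and Osgood: "\<And>d. d > 0 \<Longrightarrow> (\<integral>\<^sup>+x\<in>{0<..<d}. ennreal (1 / \<rho> x) \<partial>lborel) = \<infinity>"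
    and s: "continuous_on UNIV s" "\<And>r. r > 0 \<Longrightarrow> (s r)\<^sup>2 \<le> \<rho> r"
    and \<kappa>: "\<kappa> > 0"
  obtains \<phi> \<phi>' \<psi> L where "\<And>x. (\<phi> has_real_derivative \<phi>' x) (at x)" "\<And>x. (\<phi>' has_real_derivative \<psi> x) (at x)"
    "\<phi> 0 = 0" "\<And>x. \<bar>\<phi>' x\<bar> \<le> 1" "\<And>x. 0 \<le> \<psi> x \<and> \<psi> x \<le> L" "uniformly_continuous_on UNIV \<psi>"
    "\<And>x. \<psi> x * (s \<bar>x\<bar>)\<^sup>2 \<le> \<kappa>" "\<And>x. \<bar>x\<bar> - \<kappa> \<le> \<phi> x"
proof -
  \<comment> \<open>On the left half of \<open>{0..\<kappa>}\<close> the tent is at least 1/2, so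
    mass \<open>2 / \<kappa>\<close> there yields \<open>D > 1 / \<kappa>\<close> below.\<close>
  obtain \<epsilon> where \<epsilon>: "\<epsilon> > 0" "(\<integral>\<^sup>+x\<in>{0<..<\<kappa>/2}. ennreal (1 / (\<rho> x + \<epsilon>)) \<partial>lborel) > ennreal (2 / \<kappa>)"
    using Osgood_regularized[OF pos _ Osgood[of "\<kappa>/2"], of "2/\<kappa>"] \<kappa> by auto
  define f where "f x = max 0 (1 - \<bar>x\<bar> / \<kappa>) / ((s \<bar>x\<bar>)\<^sup>2 + \<epsilon>)" for x
  have den: "(s \<bar>x\<bar>)\<^sup>2 + \<epsilon> > 0" for x using \<epsilon>(1) by (simp add: add_nonneg_pos)
  have cf: "continuous_on UNIV f"
    unfolding f_def using den by (intro continuous_intros continuous_on_compose2[OF s(1)]) (auto simp: less_imp_neq[symmetric] \<kappa> less_imp_neq[OF den, symmetric] less_imp_neq[OF \<kappa>, symmetric])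
  have f0: "f x \<ge> 0" for x using den[of x] by (simp add: f_def)
  have fz: "f x = 0" if "\<bar>x\<bar> \<ge> \<kappa>" for x using that \<kappa> by (simp add: f_def max_def field_simps)
  obtain G where G: "\<And>x. (G has_real_derivative f x) (at x)" "G 0 = 0"
    using antiderivative_UNIV[OF cf] by blast
  define D where "D = G \<kappa>"
  have "(\<integral>\<^sup>+x\<in>{0<..<\<kappa>/2}. ennreal (1 / (\<rho> x + \<epsilon>)) \<partial>lborel) \<le> (\<integral>\<^sup>+x. 2 * (ennreal (f x) * indicator {0..\<kappa>} x) \<partial>lborel)"
  proof (rule nn_integral_mono)
    fix x show "ennreal (1 / (\<rho> x + \<epsilon>)) * indicator {0<..<\<kappa>/2} x \<le> 2 * (ennreal (f x) * indicator {0..\<kappa>} x)"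
    proof (cases "0 < x \<and> x < \<kappa>/2")
      case True
      then have a: "1/2 \<le> 1 - x / \<kappa>" using \<kappa> by (simp add: field_simps)
      have "1 / (\<rho> x + \<epsilon>) \<le> 1 / ((s x)\<^sup>2 + \<epsilon>)"
        using s(2)[of x] True den[of x] pos[of x] \<epsilon>(1) by (intro divide_left_mono mult_pos_pos) auto
      also have "\<dots> \<le> 2 * f x"
        using True a den[of x] by (simp add: f_def max_def divide_simps)
      finally have "ennreal (1 / (\<rho> x + \<epsilon>)) \<le> ennreal (2 * f x)" by (rule ennreal_leI)
      then show ?thesis using True \<kappa> f0[of x] by (simp add: ennreal_mult)
    qed auto
  qed
  also have "\<dots> = 2 * (\<integral>\<^sup>+x. ennreal (f x) * indicator {0..\<kappa>} x \<partial>lborel)"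
    using borel_measurable_continuous_onI[OF cf] by (intro nn_integral_cmult) auto
  also have "(\<integral>\<^sup>+x. ennreal (f x) * indicator {0..\<kappa>} x \<partial>lborel) = ennreal (G \<kappa> - G 0)"
    by (rule nn_integral_FTC_Icc) (use G f0 \<kappa> borel_measurable_continuous_onI[OF cf] in auto)
  finally have "ennreal (2 / \<kappa>) < 2 * ennreal D" using \<epsilon>(2) G(2) by (simp add: D_def)
  moreover have "2 * ennreal D = ennreal (2 * D)" by (simp add: ennreal_mult')
  ultimately have "2 / \<kappa> < 2 * D" using \<kappa> by (simp add: ennreal_less_iff)
  then have D: "1 / \<kappa> < D" by simp
  moreover have "1 / \<kappa> > 0" using \<kappa> by simp
  ultimately have "D > 0" by linarith
  note D = D this
  define \<psi> where "\<psi> x = f x / D" for x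
  define \<phi>' where "\<phi>' x = G x / D" for x
  have d2: "(\<phi>' has_real_derivative \<psi> x) (at x)" for x
    unfolding \<phi>'_def \<psi>_def by (rule DERIV_cdivide[OF G(1)])
  have c\<phi>': "continuous_on UNIV \<phi>'" using d2 DERIV_isCont by (force simp: continuous_on_eq_continuous_at)
  obtain \<phi> where \<phi>: "\<And>x. (\<phi> has_real_derivative \<phi>' x) (at x)" "\<phi> 0 = 0"
    using antiderivative_UNIV[OF c\<phi>'] by blast
  have \<psi>0: "\<psi> x \<ge> 0" for x using f0[of x] D by (simp add: \<psi>_def)
  have mono: "\<phi>' x \<le> \<phi>' y" if "x \<le> y" for x y
    using DERIV_nonneg_imp_nondecreasing[OF that, of \<phi>'] d2 \<psi>0 by blast
  \<comment> \<open>Since \<open>f\<close> is even, \<open>\<phi>'\<close> is odd and \<phi> is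
    even; this reduces the bounds on \<phi> and \<open>\<phi>'\<close> to the positive
    half-line.\<close>
  have "\<exists>c. \<forall>x. \<phi>' x + \<phi>' (- x) = c"
  proof -
    have "((\<lambda>x. \<phi>' x + \<phi>' (- x)) has_real_derivative 0) (at x)" for x
    proof -
      have "((\<lambda>x. \<phi>' x + \<phi>' (- x)) has_real_derivative (\<psi> x + \<psi> (- x) * (-1))) (at x)"
        by (intro DERIV_add d2 DERIV_chain2[of \<phi>'] derivative_eq_intros) auto
      then show ?thesis by (simp add: \<psi>_def f_def)
    qed
    then have "\<phi>' x + \<phi>' (- x) = \<phi>' 0 + \<phi>' (- 0)" for x
      by (intro DERIV_isconst_all[of "\<lambda>x. \<phi>' x + \<phi>' (- x)"]) blast
    then show ?thesis by blast
  qed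
  then have odd: "\<phi>' (- x) = - \<phi>' x" for x
    using G(2) by (auto simp: \<phi>'_def) (metis add.right_neutral add_eq_0_iff div_0 neg_0_equal_iff_equal)
  have even: "\<phi> (- x) = \<phi> x" for x
  proof -
    have "((\<lambda>x. \<phi> (- x) - \<phi> x) has_real_derivative 0) (at x)" for x
    proof -
      have "((\<lambda>x. \<phi> (- x) - \<phi> x) has_real_derivative (\<phi>' (- x) * (-1) - \<phi>' x)) (at x)"
        by (intro DERIV_diff \<phi>(1) DERIV_chain2[of \<phi>] derivative_eq_intros) auto
      then show ?thesis by (simp add: odd)
    qed
    then have "\<phi> (- x) - \<phi> x = \<phi> (- 0) - \<phi> 0"
      by (intro DERIV_isconst_all[of "\<lambda>x. \<phi> (- x) - \<phi> x"]) blast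
    then show ?thesis by simp
  qed
  \<comment> \<open>Beyond \<kappa> the integrand \<open>f\<close> vanishes, so \<open>G\<close>
    stays at its value \<open>D\<close>, by which \<open>\<phi>'\<close> was normalized.\<close>
  have one: "\<phi>' x = 1" if "x \<ge> \<kappa>" for x
  proof -
    have "\<phi>' x = \<phi>' \<kappa>"
    proof (rule antisym)
      have "G x \<le> G \<kappa>"
        by (rule DERIV_nonpos_imp_nonincreasing[OF that]) (use G(1) fz \<kappa> in \<open>force\<close>)
      then show "\<phi>' x \<le> \<phi>' \<kappa>" using D by (simp add: \<phi>'_def divide_right_mono)
    qed (use mono that in auto)
    then show ?thesis using D by (simp add: \<phi>'_def D_def)
  qed
  have nonneg: "0 \<le> \<phi>' x" if "x \<ge> 0" for x using mono[OF that] G(2) by (simp add: \<phi>'_def)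
  have le1: "\<phi>' x \<le> 1" for x using one[of "max x \<kappa>"] mono[of x "max x \<kappa>"] by simp
  have \<phi>0: "\<phi> x \<ge> 0" if "x \<ge> 0" for x
    using DERIV_nonneg_imp_nondecreasing[OF that, of \<phi>] \<phi> nonneg by force
  have \<phi>low: "x - \<kappa> \<le> \<phi> x" if "x \<ge> 0" for x
  proof (cases "x \<le> \<kappa>")
    case True then show ?thesis using \<phi>0[OF that] by simp
  next
    case False
    then have "\<kappa> \<le> x" by simp
    have "\<phi> \<kappa> - \<kappa> \<le> \<phi> x - x"
    proof (rule DERIV_nonneg_imp_nondecreasing[OF \<open>\<kappa> \<le> x\<close>, of "\<lambda>x. \<phi> x - x"])
      fix z assume "\<kappa> \<le> z" "z \<le> x"
      have "((\<lambda>x. \<phi> x - x) has_real_derivative (\<phi>' z - 1)) (at z)"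
        by (intro DERIV_diff \<phi>(1) DERIV_ident)
      then show "\<exists>y. ((\<lambda>x. \<phi> x - x) has_real_derivative y) (at z) \<and> 0 \<le> y"
        using one[OF \<open>\<kappa> \<le> z\<close>] by (intro exI[of _ "\<phi>' z - 1"]) simp
    qed
    then show ?thesis using \<phi>0[of \<kappa>] \<kappa> by simp
  qed
  have c\<psi>: "continuous_on UNIV \<psi>" unfolding \<psi>_def using cf D by (intro continuous_intros) auto
  obtain L where L: "\<And>x. x \<in> {-\<kappa>..\<kappa>} \<Longrightarrow> \<psi> x \<le> L"
  proof -
    have "bounded (\<psi> ` {-\<kappa>..\<kappa>})"
      by (intro compact_imp_bounded compact_continuous_image continuous_on_subset[OF c\<psi>]) auto
    then show thesis using that by (force simp: bounded_iff abs_le_iff)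
  qed
  have \<psi>z: "\<psi> x = 0" if "\<bar>x\<bar> \<ge> \<kappa>" for x using fz[OF that] by (simp add: \<psi>_def)
  \<comment> \<open>Compact support upgrades continuity. With the margin 1, two points closer than 1
    lie either both in the enlarged interval or both where \<psi> vanishes.\<close>
  have uc: "uniformly_continuous_on UNIV \<psi>"
    unfolding uniformly_continuous_on_def
  proof (intro allI impI)
    fix e :: real assume e: "0 < e"
    have "uniformly_continuous_on {-\<kappa>-1..\<kappa>+1} \<psi>"
      by (intro compact_uniformly_continuous continuous_on_subset[OF c\<psi>]) auto
    then obtain d where d: "d > 0" "\<And>x y. x \<in> {-\<kappa>-1..\<kappa>+1} \<Longrightarrow> y \<in> {-\<kappa>-1..\<kappa>+1} \<Longrightarrow> dist y x < d \<Longrightarrow> dist (\<psi> y) (\<psi> x) < e"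
      using e unfolding uniformly_continuous_on_def by metis
    have "dist (\<psi> y) (\<psi> x) < e" if "dist y x < min d 1" for x y
    proof (cases "x \<in> {-\<kappa>-1..\<kappa>+1} \<and> y \<in> {-\<kappa>-1..\<kappa>+1}")
      case True then show ?thesis using d(2) that by auto
    next
      case False
      then have "\<bar>x\<bar> \<ge> \<kappa>" "\<bar>y\<bar> \<ge> \<kappa>" using that by (auto simp: dist_real_def abs_if split: if_splits)
      then show ?thesis using \<psi>z e by simp
    qed
    then show "\<exists>d>0. \<forall>x\<in>UNIV. \<forall>x'\<in>UNIV. dist x' x < d \<longrightarrow> dist (\<psi> x') (\<psi> x) < e"
      using d(1) by (intro exI[of _ "min d 1"]) auto
  qed
  show thesis
  proof (rule that[of \<phi> \<phi>' \<psi> L])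
    show "\<bar>\<phi>' x\<bar> \<le> 1" for x using le1[of x] le1[of "-x"] odd[of x] by linarith
    show "0 \<le> \<psi> x \<and> \<psi> x \<le> L" for x
      using \<psi>0[of x] L[of x] \<psi>z[of x] L[of \<kappa>] \<psi>0[of \<kappa>] \<kappa> by (cases "x \<in> {-\<kappa>..\<kappa>}") (auto simp: abs_if split: if_splits)
    show "\<psi> x * (s \<bar>x\<bar>)\<^sup>2 \<le> \<kappa>" for x
    proof -
      have "f x * (s \<bar>x\<bar>)\<^sup>2 \<le> 1 / ((s \<bar>x\<bar>)\<^sup>2 + \<epsilon>) * (s \<bar>x\<bar>)\<^sup>2"
        unfolding f_def using den[of x] \<kappa> by (intro mult_right_mono divide_right_mono) auto
      also have "\<dots> \<le> 1" using den[of x] \<epsilon>(1) by (simp add: divide_simps)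
      finally have "\<psi> x * (s \<bar>x\<bar>)\<^sup>2 \<le> 1 / D" using D by (simp add: \<psi>_def divide_right_mono)
      also have "\<dots> \<le> \<kappa>" using D \<kappa> by (simp add: field_simps)
      finally show ?thesis .
    qed
    show "\<bar>x\<bar> - \<kappa> \<le> \<phi> x" for x
      using \<phi>low[of x] \<phi>low[of "-x"] even[of x] by (cases "x \<ge> 0") auto
  qed (use \<phi> d2 uc in auto)
qed

section \<open>Elementary integrals against Brownian motion\<close>

lemma (in prob_space) bounded_integrable:
  fixes f :: "'a \<Rightarrow> real"
  assumes "f \<in> borel_measurable M" "bounded (f ` space M)"
  shows "integrable M f"
proof -
  obtain K where "\<And>\<omega>. \<omega> \<in> space M \<Longrightarrow> norm (f \<omega>) \<le> K" using assms(2) by (auto simp: bounded_iff)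
  then show ?thesis using assms(1) by (intro integrable_const_bound[of _ K]) auto
qed

lemma bounded_mult_image:
  fixes f g :: "'a \<Rightarrow> real"
  assumes "bounded (f ` A)" "bounded (g ` A)"
  shows "bounded ((\<lambda>\<omega>. f \<omega> * g \<omega>) ` A)"
proof -
  obtain K K' where "\<And>\<omega>. \<omega> \<in> A \<Longrightarrow> \<bar>f \<omega>\<bar> \<le> K" "\<And>\<omega>. \<omega> \<in> A \<Longrightarrow> \<bar>g \<omega>\<bar> \<le> K'"
    using assms by (auto simp: bounded_iff)
  then have "\<And>\<omega>. \<omega> \<in> A \<Longrightarrow> \<bar>f \<omega> * g \<omega>\<bar> \<le> K * K'"
    unfolding abs_mult by (intro mult_mono) (auto intro: order.trans[OF abs_ge_zero])
  then show ?thesis by (auto simp: bounded_iff)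
qed

section \<open>Moments and covariances of Brownian increments\<close>

locale brownian_filtration = prob_space M for M :: "'w measure" +
  fixes F :: "real \<Rightarrow> 'w measure" and W :: "real \<Rightarrow> 'w \<Rightarrow> real"
  assumes filtration: "filtered_prob_space M F" and brownian: "brownian_motion M F W"
begin

lemma measurable_M: "0 \<le> t \<Longrightarrow> f \<in> borel_measurable (F t) \<Longrightarrow> f \<in> borel_measurable M"
  using filtration measurable_from_subalg unfolding filtered_prob_space_def by blast

lemma measurable_later: "0 \<le> s \<Longrightarrow> s \<le> t \<Longrightarrow> f \<in> borel_measurable (F s) \<Longrightarrow> f \<in> borel_measurable (F t)"
  using filtration measurable_from_subalg unfolding filtered_prob_space_def by blast

lemma W_adapted: "0 \<le> t \<Longrightarrow> W t \<in> borel_measurable (F t)"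
  using brownian by (simp add: brownian_motion_def adapted_process_def)

lemma W_measurable: "0 \<le> t \<Longrightarrow> W t \<in> borel_measurable M"
  by (rule measurable_M) (auto intro: W_adapted)

lemma increment_distributed:
  "0 \<le> s \<Longrightarrow> s < t \<Longrightarrow> distributed M lborel (\<lambda>\<omega>. W t \<omega> - W s \<omega>) (normal_density 0 (sqrt (t - s)))"
  using brownian by (simp add: brownian_motion_def)

text \<open>The degenerate case \<open>s = t\<close> is separate because the definition of Brownian
  motion speaks only of \<open>s < t\<close>. The second moment enters the isometry and the
  second-order term, the fourth moment the quartic term of the Taylor bound.\<close>

lemma increment_moment_even:
  assumes "0 \<le> s" "s \<le> t"
  shows "expectation (\<lambda>\<omega>. (W t \<omega> - W s \<omega>) ^ (2 * k)) = fact (2 * k) / (2 ^ k * fact k) * (t - s) ^ k"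
proof (cases "s = t")
  case False
  then have "s < t" using assms by simp
  note d = increment_distributed[OF assms(1) this]
  have "expectation (\<lambda>\<omega>. (W t \<omega> - W s \<omega>) ^ (2 * k)) = (\<integral>x. normal_density 0 (sqrt (t - s)) x * x ^ (2 * k) \<partial>lborel)"
    by (rule distributed_integral[OF d, symmetric]) auto
  also have "\<dots> = fact (2 * k) / ((2 / (sqrt (t - s))\<^sup>2)^k * fact k)"
    using integral_normal_moment_even[of "sqrt (t - s)" 0 k] \<open>s < t\<close> by simp
  also have "\<dots> = fact (2 * k) / (2 ^ k * fact k) * (t - s) ^ k"
    using \<open>s < t\<close> by (simp add: power_divide)
  finally show ?thesis .
qed (cases k; simp add: prob_space)

lemma increment_moment_1:
  assumes "0 \<le> s" "s \<le> t"
  shows "expectation (\<lambda>\<omega>. W t \<omega> - W s \<omega>) = 0"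
proof (cases "s = t")
  case False
  then have "s < t" using assms by simp
  note d = increment_distributed[OF assms(1) this]
  have "expectation (\<lambda>\<omega>. W t \<omega> - W s \<omega>) = (\<integral>x. normal_density 0 (sqrt (t - s)) x * x \<partial>lborel)"
    by (rule distributed_integral[OF d, symmetric]) auto
  also have "\<dots> = 0"
    using integral_normal_moment_odd[of "sqrt (t - s)" 0 0] \<open>s < t\<close> by simp
  finally show ?thesis .
qed simp

lemma increment_moment_2:
  "0 \<le> s \<Longrightarrow> s \<le> t \<Longrightarrow> expectation (\<lambda>\<omega>. (W t \<omega> - W s \<omega>)\<^sup>2) = t - s"
  using increment_moment_even[of s t 1] by (simp add: eval_nat_numeral)

lemma increment_moment_4:
  "0 \<le> s \<Longrightarrow> s \<le> t \<Longrightarrow> expectation (\<lambda>\<omega>. (W t \<omega> - W s \<omega>) ^ 4) = 3 * (t - s)\<^sup>2"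
  using increment_moment_even[of s t 2] by (simp add: eval_nat_numeral)

lemma increment_integrable:
  assumes "0 \<le> s" "s \<le> t"
  shows "integrable M (\<lambda>\<omega>. (W t \<omega> - W s \<omega>) ^ k)"
proof (cases "s = t")
  case False
  then have "s < t" using assms by simp
  note d = increment_distributed[OF assms(1) this]
  have "integrable lborel (\<lambda>x. normal_density 0 (sqrt (t - s)) x * x ^ k)"
    using integrable_normal_moment[of "sqrt (t - s)" 0 k] \<open>s < t\<close> by simp
  then show ?thesis
    by (subst (asm) distributed_integrable[OF d]) auto
qed simp

text \<open>For \<open>s < t\<close>, \<sigma>-algebras contained in independent ones are
  independent: that of \<open>f\<close> lies in \<open>F s\<close>, that of the power in the one
  generated by the increment. Hence the expectation factorizes.\<close>

lemma
  assumes st: "0 \<le> s" "s \<le> t" and f: "f \<in> borel_measurable (F s)" "integrable M f"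
  shows integrable_mult_increment: "integrable M (\<lambda>\<omega>. f \<omega> * (W t \<omega> - W s \<omega>) ^ k)"
    and expectation_mult_increment:
      "expectation (\<lambda>\<omega>. f \<omega> * (W t \<omega> - W s \<omega>) ^ k) = expectation f * expectation (\<lambda>\<omega>. (W t \<omega> - W s \<omega>) ^ k)"
proof -
  have "integrable M (\<lambda>\<omega>. f \<omega> * (W t \<omega> - W s \<omega>) ^ k) \<and>
      expectation (\<lambda>\<omega>. f \<omega> * (W t \<omega> - W s \<omega>) ^ k) = expectation f * expectation (\<lambda>\<omega>. (W t \<omega> - W s \<omega>) ^ k)"
  proof (cases "s = t")
    case True
    then show ?thesis using f by (cases k) (auto simp: prob_space)
  next
    case False
    then have "s < t" using st by simp
    let ?D = "\<lambda>\<omega>. W t \<omega> - W s \<omega>"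
    have Dm[measurable]: "?D \<in> borel_measurable M"
      using W_measurable[of s] W_measurable[of t] st by auto
    have fm: "f \<in> borel_measurable M" using f st measurable_M by blast
    have spF: "space (F s) = space M"
      using filtration st by (simp add: filtered_prob_space_def subalgebra_def)
    have ind: "indep_set (sets (F s)) (sets (vimage_algebra (space M) ?D borel))"
      using brownian st \<open>s < t\<close> by (simp add: brownian_motion_def)
    have "indep_set (sigma_sets (space M) {f -` A \<inter> space M | A. A \<in> sets borel})
        (sigma_sets (space M) {(\<lambda>\<omega>. ?D \<omega> ^ k) -` A \<inter> space M | A. A \<in> sets borel})"
      unfolding indep_set_def
    proof (rule indep_sets_mono_sets[OF ind[unfolded indep_set_def]])
      have 1: "sigma_sets (space M) {f -` A \<inter> space M | A. A \<in> sets borel} \<subseteq> sets (F s)"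
        unfolding spF[symmetric] by (intro sets.sigma_sets_subset) (use f(1) in \<open>auto simp: measurable_sets\<close>)
      have "(\<lambda>\<omega>. ?D \<omega> ^ k) \<in> borel_measurable (vimage_algebra (space M) ?D borel)"
        by (intro borel_measurable_power measurable_vimage_algebra1) auto
      then have 2: "sigma_sets (space M) {(\<lambda>\<omega>. ?D \<omega> ^ k) -` A \<inter> space M | A. A \<in> sets borel} \<subseteq> sets (vimage_algebra (space M) ?D borel)"
        using sets.sigma_sets_subset[of "{(\<lambda>\<omega>. ?D \<omega> ^ k) -` A \<inter> space M | A. A \<in> sets borel}" "vimage_algebra (space M) ?D borel"]
        by (force dest: measurable_sets)
      show "(case i of True \<Rightarrow> sigma_sets (space M) {f -` A \<inter> space M | A. A \<in> sets borel}
           | False \<Rightarrow> sigma_sets (space M) {(\<lambda>\<omega>. ?D \<omega> ^ k) -` A \<inter> space M | A. A \<in> sets borel})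
         \<subseteq> (case i of True \<Rightarrow> sets (F s) | False \<Rightarrow> sets (vimage_algebra (space M) ?D borel))" for i
        using 1 2 by (cases i) auto
    qed
    then have "indep_var borel f borel (\<lambda>\<omega>. ?D \<omega> ^ k)"
      unfolding indep_var_eq using fm by auto
    then show ?thesis
      using indep_var_lebesgue_integral indep_var_integrable f(2) increment_integrable[OF st, of k] by blast
  qed
  then show "integrable M (\<lambda>\<omega>. f \<omega> * (W t \<omega> - W s \<omega>) ^ k)"
    "expectation (\<lambda>\<omega>. f \<omega> * (W t \<omega> - W s \<omega>) ^ k) = expectation f * expectation (\<lambda>\<omega>. (W t \<omega> - W s \<omega>) ^ k)"
    by auto
qed

lemma
  assumes st: "0 \<le> s" "s \<le> t" and f: "f \<in> borel_measurable (F s)" "integrable M f"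
  shows integrable_mult_increment_1: "integrable M (\<lambda>\<omega>. f \<omega> * (W t \<omega> - W s \<omega>))"
    and expectation_mult_increment_1: "expectation (\<lambda>\<omega>. f \<omega> * (W t \<omega> - W s \<omega>)) = 0"
  using integrable_mult_increment[OF assms, of 1] expectation_mult_increment[OF assms, of 1]
    increment_moment_1[OF st] by simp_all

text \<open>Only the overlap of the two intervals contributes: every piece in which one Brownian
  increment comes after everything else has mean 0 by independence.\<close>

lemma increment_covariance_ordered:
  assumes ab: "0 \<le> a" "a \<le> b" "a' \<le> b'" "a \<le> a'"
    and \<xi>: "\<xi> \<in> borel_measurable (F a)" "bounded (\<xi> ` space M)"
    and \<xi>': "\<xi>' \<in> borel_measurable (F a')" "bounded (\<xi>' ` space M)"
  shows "has_bochner_integral M (\<lambda>\<omega>. (\<xi> \<omega> * (W b \<omega> - W a \<omega>)) * (\<xi>' \<omega> * (W b' \<omega> - W a' \<omega>)))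
      (expectation (\<lambda>\<omega>. \<xi> \<omega> * \<xi>' \<omega>) * measure lborel ({a<..b} \<inter> {a'<..b'}))"
proof -
  let ?x = "\<lambda>\<omega>. \<xi> \<omega> * \<xi>' \<omega>"
  have a': "0 \<le> a'" using ab by simp
  have xm: "?x \<in> borel_measurable (F a')"
    using measurable_later[OF ab(1,4) \<xi>(1)] \<xi>'(1) by auto
  have xb: "bounded (?x ` space M)" by (rule bounded_mult_image[OF \<xi>(2) \<xi>'(2)])
  have xi: "integrable M ?x" by (rule bounded_integrable[OF measurable_M[OF a' xm] xb])
  have xW: "integrable M (\<lambda>\<omega>. ?x \<omega> * (W v \<omega> - W u \<omega>))" if "0 \<le> u" "u \<le> v" for u v
  proof -
    obtain K where K: "\<And>\<omega>. \<omega> \<in> space M \<Longrightarrow> \<bar>?x \<omega>\<bar> \<le> K" using xb by (auto simp: bounded_iff)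
    have m: "?x \<in> borel_measurable M" "W u \<in> borel_measurable M" "W v \<in> borel_measurable M"
      using measurable_M[OF a' xm] W_measurable[of u] W_measurable[of v] that by auto
    have "integrable M (\<lambda>\<omega>. K * (W v \<omega> - W u \<omega>))"
      using increment_integrable[OF that, of 1] by simp
    then show ?thesis
    proof (rule Bochner_Integration.integrable_bound)
      show "AE \<omega> in M. norm (?x \<omega> * (W v \<omega> - W u \<omega>)) \<le> norm (K * (W v \<omega> - W u \<omega>))"
      proof (rule AE_I2)
        fix \<omega> assume "\<omega> \<in> space M"
        then have "\<bar>?x \<omega>\<bar> \<le> \<bar>K\<bar>" using K by (meson abs_ge_self order.trans)
        then show "norm (?x \<omega> * (W v \<omega> - W u \<omega>)) \<le> norm (K * (W v \<omega> - W u \<omega>))"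
          by (subst (1 2) norm_mult) (auto intro: mult_right_mono)
      qed
    qed (use m in measurable)
  qed
  show ?thesis
  proof (cases "b \<le> a'")
    case True
    have m: "(\<lambda>\<omega>. ?x \<omega> * (W b \<omega> - W a \<omega>)) \<in> borel_measurable (F a')"
      using xm measurable_later[OF _ True W_adapted] measurable_later[OF _ ab(4) W_adapted] ab by auto
    have "has_bochner_integral M (\<lambda>\<omega>. (?x \<omega> * (W b \<omega> - W a \<omega>)) * (W b' \<omega> - W a' \<omega>)) 0"
      using integrable_mult_increment_1[OF a' ab(3) m xW] expectation_mult_increment_1[OF a' ab(3) m xW] ab
      by (auto simp: has_bochner_integral_iff)
    moreover have "{a<..b} \<inter> {a'<..b'} = {}" using True by auto
    ultimately show ?thesis by (simp only: measure_empty mult_zero_right) (simp only: mult_ac)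
  next
    case False
    \<comment> \<open>The product is cut at \<open>a'\<close> and at the earlier right end point
      \<open>m\<close>. It splits into a part before \<open>a'\<close> times a later increment, the
      square over \<open>{a'<..m}\<close>, and the overlap times the increment from \<open>m\<close>
      to \<open>m'\<close>; only the square has nonzero mean.\<close>
    define m where "m = min b b'"
    define m' where "m' = max b b'"
    have m: "a' \<le> m" "m \<le> m'" using False ab by (auto simp: m_def m'_def)
    have m0: "0 \<le> m" using m a' by simp
    have m1: "(\<lambda>\<omega>. ?x \<omega> * (W a' \<omega> - W a \<omega>)) \<in> borel_measurable (F a')"
      using xm W_adapted[OF a'] measurable_later[OF _ ab(4) W_adapted] ab by auto
    have m3: "(\<lambda>\<omega>. ?x \<omega> * (W m \<omega> - W a' \<omega>)) \<in> borel_measurable (F m)"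
      using measurable_later[OF a' m(1) xm] measurable_later[OF _ m(1) W_adapted] W_adapted[OF m0] a' by auto
    have "has_bochner_integral M (\<lambda>\<omega>. (?x \<omega> * (W a' \<omega> - W a \<omega>)) * (W b' \<omega> - W a' \<omega>)) 0"
      using integrable_mult_increment_1[OF a' ab(3) m1 xW] expectation_mult_increment_1[OF a' ab(3) m1 xW] ab
      by (auto simp: has_bochner_integral_iff)
    moreover have "has_bochner_integral M (\<lambda>\<omega>. ?x \<omega> * (W m \<omega> - W a' \<omega>)^2) (expectation ?x * (m - a'))"
      using integrable_mult_increment[OF a' m(1) xm xi, of 2] expectation_mult_increment[OF a' m(1) xm xi, of 2]
        increment_moment_2[OF a' m(1)] by (auto simp: has_bochner_integral_iff)
    moreover have "has_bochner_integral M (\<lambda>\<omega>. (?x \<omega> * (W m \<omega> - W a' \<omega>)) * (W m' \<omega> - W m \<omega>)) 0"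
      using integrable_mult_increment_1[OF m0 m(2) m3 xW[OF a' m(1)]] expectation_mult_increment_1[OF m0 m(2) m3 xW[OF a' m(1)]]
      by (auto simp: has_bochner_integral_iff)
    ultimately have "has_bochner_integral M (\<lambda>\<omega>. (?x \<omega> * (W a' \<omega> - W a \<omega>)) * (W b' \<omega> - W a' \<omega>) +
        (?x \<omega> * (W m \<omega> - W a' \<omega>)^2 + (?x \<omega> * (W m \<omega> - W a' \<omega>)) * (W m' \<omega> - W m \<omega>))) (0 + (expectation ?x * (m - a') + 0))"
      by (intro has_bochner_integral_add)
    moreover have "(?x \<omega> * (W a' \<omega> - W a \<omega>)) * (W b' \<omega> - W a' \<omega>) +
        (?x \<omega> * (W m \<omega> - W a' \<omega>)^2 + (?x \<omega> * (W m \<omega> - W a' \<omega>)) * (W m' \<omega> - W m \<omega>))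
      = (\<xi> \<omega> * (W b \<omega> - W a \<omega>)) * (\<xi>' \<omega> * (W b' \<omega> - W a' \<omega>))" for \<omega>
      by (cases "b \<le> b'") (simp_all add: m_def m'_def min_def max_def power2_eq_square algebra_simps)
    moreover have "{a<..b} \<inter> {a'<..b'} = {a'<..m}" using ab False by (auto simp: m_def)
    ultimately show ?thesis using m by simp
  qed
qed

lemma increment_covariance:
  assumes ab: "0 \<le> a" "a \<le> b" "0 \<le> a'" "a' \<le> b'"
    and \<xi>: "\<xi> \<in> borel_measurable (F a)" "bounded (\<xi> ` space M)"
    and \<xi>': "\<xi>' \<in> borel_measurable (F a')" "bounded (\<xi>' ` space M)"
  shows "has_bochner_integral M (\<lambda>\<omega>. (\<xi> \<omega> * (W b \<omega> - W a \<omega>)) * (\<xi>' \<omega> * (W b' \<omega> - W a' \<omega>)))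
      (expectation (\<lambda>\<omega>. \<xi> \<omega> * \<xi>' \<omega>) * measure lborel ({a<..b} \<inter> {a'<..b'}))"
proof (cases "a \<le> a'")
  case True
  then show ?thesis using assms by (intro increment_covariance_ordered)
next
  case False
  then have "has_bochner_integral M (\<lambda>\<omega>. (\<xi>' \<omega> * (W b' \<omega> - W a' \<omega>)) * (\<xi> \<omega> * (W b \<omega> - W a \<omega>)))
      (expectation (\<lambda>\<omega>. \<xi>' \<omega> * \<xi> \<omega>) * measure lborel ({a'<..b'} \<inter> {a<..b}))"
    using assms by (intro increment_covariance_ordered) auto
  then show ?thesis by (simp add: mult.commute Int_commute)
qed

text \<open>An entry \<open>(\<xi>, a, b)\<close> stands for \<open>\<xi> \<cdot> indicator {a<..b}\<close>. The intervals may overlap, so that linear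
  combinations are just concatenations.\<close>

definition elementary :: "(('w \<Rightarrow> real) \<times> real \<times> real) list \<Rightarrow> bool" where
  "elementary xs \<longleftrightarrow> (\<forall>(\<xi>, a, b)\<in>set xs. 0 \<le> a \<and> a \<le> b \<and> \<xi> \<in> borel_measurable (F a) \<and> bounded (\<xi> ` space M))"

definition elem_integral :: "(('w \<Rightarrow> real) \<times> real \<times> real) list \<Rightarrow> 'w \<Rightarrow> real" where
  "elem_integral xs \<omega> = (\<Sum>(\<xi>, a, b)\<leftarrow>xs. \<xi> \<omega> * (W b \<omega> - W a \<omega>))"

definition elem_process :: "(('w \<Rightarrow> real) \<times> real \<times> real) list \<Rightarrow> real \<Rightarrow> 'w \<Rightarrow> real" where
  "elem_process xs s \<omega> = (\<Sum>(\<xi>, a, b)\<leftarrow>xs. \<xi> \<omega> * indicator {a<..b} s)"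

lemma elementary_append[simp]: "elementary (xs @ ys) \<longleftrightarrow> elementary xs \<and> elementary ys"
  unfolding elementary_def set_append ball_Un ..

lemma elem_integral_append[simp]: "elem_integral (xs @ ys) \<omega> = elem_integral xs \<omega> + elem_integral ys \<omega>"
  by (simp add: elem_integral_def)

lemma elem_process_append[simp]: "elem_process (xs @ ys) s \<omega> = elem_process xs s \<omega> + elem_process ys s \<omega>"
  by (simp add: elem_process_def)

section \<open>Isometry and orthogonality of elementary integrals\<close>

text \<open>Both sides expand into the same double sum over pairs of entries, with the expected
  product of the coefficients times the length of the overlap. Overlapping intervals need no
  refinement to a common partition, since the covariance formula already covers them.\<close>

lemma elementary_isometry:
  assumes "elementary xs"
  shows "(\<integral>\<^sup>+\<omega>. ennreal ((elem_integral xs \<omega>)\<^sup>2) \<partial>M) = (\<integral>\<^sup>+\<omega>. (\<integral>\<^sup>+s. ennreal ((elem_process xs s \<omega>)\<^sup>2) \<partial>lborel) \<partial>M)"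
    and "integrable M (\<lambda>\<omega>. (elem_integral xs \<omega>)\<^sup>2)"
proof -
  define n where "n = length xs"
  define \<xi> where "\<xi> k = fst (xs ! k)" for k
  define a where "a k = fst (snd (xs ! k))" for k
  define b where "b k = snd (snd (xs ! k))" for k
  have x: "0 \<le> a k" "a k \<le> b k" "\<xi> k \<in> borel_measurable (F (a k))" "bounded (\<xi> k ` space M)" if "k < n" for k
    using assms that nth_mem[of k xs] unfolding elementary_def n_def \<xi>_def a_def b_def
    by (auto simp: case_prod_beta)
  have I: "elem_integral xs \<omega> = (\<Sum>k<n. \<xi> k \<omega> * (W (b k) \<omega> - W (a k) \<omega>))" for \<omega>
    by (simp add: elem_integral_def sum_list_sum_nth n_def \<xi>_def a_def b_def case_prod_beta atLeast0LessThan)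
  have H: "elem_process xs s \<omega> = (\<Sum>k<n. \<xi> k \<omega> * indicator {a k<..b k} s)" for \<omega> s
    by (simp add: elem_process_def sum_list_sum_nth n_def \<xi>_def a_def b_def case_prod_beta atLeast0LessThan)
  let ?m = "\<lambda>j k. measure lborel ({a j<..b j} \<inter> {a k<..b k})"
  have xx: "integrable M (\<lambda>\<omega>. \<xi> j \<omega> * \<xi> k \<omega>)" if "j < n" "k < n" for j k
    using x(1,3,4)[OF that(1)] x(1,3,4)[OF that(2)] measurable_M
    by (intro bounded_integrable bounded_mult_image borel_measurable_times) auto
  have "has_bochner_integral M (\<lambda>\<omega>. (\<Sum>j<n. \<Sum>k<n. (\<xi> j \<omega> * (W (b j) \<omega> - W (a j) \<omega>)) * (\<xi> k \<omega> * (W (b k) \<omega> - W (a k) \<omega>))))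
     (\<Sum>j<n. \<Sum>k<n. expectation (\<lambda>\<omega>. \<xi> j \<omega> * \<xi> k \<omega>) * ?m j k)"
    using x by (intro has_bochner_integral_sum, intro increment_covariance) auto
  then have L: "has_bochner_integral M (\<lambda>\<omega>. (elem_integral xs \<omega>)\<^sup>2) (\<Sum>j<n. \<Sum>k<n. expectation (\<lambda>\<omega>. \<xi> j \<omega> * \<xi> k \<omega>) * ?m j k)"
    by (simp add: I power2_eq_square sum_product)
  then show "integrable M (\<lambda>\<omega>. (elem_integral xs \<omega>)\<^sup>2)" by (simp add: has_bochner_integral_iff)
  have inner: "has_bochner_integral lborel (\<lambda>s. (elem_process xs s \<omega>)\<^sup>2) (\<Sum>j<n. \<Sum>k<n. \<xi> j \<omega> * \<xi> k \<omega> * ?m j k)" for \<omega>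
  proof -
    have "has_bochner_integral lborel (\<lambda>s. (\<Sum>j<n. \<Sum>k<n. (\<xi> j \<omega> * \<xi> k \<omega>) * indicator ({a j<..b j} \<inter> {a k<..b k}) s)) (\<Sum>j<n. \<Sum>k<n. (\<xi> j \<omega> * \<xi> k \<omega>) * ?m j k)"
    proof (intro has_bochner_integral_sum has_bochner_integral_mult_right has_bochner_integral_real_indicator)
      fix j k assume "j \<in> {..<n}"
      have "emeasure lborel ({a j<..b j} \<inter> {a k<..b k}) \<le> emeasure lborel {a j<..b j}"
        by (rule emeasure_mono) auto
      then show "emeasure lborel ({a j<..b j} \<inter> {a k<..b k}) < \<infinity>"
        using x(2)[of j] \<open>j \<in> {..<n}\<close> by (auto simp: less_top[symmetric] top_unique)
    qed auto
    moreover have "(\<Sum>j<n. \<Sum>k<n. (\<xi> j \<omega> * \<xi> k \<omega>) * indicator ({a j<..b j} \<inter> {a k<..b k}) s) = (elem_process xs s \<omega>)\<^sup>2" for s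
      unfolding H power2_eq_square sum_product indicator_inter_arith by (intro sum.cong refl) (simp only: mult_ac)
    ultimately show ?thesis by simp
  qed
  have inn: "(\<integral>\<^sup>+s. ennreal ((elem_process xs s \<omega>)\<^sup>2) \<partial>lborel) = ennreal (\<Sum>j<n. \<Sum>k<n. \<xi> j \<omega> * \<xi> k \<omega> * ?m j k)" for \<omega>
    using inner[of \<omega>] by (intro nn_integral_eq_integral[THEN trans]) (auto simp: has_bochner_integral_iff)
  \<comment> \<open>Single summands may be negative; the sum is not, being the integral of a square.
    This is what allows the passage to \<open>ennreal\<close>.\<close>
  have nn: "0 \<le> (\<Sum>j<n. \<Sum>k<n. \<xi> j \<omega> * \<xi> k \<omega> * ?m j k)" for \<omega>
    using inner[of \<omega>] by (metis (no_types, lifting) has_bochner_integral_iff integral_nonneg_AE AE_I2 zero_le_power2)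
  have "has_bochner_integral M (\<lambda>\<omega>. (\<Sum>j<n. \<Sum>k<n. \<xi> j \<omega> * \<xi> k \<omega> * ?m j k)) (\<Sum>j<n. \<Sum>k<n. expectation (\<lambda>\<omega>. \<xi> j \<omega> * \<xi> k \<omega>) * ?m j k)"
    by (intro has_bochner_integral_sum, rule has_bochner_integral_mult_left, rule has_bochner_integral_integrable) (auto intro: xx)
  then have "(\<integral>\<^sup>+\<omega>. ennreal (\<Sum>j<n. \<Sum>k<n. \<xi> j \<omega> * \<xi> k \<omega> * ?m j k) \<partial>M) = ennreal (\<Sum>j<n. \<Sum>k<n. expectation (\<lambda>\<omega>. \<xi> j \<omega> * \<xi> k \<omega>) * ?m j k)"
    using nn by (intro nn_integral_eq_integral[THEN trans]) (auto simp: has_bochner_integral_iff)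
  also have "\<dots> = (\<integral>\<^sup>+\<omega>. ennreal ((elem_integral xs \<omega>)\<^sup>2) \<partial>M)"
    using L by (intro nn_integral_eq_integral[THEN trans, symmetric]) (auto simp: has_bochner_integral_iff)
  finally show "(\<integral>\<^sup>+\<omega>. ennreal ((elem_integral xs \<omega>)\<^sup>2) \<partial>M) = (\<integral>\<^sup>+\<omega>. (\<integral>\<^sup>+s. ennreal ((elem_process xs s \<omega>)\<^sup>2) \<partial>lborel) \<partial>M)"
    by (simp add: inn)
qed

text \<open>When all intervals start at or after \<open>s\<close>, the factor \<open>Z\<close> can
  be absorbed into each coefficient without losing measurability at the left end point. This is the
  martingale property in tested form.\<close>

lemma elementary_orthogonal:
  assumes xs: "elementary xs" and s: "0 \<le> s" "\<And>\<xi> a b. (\<xi>, a, b) \<in> set xs \<Longrightarrow> s \<le> a"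
    and Z: "Z \<in> borel_measurable (F s)" "bounded (Z ` space M)"
  shows "has_bochner_integral M (\<lambda>\<omega>. Z \<omega> * elem_integral xs \<omega>) 0"
  using xs s(2)
proof (induction xs)
  case Nil
  then show ?case by (simp add: elem_integral_def has_bochner_integral_zero)
next
  case (Cons x xs)
  obtain \<xi> a b where x: "x = (\<xi>, a, b)" by (cases x) auto
  have p: "0 \<le> a" "a \<le> b" "\<xi> \<in> borel_measurable (F a)" "bounded (\<xi> ` space M)" "s \<le> a"
    using Cons.prems by (auto simp: elementary_def x)
  have m: "(\<lambda>\<omega>. Z \<omega> * \<xi> \<omega>) \<in> borel_measurable (F a)"
    using p measurable_later[OF s(1) p(5) Z(1)] by auto
  have i: "integrable M (\<lambda>\<omega>. Z \<omega> * \<xi> \<omega>)"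
    by (rule bounded_integrable[OF measurable_M[OF p(1) m] bounded_mult_image[OF Z(2) p(4)]])
  have "has_bochner_integral M (\<lambda>\<omega>. (Z \<omega> * \<xi> \<omega>) * (W b \<omega> - W a \<omega>)) 0"
    using integrable_mult_increment_1[OF p(1,2) m i] expectation_mult_increment_1[OF p(1,2) m i]
    by (auto simp: has_bochner_integral_iff)
  moreover have "has_bochner_integral M (\<lambda>\<omega>. Z \<omega> * elem_integral xs \<omega>) 0"
    using Cons by (auto simp: elementary_def)
  ultimately have "has_bochner_integral M (\<lambda>\<omega>. (Z \<omega> * \<xi> \<omega>) * (W b \<omega> - W a \<omega>) + Z \<omega> * elem_integral xs \<omega>) (0 + 0)"
    by (rule has_bochner_integral_add)
  then show ?case by (simp add: elem_integral_def x algebra_simps)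
qed

text \<open>When \<open>\<tau> k > t\<close> the clamped interval is empty, but \<open>\<xi> k\<close> need not be measurable with respect to
  \<open>F t\<close> and has to be replaced by \<open>0\<close>.\<close>

definition simple_restrict :: "real \<Rightarrow> real \<Rightarrow> nat \<Rightarrow> (nat \<Rightarrow> real) \<Rightarrow> (nat \<Rightarrow> 'w \<Rightarrow> real) \<Rightarrow> (('w \<Rightarrow> real) \<times> real \<times> real) list" where
  "simple_restrict s t n \<tau> \<xi> = map (\<lambda>k. (if \<tau> k \<le> t then \<xi> k else (\<lambda>_. 0), max s (min (\<tau> k) t), max s (min (\<tau> (Suc k)) t))) [0..<n]"

lemma simple_data_nonneg:
  assumes "simple_data M F n \<tau> \<xi>" "k \<le> n"
  shows "0 \<le> \<tau> k"
  using assms(2)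
proof (induction k)
  case 0 then show ?case using assms(1) by (simp add: simple_data_def)
next
  case (Suc k)
  then have "\<tau> k \<le> \<tau> (Suc k)" using assms(1) by (simp add: simple_data_def)
  then show ?case using Suc by simp
qed

lemma simple_restrict:
  assumes sd: "simple_data M F n \<tau> \<xi>" and st: "0 \<le> s" "s \<le> t"
  shows "elementary (simple_restrict s t n \<tau> \<xi>)"
    and "(\<zeta>, a, b) \<in> set (simple_restrict s t n \<tau> \<xi>) \<Longrightarrow> s \<le> a"
    and "elem_integral (simple_restrict s t n \<tau> \<xi>) \<omega> = simple_integral W n \<tau> \<xi> t \<omega> - simple_integral W n \<tau> \<xi> s \<omega>"
    and "elem_process (simple_restrict s t n \<tau> \<xi>) u \<omega> = simple_process n \<tau> \<xi> u \<omega> * indicator {s<..t} u"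
proof -
  have k: "0 \<le> \<tau> k" "\<tau> k \<le> \<tau> (Suc k)" "\<xi> k \<in> borel_measurable (F (\<tau> k))" "bounded (\<xi> k ` space M)" if "k < n" for k
    using sd that simple_data_nonneg[OF sd, of k] by (auto simp: simple_data_def)
  have "0 \<le> max s (min (\<tau> k) t) \<and> max s (min (\<tau> k) t) \<le> max s (min (\<tau> (Suc k)) t)
       \<and> (if \<tau> k \<le> t then \<xi> k else (\<lambda>_. 0)) \<in> borel_measurable (F (max s (min (\<tau> k) t)))
       \<and> bounded ((if \<tau> k \<le> t then \<xi> k else (\<lambda>_. 0)) ` space M)" if "k < n" for k
  proof (cases "\<tau> k \<le> t")
    case True
    have "\<xi> k \<in> borel_measurable (F (max s (min (\<tau> k) t)))"
      using k[OF that] True by (intro measurable_later[OF k(1)[OF that] _ k(3)[OF that]]) auto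
    then show ?thesis using True k[OF that] st by (auto intro: max.coboundedI1)
  next
    case False
    then show ?thesis using st k[OF that] by (auto simp: max_def bounded_iff)
  qed
  then show "elementary (simple_restrict s t n \<tau> \<xi>)"
    by (auto simp: elementary_def simple_restrict_def)
  show "(\<zeta>, a, b) \<in> set (simple_restrict s t n \<tau> \<xi>) \<Longrightarrow> s \<le> a"
    by (auto simp: simple_restrict_def)
  \<comment> \<open>For \<open>r \<le> s\<close> the bracket vanishes because both clamped times
    equal \<open>r\<close>; for \<open>r > s\<close> its subtracted term cancels
    \<open>W s\<close>.\<close>
  have W: "W (max s (min r t)) \<omega> = W s \<omega> + (W (min r t) \<omega> - W (min r s) \<omega>)" for r
    using st by (cases "r \<le> s") (auto simp: max_def min_def)
  show "elem_integral (simple_restrict s t n \<tau> \<xi>) \<omega> = simple_integral W n \<tau> \<xi> t \<omega> - simple_integral W n \<tau> \<xi> s \<omega>"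
    unfolding elem_integral_def simple_restrict_def simple_integral_def sum_subtractf[symmetric]
    by (simp add: o_def interv_sum_list_conv_sum_set_nat atLeast0LessThan, intro sum.cong refl)
       (use k(2) st in \<open>force simp: W algebra_simps min_def\<close>)
  show "elem_process (simple_restrict s t n \<tau> \<xi>) u \<omega> = simple_process n \<tau> \<xi> u \<omega> * indicator {s<..t} u"
    unfolding elem_process_def simple_restrict_def simple_process_def sum_distrib_right
    by (simp add: o_def interv_sum_list_conv_sum_set_nat atLeast0LessThan, intro sum.cong refl)
       (use st in \<open>auto split: split_indicator\<close>)
qed

end

section \<open>The Ito integral\<close>

abbreviation nn_path_integral :: "'w measure \<Rightarrow> real \<Rightarrow> real \<Rightarrow> (real \<Rightarrow> 'w \<Rightarrow> real) \<Rightarrow> ennreal" where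
  "nn_path_integral M a b f \<equiv> \<integral>\<^sup>+\<omega>. (\<integral>\<^sup>+u\<in>{a..b}. ennreal (f u \<omega>) \<partial>lborel) \<partial>M"

abbreviation jointly_measurable :: "'w measure \<Rightarrow> (real \<Rightarrow> 'w \<Rightarrow> 'x::topological_space) \<Rightarrow> bool" where
  "jointly_measurable M X \<equiv> (\<lambda>(\<omega>, u). X u \<omega>) \<in> borel_measurable (M \<Otimes>\<^sub>M lborel)"

text \<open>The four perturbations are the approximation errors of two Ito integrals at two end
  points. The sum of six squares is the Lagrange identity behind Cauchy-Schwarz for four
  terms.\<close>

lemma ennreal_square_perturb4:
  fixes x a b c d :: real
  shows "ennreal ((x - (a - b - c + d))\<^sup>2) \<le> 2 * ennreal (x\<^sup>2) + 8 * (ennreal (a\<^sup>2) + ennreal (b\<^sup>2) + ennreal (c\<^sup>2) + ennreal (d\<^sup>2))"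
proof -
  have "0 \<le> (a + b)\<^sup>2 + (a + c)\<^sup>2 + (a - d)\<^sup>2 + (b - c)\<^sup>2 + (b + d)\<^sup>2 + (c + d)\<^sup>2" by simp
  also have "\<dots> = 4 * (a\<^sup>2 + b\<^sup>2 + c\<^sup>2 + d\<^sup>2) - (a - b - c + d)\<^sup>2" by (simp add: power2_eq_square algebra_simps)
  finally have 1: "(a - b - c + d)\<^sup>2 \<le> 4 * (a\<^sup>2 + b\<^sup>2 + c\<^sup>2 + d\<^sup>2)" by simp
  have "0 \<le> (x + (a - b - c + d))\<^sup>2" by simp
  then have "(x - (a - b - c + d))\<^sup>2 \<le> 2 * x\<^sup>2 + 2 * (a - b - c + d)\<^sup>2" by (simp add: power2_eq_square algebra_simps)
  then have "(x - (a - b - c + d))\<^sup>2 \<le> 2 * x\<^sup>2 + 8 * (a\<^sup>2 + b\<^sup>2 + c\<^sup>2 + d\<^sup>2)" using 1 by linarith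
  then have "ennreal ((x - (a - b - c + d))\<^sup>2) \<le> ennreal (2 * x\<^sup>2 + 8 * (a\<^sup>2 + b\<^sup>2 + c\<^sup>2 + d\<^sup>2))" by (rule ennreal_leI)
  also have "\<dots> = 2 * ennreal (x\<^sup>2) + 8 * (ennreal (a\<^sup>2) + ennreal (b\<^sup>2) + ennreal (c\<^sup>2) + ennreal (d\<^sup>2))"
    by (simp add: ennreal_mult ennreal_plus)
  finally show ?thesis .
qed

lemma ennreal_square_perturb2:
  fixes x a b :: real
  shows "ennreal ((x + a - b)\<^sup>2) \<le> 2 * ennreal (x\<^sup>2) + 4 * (ennreal (a\<^sup>2) + ennreal (b\<^sup>2))"
proof -
  have "0 \<le> (x - a + b)\<^sup>2 + 2 * (a + b)\<^sup>2" by simp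
  then have "(x + a - b)\<^sup>2 \<le> 2 * x\<^sup>2 + 4 * (a\<^sup>2 + b\<^sup>2)" by (simp add: power2_eq_square algebra_simps)
  then have "ennreal ((x + a - b)\<^sup>2) \<le> ennreal (2 * x\<^sup>2 + 4 * (a\<^sup>2 + b\<^sup>2))" by (rule ennreal_leI)
  also have "\<dots> = 2 * ennreal (x\<^sup>2) + 4 * (ennreal (a\<^sup>2) + ennreal (b\<^sup>2))"
    by (simp add: ennreal_mult ennreal_plus)
  finally show ?thesis .
qed

context brownian_filtration
begin

text \<open>Processes are arbitrary outside their time domain; hence the clamping here and the \<open>max 0\<close> in later
  joint measurability statements.\<close>

lemma progressively_measurable_clamp:
  fixes H :: "real \<Rightarrow> 'w \<Rightarrow> real"
  assumes H: "progressively_measurable F H" and T: "0 \<le> T"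
  shows "jointly_measurable M (\<lambda>u \<omega>. H (max 0 (min T u)) \<omega>)"
proof -
  have sub: "subalgebra M (F T)" using filtration T by (simp add: filtered_prob_space_def)
  then have id: "(\<lambda>\<omega>. \<omega>) \<in> measurable M (F T)"
    by (intro measurableI) (auto simp: subalgebra_def Int_absorb2 dest: sets.sets_into_space)
  have "(\<lambda>(\<omega>, u). (max 0 (min T u), \<omega>)) \<in> measurable (M \<Otimes>\<^sub>M lborel) (restrict_space borel {0..T} \<Otimes>\<^sub>M F T)"
    unfolding split_beta'
  proof (rule measurable_Pair)
    show "(\<lambda>x. max 0 (min T (snd x))) \<in> measurable (M \<Otimes>\<^sub>M lborel) (restrict_space borel {0..T})"
      by (rule measurable_restrict_space2) (use T in auto)
    show "(\<lambda>x. fst x) \<in> measurable (M \<Otimes>\<^sub>M lborel) (F T)"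
      by (rule measurable_compose[OF measurable_fst id])
  qed
  moreover have "(\<lambda>(s, \<omega>). H s \<omega>) \<in> borel_measurable (restrict_space borel {0..T} \<Otimes>\<^sub>M F T)"
    using H T by (simp add: progressively_measurable_def)
  ultimately have "(\<lambda>x. (\<lambda>(s, \<omega>). H s \<omega>) ((\<lambda>(\<omega>, u). (max 0 (min T u), \<omega>)) x)) \<in> borel_measurable (M \<Otimes>\<^sub>M lborel)"
    by (rule measurable_compose)
  then show ?thesis by (simp add: split_beta')
qed

lemma simple_process_measurable:
  assumes sd: "simple_data M F n \<tau> \<xi>"
  shows "jointly_measurable M (\<lambda>u \<omega>. simple_process n \<tau> \<xi> u \<omega>)"
proof -
  have "\<xi> k \<in> borel_measurable M" if "k < n" for k
    using sd that simple_data_nonneg[OF sd, of k] by (auto simp: simple_data_def intro: measurable_M)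
  then show ?thesis
    unfolding simple_process_def split_beta'
    by (intro borel_measurable_sum borel_measurable_times measurable_compose[OF measurable_fst])
       (auto intro!: measurable_compose[OF measurable_snd] borel_measurable_indicator)
qed

lemma simple_integral_measurable:
  assumes sd: "simple_data M F n \<tau> \<xi>" and "0 \<le> t"
  shows "(\<lambda>\<omega>. simple_integral W n \<tau> \<xi> t \<omega>) \<in> borel_measurable M"
proof -
  have k: "0 \<le> \<tau> k" "0 \<le> \<tau> (Suc k)" "\<xi> k \<in> borel_measurable M" if "k < n" for k
    using sd that simple_data_nonneg[OF sd, of k] simple_data_nonneg[OF sd, of "Suc k"]
    by (auto simp: simple_data_def intro: measurable_M)
  show ?thesis
    unfolding simple_integral_def
    using k \<open>0 \<le> t\<close> by (intro borel_measurable_sum borel_measurable_times borel_measurable_diff W_measurable) auto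
qed

definition elem_uminus :: "(('w \<Rightarrow> real) \<times> real \<times> real) list \<Rightarrow> (('w \<Rightarrow> real) \<times> real \<times> real) list" where
  "elem_uminus xs = map (\<lambda>(\<xi>, a, b). (\<lambda>\<omega>. - \<xi> \<omega>, a, b)) xs"

lemma elem_uminus:
  shows "elementary xs \<Longrightarrow> elementary (elem_uminus xs)"
    and "elem_integral (elem_uminus xs) \<omega> = - elem_integral xs \<omega>"
    and "elem_process (elem_uminus xs) s \<omega> = - elem_process xs s \<omega>"
proof -
  show "elementary xs \<Longrightarrow> elementary (elem_uminus xs)"
    by (force simp: elementary_def elem_uminus_def bounded_iff)
  show "elem_integral (elem_uminus xs) \<omega> = - elem_integral xs \<omega>"
    by (induction xs) (auto simp: elem_integral_def elem_uminus_def)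
  show "elem_process (elem_uminus xs) s \<omega> = - elem_process xs s \<omega>"
    by (induction xs) (auto simp: elem_process_def elem_uminus_def)
qed

text \<open>Passing to the limit with \<open>(x + y)\<^sup>2 \<le> 2 x\<^sup>2 + 2 y\<^sup>2\<close> in place of Minkowski's inequality costs the
  factor 4, which is harmless below.\<close>

theorem ito_integral_bound:
  assumes H: "has_ito_integral M F W H I" and H': "has_ito_integral M F W H' I'"
    and st: "0 \<le> s" "s \<le> t" and \<zeta>: "\<zeta> \<in> borel_measurable (F s)" "bounded (\<zeta> ` space M)"
  shows "(\<integral>\<^sup>+\<omega>. ennreal (((I t \<omega> - I s \<omega>) - (I' t \<omega> - I' s \<omega>) - \<zeta> \<omega> * (W t \<omega> - W s \<omega>))\<^sup>2) \<partial>M)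
     \<le> 4 * nn_path_integral M s t (\<lambda>u \<omega>. (H u \<omega> - H' u \<omega> - \<zeta> \<omega>)\<^sup>2)"
proof -
  have t: "0 \<le> t" using st by simp
  obtain n \<tau> \<xi> where sd: "\<And>m. simple_data M F (n m) (\<tau> m) (\<xi> m)"
    and lp: "\<And>T. T \<ge> 0 \<Longrightarrow> (\<lambda>m. \<integral>\<^sup>+\<omega>. (\<integral>\<^sup>+s\<in>{0..T}. ennreal ((simple_process (n m) (\<tau> m) (\<xi> m) s \<omega> - H s \<omega>)\<^sup>2) \<partial>lborel) \<partial>M) \<longlonglongrightarrow> 0"
    and li: "\<And>t. t \<ge> 0 \<Longrightarrow> (\<lambda>m. \<integral>\<^sup>+\<omega>. ennreal ((simple_integral W (n m) (\<tau> m) (\<xi> m) t \<omega> - I t \<omega>)\<^sup>2) \<partial>M) \<longlonglongrightarrow> 0"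
    using H unfolding has_ito_integral_def by blast
  obtain n' \<tau>' \<xi>' where sd': "\<And>m. simple_data M F (n' m) (\<tau>' m) (\<xi>' m)"
    and lp': "\<And>T. T \<ge> 0 \<Longrightarrow> (\<lambda>m. \<integral>\<^sup>+\<omega>. (\<integral>\<^sup>+s\<in>{0..T}. ennreal ((simple_process (n' m) (\<tau>' m) (\<xi>' m) s \<omega> - H' s \<omega>)\<^sup>2) \<partial>lborel) \<partial>M) \<longlonglongrightarrow> 0"
    and li': "\<And>t. t \<ge> 0 \<Longrightarrow> (\<lambda>m. \<integral>\<^sup>+\<omega>. ennreal ((simple_integral W (n' m) (\<tau>' m) (\<xi>' m) t \<omega> - I' t \<omega>)\<^sup>2) \<partial>M) \<longlonglongrightarrow> 0"
    using H' unfolding has_ito_integral_def by blast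
  \<comment> \<open>Clamping leaves the integrands unchanged on \<open>{0..t}\<close> and makes them
    jointly measurable on the whole line.\<close>
  define h where "h \<omega> u = H (max 0 (min t u)) \<omega>" for \<omega> u
  define h' where "h' \<omega> u = H' (max 0 (min t u)) \<omega>" for \<omega> u
  define S where "S m \<omega> u = simple_process (n m) (\<tau> m) (\<xi> m) u \<omega>" for m \<omega> u
  define S' where "S' m \<omega> u = simple_process (n' m) (\<tau>' m) (\<xi>' m) u \<omega>" for m \<omega> u
  have hm[measurable]: "case_prod h \<in> borel_measurable (M \<Otimes>\<^sub>M lborel)" "case_prod h' \<in> borel_measurable (M \<Otimes>\<^sub>M lborel)"
    using H H' progressively_measurable_clamp[of _ t] t unfolding has_ito_integral_def h_def h'_def by auto
  have Sm[measurable]: "case_prod (S m) \<in> borel_measurable (M \<Otimes>\<^sub>M lborel)" "case_prod (S' m) \<in> borel_measurable (M \<Otimes>\<^sub>M lborel)" for m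
    using simple_process_measurable[OF sd] simple_process_measurable[OF sd'] unfolding S_def S'_def by auto
  have [measurable]: "\<zeta> \<in> borel_measurable M" using measurable_M[OF st(1) \<zeta>(1)] .
  have Im[measurable]: "I t \<in> borel_measurable M" "I s \<in> borel_measurable M" "I' t \<in> borel_measurable M" "I' s \<in> borel_measurable M"
    using H H' t st unfolding has_ito_integral_def by auto
  define J where "J m \<omega> r = simple_integral W (n m) (\<tau> m) (\<xi> m) r \<omega>" for m \<omega> r
  define J' where "J' m \<omega> r = simple_integral W (n' m) (\<tau>' m) (\<xi>' m) r \<omega>" for m \<omega> r
  have Jm[measurable]: "(\<lambda>\<omega>. J m \<omega> s) \<in> borel_measurable M" "(\<lambda>\<omega>. J m \<omega> t) \<in> borel_measurable M"
      "(\<lambda>\<omega>. J' m \<omega> s) \<in> borel_measurable M" "(\<lambda>\<omega>. J' m \<omega> t) \<in> borel_measurable M" for m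
    unfolding J_def J'_def using simple_integral_measurable[OF sd] simple_integral_measurable[OF sd'] st t by auto
  define A where "A m = nn_path_integral M 0 t (\<lambda>u \<omega>. (S m \<omega> u - h \<omega> u)\<^sup>2)" for m
  define A' where "A' m = nn_path_integral M 0 t (\<lambda>u \<omega>. (S' m \<omega> u - h' \<omega> u)\<^sup>2)" for m
  define R where "R = nn_path_integral M s t (\<lambda>u \<omega>. (h \<omega> u - h' \<omega> u - \<zeta> \<omega>)\<^sup>2)"
  define p where "p m r = (\<integral>\<^sup>+\<omega>. ennreal ((J m \<omega> r - I r \<omega>)\<^sup>2) \<partial>M)" for m r
  define p' where "p' m r = (\<integral>\<^sup>+\<omega>. ennreal ((J' m \<omega> r - I' r \<omega>)\<^sup>2) \<partial>M)" for m r
  have A0: "A \<longlonglongrightarrow> 0"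
  proof -
    have "A = (\<lambda>m. \<integral>\<^sup>+\<omega>. (\<integral>\<^sup>+s\<in>{0..t}. ennreal ((simple_process (n m) (\<tau> m) (\<xi> m) s \<omega> - H s \<omega>)\<^sup>2) \<partial>lborel) \<partial>M)"
      unfolding A_def by (intro ext nn_integral_cong) (auto simp: S_def h_def split: split_indicator)
    then show ?thesis using lp[OF t] by simp
  qed
  have A0': "A' \<longlonglongrightarrow> 0"
  proof -
    have "A' = (\<lambda>m. \<integral>\<^sup>+\<omega>. (\<integral>\<^sup>+s\<in>{0..t}. ennreal ((simple_process (n' m) (\<tau>' m) (\<xi>' m) s \<omega> - H' s \<omega>)\<^sup>2) \<partial>lborel) \<partial>M)"
      unfolding A'_def by (intro ext nn_integral_cong) (auto simp: S'_def h'_def split: split_indicator)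
    then show ?thesis using lp'[OF t] by simp
  qed
  have p0: "(\<lambda>m. p m t) \<longlonglongrightarrow> 0" "(\<lambda>m. p m s) \<longlonglongrightarrow> 0" "(\<lambda>m. p' m t) \<longlonglongrightarrow> 0" "(\<lambda>m. p' m s) \<longlonglongrightarrow> 0"
    unfolding p_def p'_def J_def J'_def using li li' t st by auto
  define D where "D \<omega> = (I t \<omega> - I s \<omega>) - (I' t \<omega> - I' s \<omega>) - \<zeta> \<omega> * (W t \<omega> - W s \<omega>)" for \<omega>
  have bound: "(\<integral>\<^sup>+\<omega>. ennreal ((D \<omega>)\<^sup>2) \<partial>M) \<le> 4 * R + (8 * (A m + A' m) + 8 * (p m t + p m s + p' m t + p' m s))" for m
  proof -
    define xs where "xs = simple_restrict s t (n m) (\<tau> m) (\<xi> m) @ (elem_uminus (simple_restrict s t (n' m) (\<tau>' m) (\<xi>' m)) @ [(\<lambda>\<omega>. - \<zeta> \<omega>, s, t)])"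
    have xs: "elementary xs"
      unfolding xs_def using simple_restrict(1)[OF sd st] elem_uminus(1)[OF simple_restrict(1)[OF sd' st]] st \<zeta>
      by (auto simp: elementary_append) (auto simp: elementary_def bounded_iff)
    have E: "elem_integral xs \<omega> = (J m \<omega> t - J m \<omega> s) - (J' m \<omega> t - J' m \<omega> s) - \<zeta> \<omega> * (W t \<omega> - W s \<omega>)" for \<omega>
      by (simp add: xs_def simple_restrict(3)[OF sd st] simple_restrict(3)[OF sd' st] elem_uminus J_def J'_def) (simp add: elem_integral_def)
    have P: "elem_process xs u \<omega> = (S m \<omega> u - S' m \<omega> u - \<zeta> \<omega>) * indicator {s<..t} u" for u \<omega>
      by (simp add: xs_def simple_restrict(4)[OF sd st] simple_restrict(4)[OF sd' st] elem_uminus S_def S'_def) (simp add: elem_process_def algebra_simps)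
    have Wm[measurable]: "W s \<in> borel_measurable M" "W t \<in> borel_measurable M" using W_measurable st t by auto
    have [measurable]: "elem_integral xs \<in> borel_measurable M" unfolding E by measurable
    have "(\<integral>\<^sup>+\<omega>. ennreal ((D \<omega>)\<^sup>2) \<partial>M) \<le> (\<integral>\<^sup>+\<omega>. 2 * ennreal ((elem_integral xs \<omega>)\<^sup>2) + 8 * (ennreal ((J m \<omega> t - I t \<omega>)\<^sup>2)
        + ennreal ((J m \<omega> s - I s \<omega>)\<^sup>2) + ennreal ((J' m \<omega> t - I' t \<omega>)\<^sup>2) + ennreal ((J' m \<omega> s - I' s \<omega>)\<^sup>2)) \<partial>M)"
    proof (rule nn_integral_mono, goal_cases)
      case (1 \<omega>)
      have "D \<omega> = elem_integral xs \<omega> - ((J m \<omega> t - I t \<omega>) - (J m \<omega> s - I s \<omega>) - (J' m \<omega> t - I' t \<omega>) + (J' m \<omega> s - I' s \<omega>))"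
        by (simp add: E D_def)
      then show ?case
        by (simp only: ennreal_square_perturb4)
    qed
    also have "\<dots> = 2 * (\<integral>\<^sup>+\<omega>. ennreal ((elem_integral xs \<omega>)\<^sup>2) \<partial>M) + 8 * (p m t + p m s + p' m t + p' m s)"
      unfolding p_def p'_def by (simp add: nn_integral_add nn_integral_cmult)
    also have "(\<integral>\<^sup>+\<omega>. ennreal ((elem_integral xs \<omega>)\<^sup>2) \<partial>M) = (\<integral>\<^sup>+\<omega>. (\<integral>\<^sup>+u. ennreal ((elem_process xs u \<omega>)\<^sup>2) \<partial>lborel) \<partial>M)"
      by (rule elementary_isometry[OF xs])
    also have "\<dots> \<le> (\<integral>\<^sup>+\<omega>. (\<integral>\<^sup>+u. 2 * (ennreal ((h \<omega> u - h' \<omega> u - \<zeta> \<omega>)\<^sup>2) * indicator {s..t} u)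
         + 4 * (ennreal ((S m \<omega> u - h \<omega> u)\<^sup>2) * indicator {0..t} u + ennreal ((S' m \<omega> u - h' \<omega> u)\<^sup>2) * indicator {0..t} u) \<partial>lborel) \<partial>M)"
    proof (intro nn_integral_mono, goal_cases)
      case (1 \<omega> u)
      have "S m \<omega> u - S' m \<omega> u - \<zeta> \<omega> = (h \<omega> u - h' \<omega> u - \<zeta> \<omega>) + (S m \<omega> u - h \<omega> u) - (S' m \<omega> u - h' \<omega> u)" by simp
      then have "ennreal ((S m \<omega> u - S' m \<omega> u - \<zeta> \<omega>)\<^sup>2) \<le> 2 * ennreal ((h \<omega> u - h' \<omega> u - \<zeta> \<omega>)\<^sup>2)
           + 4 * (ennreal ((S m \<omega> u - h \<omega> u)\<^sup>2) + ennreal ((S' m \<omega> u - h' \<omega> u)\<^sup>2))"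
        by (simp only: ennreal_square_perturb2)
      then show ?case
        using st by (auto simp: P split: split_indicator)
    qed
    also have "\<dots> = (\<integral>\<^sup>+\<omega>. 2 * (\<integral>\<^sup>+u\<in>{s..t}. ennreal ((h \<omega> u - h' \<omega> u - \<zeta> \<omega>)\<^sup>2) \<partial>lborel)
         + 4 * ((\<integral>\<^sup>+u\<in>{0..t}. ennreal ((S m \<omega> u - h \<omega> u)\<^sup>2) \<partial>lborel) + (\<integral>\<^sup>+u\<in>{0..t}. ennreal ((S' m \<omega> u - h' \<omega> u)\<^sup>2) \<partial>lborel)) \<partial>M)"
    proof (rule nn_integral_cong, goal_cases)
      case \<omega>: (1 \<omega>)
      have [measurable]: "h \<omega> \<in> borel_measurable lborel" "h' \<omega> \<in> borel_measurable lborel"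
          "S m \<omega> \<in> borel_measurable lborel" "S' m \<omega> \<in> borel_measurable lborel"
        using measurable_Pair2[OF hm(1) \<omega>] measurable_Pair2[OF hm(2) \<omega>]
          measurable_Pair2[OF Sm(1) \<omega>] measurable_Pair2[OF Sm(2) \<omega>] by simp_all
      show ?case
        by (simp add: nn_integral_add nn_integral_cmult distrib_left)
    qed
    also have "\<dots> = 2 * R + 4 * (A m + A' m)"
      unfolding R_def A_def A'_def by (simp add: nn_integral_add nn_integral_cmult distrib_left)
    finally show ?thesis
      by (simp add: distrib_left mult.assoc[symmetric] add.assoc mult_left_mono add_mono)
  qed
  have "(\<lambda>m. 4 * R + (8 * (A m + A' m) + 8 * (p m t + p m s + p' m t + p' m s))) \<longlonglongrightarrow> 4 * R + (8 * (0 + 0) + 8 * (0 + 0 + 0 + 0))"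
    by (intro tendsto_add tendsto_const ennreal_tendsto_cmult A0 A0' p0) auto
  then have "(\<lambda>m. 4 * R + (8 * (A m + A' m) + 8 * (p m t + p m s + p' m t + p' m s))) \<longlonglongrightarrow> 4 * R" by simp
  then have "(\<integral>\<^sup>+\<omega>. ennreal ((D \<omega>)\<^sup>2) \<partial>M) \<le> 4 * R"
    by (rule LIMSEQ_le_const) (use bound in blast)
  moreover have "R = nn_path_integral M s t (\<lambda>u \<omega>. (H u \<omega> - H' u \<omega> - \<zeta> \<omega>)\<^sup>2)"
    unfolding R_def using st by (intro nn_integral_cong) (auto simp: h_def h'_def split: split_indicator)
  ultimately show ?thesis by (simp add: D_def)
qed

text \<open>All three properties come from the simple approximants. One approximant at finite
  \<open>L\<^sup>2\<close> distance gives square integrability; orthogonality to the past survives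
  the limit because \<open>Z\<close> is bounded. It is used with
  \<open>Z = \<phi>' (X s)\<close>.\<close>

lemma ito_increment:
  assumes H: "has_ito_integral M F W H I" and st: "0 \<le> s" "s \<le> t"
  shows "integrable M (\<lambda>\<omega>. (I t \<omega> - I s \<omega>)\<^sup>2)"
    and "integrable M (\<lambda>\<omega>. I t \<omega> - I s \<omega>)"
    and "Z \<in> borel_measurable (F s) \<Longrightarrow> bounded (Z ` space M) \<Longrightarrow> expectation (\<lambda>\<omega>. Z \<omega> * (I t \<omega> - I s \<omega>)) = 0"
proof -
  have t: "0 \<le> t" using st by simp
  obtain n \<tau> \<xi> where sd: "\<And>m. simple_data M F (n m) (\<tau> m) (\<xi> m)"
    and li: "\<And>t. t \<ge> 0 \<Longrightarrow> (\<lambda>m. \<integral>\<^sup>+\<omega>. ennreal ((simple_integral W (n m) (\<tau> m) (\<xi> m) t \<omega> - I t \<omega>)\<^sup>2) \<partial>M) \<longlonglongrightarrow> 0"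
    using H unfolding has_ito_integral_def by blast
  define J where "J m \<omega> r = simple_integral W (n m) (\<tau> m) (\<xi> m) r \<omega>" for m \<omega> r
  have [measurable]: "I t \<in> borel_measurable M" "I s \<in> borel_measurable M"
    using H t st unfolding has_ito_integral_def by auto
  have [measurable]: "(\<lambda>\<omega>. J m \<omega> s) \<in> borel_measurable M" "(\<lambda>\<omega>. J m \<omega> t) \<in> borel_measurable M" for m
    unfolding J_def using simple_integral_measurable[OF sd] st t by auto
  define xs where "xs m = simple_restrict s t (n m) (\<tau> m) (\<xi> m)" for m
  have xs: "elementary (xs m)" for m unfolding xs_def by (rule simple_restrict(1)[OF sd st])
  have E: "elem_integral (xs m) \<omega> = J m \<omega> t - J m \<omega> s" for m \<omega>
    by (simp add: xs_def simple_restrict(3)[OF sd st] J_def)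
  define D where "D \<omega> = I t \<omega> - I s \<omega>" for \<omega>
  have [measurable]: "D \<in> borel_measurable M" unfolding D_def by measurable
  have [measurable]: "elem_integral (xs m) \<in> borel_measurable M" for m unfolding E by measurable
  define r where "r m = (\<integral>\<^sup>+\<omega>. ennreal ((D \<omega> - elem_integral (xs m) \<omega>)\<^sup>2) \<partial>M)" for m
  have r0: "r \<longlonglongrightarrow> 0"
  proof -
    define p where "p m v = (\<integral>\<^sup>+\<omega>. ennreal ((J m \<omega> v - I v \<omega>)\<^sup>2) \<partial>M)" for m v
    have "r m \<le> 4 * (p m s + p m t)" for m
    proof -
      have "r m \<le> (\<integral>\<^sup>+\<omega>. 4 * (ennreal ((J m \<omega> s - I s \<omega>)\<^sup>2) + ennreal ((J m \<omega> t - I t \<omega>)\<^sup>2)) \<partial>M)"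
        unfolding r_def
      proof (rule nn_integral_mono, goal_cases)
        case (1 \<omega>)
        have "D \<omega> - elem_integral (xs m) \<omega> = 0 + (J m \<omega> s - I s \<omega>) - (J m \<omega> t - I t \<omega>)" by (simp add: D_def E)
        then show ?case
          using ennreal_square_perturb2[of 0 "J m \<omega> s - I s \<omega>" "J m \<omega> t - I t \<omega>"] by simp
      qed
      also have "\<dots> = 4 * (p m s + p m t)" unfolding p_def by (simp add: nn_integral_add nn_integral_cmult)
      finally show ?thesis .
    qed
    moreover have "(\<lambda>m. 4 * (p m s + p m t)) \<longlonglongrightarrow> 4 * (0 + 0)"
      using li[OF st(1)] li[OF t] unfolding p_def J_def by (intro ennreal_tendsto_cmult tendsto_add) auto
    ultimately show ?thesis
      by (intro tendsto_sandwich[of "\<lambda>_. 0" r sequentially "\<lambda>m. 4 * (p m s + p m t)" 0]) auto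
  qed
  have fin: "eventually (\<lambda>m. r m < e) sequentially" if "e > 0" for e
    using order_tendstoD(2)[OF r0 that] .
  have sq: "integrable M (\<lambda>\<omega>. (D \<omega> - elem_integral (xs m) \<omega>)\<^sup>2)" if "r m < top" for m
    using that unfolding r_def by (intro integrableI_nonneg) auto
  have "eventually (\<lambda>m. r m < 1) sequentially" by (rule fin) simp
  then obtain m where m: "r m < 1" by (auto simp: eventually_sequentially)
  then have "r m < top" using order.strict_trans ennreal_one_less_top by blast
  then have "integrable M (\<lambda>\<omega>. 2 * (D \<omega> - elem_integral (xs m) \<omega>)\<^sup>2 + 2 * (elem_integral (xs m) \<omega>)\<^sup>2)"
    using sq elementary_isometry(2)[OF xs] by auto
  then have D2: "integrable M (\<lambda>\<omega>. (D \<omega>)\<^sup>2)"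
  proof (rule Bochner_Integration.integrable_bound)
    have "(D \<omega>)\<^sup>2 \<le> 2 * (D \<omega> - elem_integral (xs m) \<omega>)\<^sup>2 + 2 * (elem_integral (xs m) \<omega>)\<^sup>2" for \<omega>
    proof -
      have "0 \<le> (D \<omega> - 2 * elem_integral (xs m) \<omega>)\<^sup>2" by simp
      then show ?thesis by (simp add: power2_eq_square algebra_simps)
    qed
    then show "AE \<omega> in M. norm ((D \<omega>)\<^sup>2) \<le> norm (2 * (D \<omega> - elem_integral (xs m) \<omega>)\<^sup>2 + 2 * (elem_integral (xs m) \<omega>)\<^sup>2)"
      by (intro AE_I2) (auto intro: order.trans[OF _ abs_ge_self])
  qed measurable
  then show "integrable M (\<lambda>\<omega>. (I t \<omega> - I s \<omega>)\<^sup>2)" by (simp add: D_def)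
  have D1: "integrable M D" by (rule square_integrable_imp_integrable[OF _ D2]) measurable
  then show "integrable M (\<lambda>\<omega>. I t \<omega> - I s \<omega>)" by (simp add: D_def[abs_def])
  assume Z: "Z \<in> borel_measurable (F s)" "bounded (Z ` space M)"
  have [measurable]: "Z \<in> borel_measurable M" using measurable_M[OF st(1) Z(1)] .
  obtain K where K: "\<And>\<omega>. \<omega> \<in> space M \<Longrightarrow> \<bar>Z \<omega>\<bar> \<le> K" "K > 0"
    using Z(2) unfolding bounded_pos by auto
  have E1: "integrable M (elem_integral (xs m))" for m
    by (rule square_integrable_imp_integrable[OF _ elementary_isometry(2)[OF xs]]) measurable
  have ZD: "integrable M (\<lambda>\<omega>. Z \<omega> * D \<omega>)"
  proof (rule Bochner_Integration.integrable_bound[of _ "\<lambda>\<omega>. K * D \<omega>"])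
    show "AE \<omega> in M. norm (Z \<omega> * D \<omega>) \<le> norm (K * D \<omega>)"
      using K by (intro AE_I2) (auto simp: abs_mult intro!: mult_right_mono)
  qed (use D1 in auto)
  \<comment> \<open>The approximant is orthogonal to \<open>Z\<close>, so the expectation is that of
    \<open>Z\<close> times the approximation error. Nonnegativity of the variance bounds its square
    by the second moment, hence by \<open>K\<^sup>2\<close> times the squared
    \<open>L\<^sup>2\<close> distance.\<close>
  have est: "(expectation (\<lambda>\<omega>. Z \<omega> * D \<omega>))\<^sup>2 \<le> K\<^sup>2 * e" if "e > 0" for e
  proof -
    obtain m where m: "r m < ennreal e" using fin[of "ennreal e"] \<open>e > 0\<close> by (auto simp: eventually_sequentially)
    then have rt: "r m < top" using order.strict_trans ennreal_less_top by blast
    let ?y = "\<lambda>\<omega>. D \<omega> - elem_integral (xs m) \<omega>"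
    let ?X = "\<lambda>\<omega>. Z \<omega> * ?y \<omega>"
    have ZE: "has_bochner_integral M (\<lambda>\<omega>. Z \<omega> * elem_integral (xs m) \<omega>) 0"
      by (rule elementary_orthogonal[OF xs st(1) _ Z]) (use simple_restrict(2)[OF sd st] in \<open>simp add: xs_def\<close>)
    have X1: "integrable M ?X" using ZD ZE by (simp add: right_diff_distrib has_bochner_integral_iff)
    have X2: "integrable M (\<lambda>\<omega>. (?X \<omega>)\<^sup>2)" and le: "expectation (\<lambda>\<omega>. (?X \<omega>)\<^sup>2) \<le> K\<^sup>2 * expectation (\<lambda>\<omega>. (?y \<omega>)\<^sup>2)"
    proof -
      have i: "integrable M (\<lambda>\<omega>. K\<^sup>2 * (?y \<omega>)\<^sup>2)" using sq[OF rt] by simp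
      have b: "(?X \<omega>)\<^sup>2 \<le> K\<^sup>2 * (?y \<omega>)\<^sup>2" if "\<omega> \<in> space M" for \<omega>
        unfolding power_mult_distrib using K(1)[OF that] K(2) by (intro mult_right_mono) (auto simp: abs_le_square_iff[symmetric])
      show X2: "integrable M (\<lambda>\<omega>. (?X \<omega>)\<^sup>2)"
      proof (rule Bochner_Integration.integrable_bound[OF i])
        show "AE \<omega> in M. norm ((?X \<omega>)\<^sup>2) \<le> norm (K\<^sup>2 * (?y \<omega>)\<^sup>2)"
          using b by (intro AE_I2) auto
      qed measurable
      have "expectation (\<lambda>\<omega>. (?X \<omega>)\<^sup>2) \<le> expectation (\<lambda>\<omega>. K\<^sup>2 * (?y \<omega>)\<^sup>2)"
        by (rule integral_mono[OF X2 i b])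
      then show "expectation (\<lambda>\<omega>. (?X \<omega>)\<^sup>2) \<le> K\<^sup>2 * expectation (\<lambda>\<omega>. (?y \<omega>)\<^sup>2)" by simp
    qed
    have "expectation ?X = expectation (\<lambda>\<omega>. Z \<omega> * D \<omega>)"
      using ZD ZE by (simp add: right_diff_distrib has_bochner_integral_iff)
    moreover have "(expectation ?X)\<^sup>2 \<le> expectation (\<lambda>\<omega>. (?X \<omega>)\<^sup>2)"
      using variance_eq[OF X1 X2] variance_positive[of ?X] by simp
    moreover have "expectation (\<lambda>\<omega>. (?y \<omega>)\<^sup>2) \<le> e"
    proof -
      have "ennreal (expectation (\<lambda>\<omega>. (?y \<omega>)\<^sup>2)) = r m"
        unfolding r_def by (rule nn_integral_eq_integral[OF sq[OF rt], symmetric]) simp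
      then have "ennreal (expectation (\<lambda>\<omega>. (?y \<omega>)\<^sup>2)) < ennreal e" using m by simp
      then show ?thesis by (metis ennreal_leI linorder_le_cases not_le)
    qed
    ultimately show ?thesis using le K(2) by (smt (verit) mult_left_mono zero_le_power2)
  qed
  have "(expectation (\<lambda>\<omega>. Z \<omega> * D \<omega>))\<^sup>2 \<le> 0"
  proof (rule field_le_epsilon)
    fix e :: real assume "e > 0"
    then show "(expectation (\<lambda>\<omega>. Z \<omega> * D \<omega>))\<^sup>2 \<le> 0 + e"
      using est[of "e / K\<^sup>2"] K(2) by simp
  qed
  then show "expectation (\<lambda>\<omega>. Z \<omega> * (I t \<omega> - I s \<omega>)) = 0" by (simp add: D_def)
qed

end

section \<open>The Yamada-Watanabe estimate\<close>

lemma floor_grid_tendsto: "(\<lambda>i. real_of_int \<lfloor>v * real (Suc i)\<rfloor> / real (Suc i)) \<longlonglongrightarrow> v"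
proof (rule tendsto_sandwich)
  have b: "v * real (Suc i) - 1 \<le> real_of_int \<lfloor>v * real (Suc i)\<rfloor>" "real_of_int \<lfloor>v * real (Suc i)\<rfloor> \<le> v * real (Suc i)" for i
    by linarith+
  show "eventually (\<lambda>i. v - 1 / real (Suc i) \<le> real_of_int \<lfloor>v * real (Suc i)\<rfloor> / real (Suc i)) sequentially"
  proof (intro always_eventually allI)
    fix i show "v - 1 / real (Suc i) \<le> real_of_int \<lfloor>v * real (Suc i)\<rfloor> / real (Suc i)"
      using divide_right_mono[OF b(1)[of i], of "real (Suc i)"] by (simp add: diff_divide_distrib del: of_nat_Suc)
  qed
  show "eventually (\<lambda>i. real_of_int \<lfloor>v * real (Suc i)\<rfloor> / real (Suc i) \<le> v) sequentially"
    using b(2) by (intro always_eventually allI) (simp add: field_simps del: of_nat_Suc)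
  have "(\<lambda>i. v - 1 / real (Suc i)) \<longlonglongrightarrow> v - 0"
    by (intro tendsto_diff tendsto_const LIMSEQ_Suc[OF lim_1_over_n])
  then show "(\<lambda>i. v - 1 / real (Suc i)) \<longlonglongrightarrow> v" by simp
qed simp

text \<open>The process is the pointwise limit of its samples at the grid points to the left; each
  sampled process takes only countably many time indices, and is therefore jointly
  measurable.\<close>

lemma continuous_process_measurable:
  fixes X :: "real \<Rightarrow> 'w \<Rightarrow> 'x::metric_space"
  assumes m: "\<And>t. 0 \<le> t \<Longrightarrow> X t \<in> borel_measurable M"
    and c: "\<And>\<omega>. \<omega> \<in> space M \<Longrightarrow> continuous_on {0..} (\<lambda>t. X t \<omega>)"
  shows "jointly_measurable M (\<lambda>u \<omega>. X (max 0 u) \<omega>)"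
proof (rule borel_measurable_LIMSEQ_metric)
  fix i :: nat
  show "(\<lambda>x. X (real (nat \<lfloor>snd x * real (Suc i)\<rfloor>) / real (Suc i)) (fst x)) \<in> borel_measurable (M \<Otimes>\<^sub>M lborel)"
  proof (rule measurable_compose_countable[where g = "\<lambda>x. nat \<lfloor>snd x * real (Suc i)\<rfloor>" and f = "\<lambda>k x. X (real k / real (Suc i)) (fst x)"])
    show "(\<lambda>x. X (real k / real (Suc i)) (fst x)) \<in> borel_measurable (M \<Otimes>\<^sub>M lborel)" for k
      by (rule measurable_compose[OF measurable_fst m]) simp
    show "(\<lambda>x. nat \<lfloor>snd x * real (Suc i)\<rfloor>) \<in> measurable (M \<Otimes>\<^sub>M lborel) (count_space UNIV)"
      by measurable
  qed
next
  fix x assume "x \<in> space (M \<Otimes>\<^sub>M lborel :: ('w \<times> real) measure)"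
  then have \<omega>: "fst x \<in> space M" by (auto simp: space_pair_measure)
  define v where "v = max 0 (snd x)"
  \<comment> \<open>At negative times \<open>nat\<close> truncates the index to 0, which is why the
    limit is the process at \<open>max 0 u\<close>.\<close>
  have eq: "real (nat \<lfloor>snd x * real (Suc i)\<rfloor>) = real_of_int \<lfloor>v * real (Suc i)\<rfloor>" for i
  proof (cases "snd x \<ge> 0")
    case True
    then show ?thesis by (simp add: v_def del: of_nat_Suc)
  next
    case False
    then have "snd x * real (Suc i) \<le> 0" by (intro mult_nonpos_nonneg) auto
    then have "\<lfloor>snd x * real (Suc i)\<rfloor> \<le> 0" by linarith
    then show ?thesis using False by (simp add: v_def del: of_nat_Suc)
  qed
  have "(\<lambda>i. real_of_int \<lfloor>v * real (Suc i)\<rfloor> / real (Suc i)) \<longlonglongrightarrow> v" by (rule floor_grid_tendsto)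
  then have "(\<lambda>i. X (real_of_int \<lfloor>v * real (Suc i)\<rfloor> / real (Suc i)) (fst x)) \<longlonglongrightarrow> X v (fst x)"
    by (rule continuous_on_tendsto_compose[OF c[OF \<omega>]])
       (auto simp: v_def intro!: always_eventually divide_nonneg_pos)
  then show "(\<lambda>i. X (real (nat \<lfloor>snd x * real (Suc i)\<rfloor>) / real (Suc i)) (fst x)) \<longlonglongrightarrow> (\<lambda>(\<omega>, u). X (max 0 u) \<omega>) x"
    by (simp only: eq split_beta' v_def)
qed

lemma
  fixes f :: "real \<Rightarrow> real"
  assumes f[measurable]: "f \<in> borel_measurable borel" and K: "\<And>u. \<bar>f u\<bar> \<le> K"
  shows bounded_set_integrable_Ioc: "set_integrable lborel {s<..t} f"
    and abs_set_integral_le: "\<bar>LBINT u:{s<..t}. f u\<bar> \<le> (LBINT u:{s<..t}. \<bar>f u\<bar>)"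
    and set_integral_abs_le: "s \<le> t \<Longrightarrow> (LBINT u:{s<..t}. \<bar>f u\<bar>) \<le> K * (t - s)"
proof -
  have fin: "emeasure lborel {s<..t} < \<infinity>" by (cases "s \<le> t") auto
  have int: "set_integrable lborel {s<..t} g" if "g \<in> borel_measurable borel" "\<And>u. \<bar>g u\<bar> \<le> K" for g :: "real \<Rightarrow> real"
    unfolding set_integrable_def
    by (rule integrableI_bounded_set_indicator[where B=K]) (use that fin in auto)
  show "set_integrable lborel {s<..t} f" by (rule int) (use assms in auto)
  show "\<bar>LBINT u:{s<..t}. f u\<bar> \<le> (LBINT u:{s<..t}. \<bar>f u\<bar>)"
    using integral_norm_bound[of lborel "\<lambda>u. indicator {s<..t} u *\<^sub>R f u"]
    by (simp add: set_lebesgue_integral_def abs_mult)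
  assume st: "s \<le> t"
  have "(LBINT u:{s<..t}. \<bar>f u\<bar>) \<le> (LBINT u:{s<..t}. K)"
    by (rule set_integral_mono) (use K order.trans[OF abs_ge_zero K] in \<open>auto intro!: int\<close>)
  also have "\<dots> = K * (t - s)" using st by (simp add: set_lebesgue_integral_def)
  finally show "(LBINT u:{s<..t}. \<bar>f u\<bar>) \<le> K * (t - s)" .
qed

context brownian_filtration
begin

text \<open>For a single path, uniform continuity on \<open>{0..T}\<close> makes the whole sum small
  with the mesh. Boundedness of \<open>a\<close> supplies the dominating constant
  \<open>(2 * K)\<^sup>2 * T\<close>, so no rate that is uniform over paths is required.\<close>

lemma riemann_error_tendsto_0:
  fixes a :: "real \<Rightarrow> 'w \<Rightarrow> real"
  assumes am: "\<And>t. 0 \<le> t \<Longrightarrow> a t \<in> borel_measurable M"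
    and ac: "\<And>\<omega>. \<omega> \<in> space M \<Longrightarrow> continuous_on {0..} (\<lambda>t. a t \<omega>)"
    and aK: "\<And>t \<omega>. 0 \<le> t \<Longrightarrow> \<omega> \<in> space M \<Longrightarrow> \<bar>a t \<omega>\<bar> \<le> K" and T: "0 \<le> T"
  shows "(\<lambda>n. \<Sum>k<n. nn_path_integral M (real k * (T / real n)) (real (Suc k) * (T / real n)) (\<lambda>u \<omega>. (a u \<omega> - a (real k * (T / real n)) \<omega>)\<^sup>2)) \<longlonglongrightarrow> 0"
proof -
  let ?t = "\<lambda>n k. real k * (T / real n)"
  define G where "G n k \<omega> = (\<integral>\<^sup>+u\<in>{?t n k..?t n (Suc k)}.
      ennreal ((a (max 0 u) \<omega> - a (?t n k) \<omega>)\<^sup>2) \<partial>lborel)" for n k \<omega>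
  have t0: "0 \<le> ?t n k" for k n using T by simp
  have Geq: "G n k \<omega> = (\<integral>\<^sup>+u\<in>{?t n k..?t n (Suc k)}.
      ennreal ((a u \<omega> - a (?t n k) \<omega>)\<^sup>2) \<partial>lborel)" for n k \<omega>
    unfolding G_def
  proof (intro nn_integral_cong, goal_cases)
    case (1 u)
    show ?case
      using order.trans[OF t0[of k n], of u] by (cases "0 \<le> u") (auto split: split_indicator)
  qed
  have Gm[measurable]: "G n k \<in> borel_measurable M" for n k
  proof -
    have [measurable]: "jointly_measurable M (\<lambda>u \<omega>. a (max 0 u) \<omega>)"
      by (rule continuous_process_measurable[OF am ac])
    have [measurable]: "a (?t n k) \<in> borel_measurable M" by (rule am[OF t0])
    show ?thesis unfolding G_def[abs_def]
      by (rule lborel.borel_measurable_nn_integral) measurable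
  qed
  have Gle: "G n k \<omega> \<le> ennreal (B * (T / real n))"
    if B: "0 \<le> B" "\<And>u. ?t n k \<le> u \<Longrightarrow> u \<le> ?t n (Suc k) \<Longrightarrow> (a u \<omega> - a (?t n k) \<omega>)\<^sup>2 \<le> B" for B n k \<omega>
  proof -
    have le: "?t n k \<le> ?t n (Suc k)" using T by (intro mult_right_mono) auto
    have "G n k \<omega> \<le> (\<integral>\<^sup>+u. ennreal B * indicator {?t n k..?t n (Suc k)} u \<partial>lborel)"
      unfolding Geq using B(2) by (intro nn_integral_mono) (auto split: split_indicator intro!: ennreal_leI)
    also have "\<dots> = ennreal B * ennreal (?t n (Suc k) - ?t n k)"
      using le by (simp add: nn_integral_cmult_indicator)
    also have "\<dots> = ennreal (B * (?t n (Suc k) - ?t n k))"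
      using B(1) le by (intro ennreal_mult[symmetric]) auto
    also have "?t n (Suc k) - ?t n k = T / real n" by (simp add: algebra_simps add_divide_distrib)
    finally show ?thesis .
  qed
  have sumle: "(\<Sum>k<n. G n k \<omega>) \<le> ennreal (B * T)"
    if "0 \<le> B" "\<And>u v. 0 \<le> v \<Longrightarrow> v \<le> u \<Longrightarrow> u \<le> T \<Longrightarrow> u - v \<le> T / real n \<Longrightarrow> (a u \<omega> - a v \<omega>)\<^sup>2 \<le> B" for B n \<omega>
  proof (cases "n = 0")
    case False
    have "(\<Sum>k<n. G n k \<omega>) \<le> (\<Sum>k<n. ennreal (B * (T / real n)))"
    proof (intro sum_mono Gle that)
      fix k u assume k: "k \<in> {..<n}" and u: "?t n k \<le> u" "u \<le> ?t n (Suc k)"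
      show "0 \<le> ?t n k" by (rule t0)
      show "u - ?t n k \<le> T / real n" using u(2) by (simp add: algebra_simps add_divide_distrib)
      have "?t n (Suc k) \<le> real n * (T / real n)" using k T by (intro mult_right_mono) auto
      then show "u \<le> T" using u(2) False by simp
    qed auto
    also have "\<dots> = ennreal (B * T)"
      using False that(1) T by (simp add: ennreal_of_nat_eq_real_of_nat ennreal_mult'[symmetric])
    finally show ?thesis .
  qed (use that T in auto)
  have "(\<lambda>n. \<integral>\<^sup>+\<omega>. (\<Sum>k<n. G n k \<omega>) \<partial>M) \<longlonglongrightarrow> (\<integral>\<^sup>+\<omega>. 0 \<partial>M)"
  proof (rule nn_integral_dominated_convergence[where w = "\<lambda>_. ennreal ((2 * K)\<^sup>2 * T)"])
    show "AE \<omega> in M. (\<Sum>k<n. G n k \<omega>) \<le> ennreal ((2 * K)\<^sup>2 * T)" for n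
    proof (intro AE_I2 sumle)
      fix \<omega> and u v :: real assume "\<omega> \<in> space M" "0 \<le> v" "v \<le> u"
      then have "\<bar>a u \<omega>\<bar> \<le> K" "\<bar>a v \<omega>\<bar> \<le> K" using aK by auto
      then have "\<bar>a u \<omega> - a v \<omega>\<bar> \<le> 2 * K" by linarith
      then show "(a u \<omega> - a v \<omega>)\<^sup>2 \<le> (2 * K)\<^sup>2" by (metis abs_ge_zero power2_abs power_mono)
    qed auto
    show "(\<integral>\<^sup>+\<omega>. ennreal ((2 * K)\<^sup>2 * T) \<partial>M) < \<infinity>" by (simp add: emeasure_space_1)
    show "AE \<omega> in M. (\<lambda>n. \<Sum>k<n. G n k \<omega>) \<longlonglongrightarrow> 0"
    proof (rule AE_I2)
      fix \<omega> assume \<omega>: "\<omega> \<in> space M"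
      have uc: "uniformly_continuous_on {0..T} (\<lambda>t. a t \<omega>)"
        by (rule compact_uniformly_continuous) (auto intro: continuous_on_subset[OF ac[OF \<omega>]])
      show "(\<lambda>n. \<Sum>k<n. G n k \<omega>) \<longlonglongrightarrow> 0"
      proof (rule order_tendstoI)
        fix e :: ennreal assume "0 < e"
        then obtain e' where e': "e' > 0" "ennreal e' < e"
          by (metis dense ennreal_less_zero_iff ennreal_cases less_top order.strict_trans top.not_eq_extremum ennreal_top_neq_zero infinity_ennreal_def not_less_zero)
        \<comment> \<open>An oscillation of at most \<open>q\<close> on each cell costs
          \<open>q\<^sup>2 * T\<close> in total; the summand 1 in the denominator covers
          \<open>T = 0\<close>.\<close>
        define q where "q = sqrt (e' / (T + 1))"
        have q: "q > 0" "q\<^sup>2 * T \<le> e'" using e'(1) T by (auto simp: q_def divide_simps)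
        obtain d where d: "d > 0" "\<And>x y. x \<in> {0..T} \<Longrightarrow> y \<in> {0..T} \<Longrightarrow> dist y x < d \<Longrightarrow> dist (a y \<omega>) (a x \<omega>) < q"
          using uc q(1) unfolding uniformly_continuous_on_def by metis
        have "(\<lambda>n. T / real n) \<longlonglongrightarrow> 0" by (rule lim_const_over_n)
        then have "eventually (\<lambda>n. T / real n < d) sequentially" using d(1) by (rule order_tendstoD)
        then show "eventually (\<lambda>n. (\<Sum>k<n. G n k \<omega>) < e) sequentially"
        proof eventually_elim
          fix n assume n: "T / real n < d"
          have "(\<Sum>k<n. G n k \<omega>) \<le> ennreal (q\<^sup>2 * T)"
          proof (rule sumle)
            fix u v :: real assume "0 \<le> v" "v \<le> u" "u \<le> T" "u - v \<le> T / real n"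
            then have "dist (a u \<omega>) (a v \<omega>) < q" using n by (intro d(2)) (auto simp: dist_real_def)
            then have "\<bar>a u \<omega> - a v \<omega>\<bar> \<le> q" by (simp add: dist_real_def)
            then show "(a u \<omega> - a v \<omega>)\<^sup>2 \<le> q\<^sup>2" by (metis abs_ge_zero power2_abs power_mono)
          qed simp
          also have "\<dots> \<le> ennreal e'" using q(2) by (rule ennreal_leI)
          finally show "(\<Sum>k<n. G n k \<omega>) < e" using e'(2) by simp
        qed
      qed simp
    qed
  qed auto
  moreover have "(\<integral>\<^sup>+\<omega>. (\<Sum>k<n. G n k \<omega>) \<partial>M) = (\<Sum>k<n. \<integral>\<^sup>+\<omega>. G n k \<omega> \<partial>M)" for n
    by (rule nn_integral_sum) simp
  ultimately show ?thesis unfolding Geq by simp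
qed

end

section \<open>One coordinate of the difference of two solutions\<close>

text \<open>\<open>H - H'\<close> is the coefficient \<open>a\<close> of the overview. The equation
  \<open>dX\<close> is stated for increments, so the values of \<open>I\<close> and
  \<open>I'\<close> at time 0 do not enter, and with an exceptional null set for each pair of times,
  as only grid points are evaluated.\<close>

locale ito_difference = brownian_filtration M F W
  for M :: "'w measure" and F :: "real \<Rightarrow> 'w measure" and W :: "real \<Rightarrow> 'w \<Rightarrow> real" +
  fixes H H' I I' X \<beta> :: "real \<Rightarrow> 'w \<Rightarrow> real" and K :: real
  assumes ito: "has_ito_integral M F W H I" and ito': "has_ito_integral M F W H' I'"
    and X_adapted: "\<And>t. 0 \<le> t \<Longrightarrow> X t \<in> borel_measurable (F t)"
    and X_0: "AE \<omega> in M. X 0 \<omega> = 0"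
    and dX: "\<And>s t. 0 \<le> s \<Longrightarrow> s \<le> t \<Longrightarrow> AE \<omega> in M. X t \<omega> - X s \<omega> =
        (I t \<omega> - I s \<omega>) - (I' t \<omega> - I' s \<omega>) + (LBINT u:{s<..t}. \<beta> u \<omega>)"
    and \<beta>_measurable: "jointly_measurable M \<beta>"
    and \<beta>_bound: "\<And>u \<omega>. \<omega> \<in> space M \<Longrightarrow> \<bar>\<beta> u \<omega>\<bar> \<le> K"
    and a_adapted: "\<And>t. 0 \<le> t \<Longrightarrow> (\<lambda>\<omega>. H t \<omega> - H' t \<omega>) \<in> borel_measurable (F t)"
    and a_continuous: "\<And>\<omega>. \<omega> \<in> space M \<Longrightarrow> continuous_on {0..} (\<lambda>t. H t \<omega> - H' t \<omega>)"
    and a_bound: "\<And>t \<omega>. 0 \<le> t \<Longrightarrow> \<omega> \<in> space M \<Longrightarrow> \<bar>H t \<omega> - H' t \<omega>\<bar> \<le> K"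
    and K_nonneg: "0 \<le> K"
begin

lemma \<beta>_path: "\<omega> \<in> space M \<Longrightarrow> (\<lambda>u. \<beta> u \<omega>) \<in> borel_measurable borel"
  using measurable_Pair2[OF \<beta>_measurable] by simp

lemma drift_measurable:
  "(\<lambda>\<omega>. LBINT u:{s<..t}. \<beta> u \<omega>) \<in> borel_measurable M"
  "(\<lambda>\<omega>. LBINT u:{s<..t}. \<bar>\<beta> u \<omega>\<bar>) \<in> borel_measurable M"
proof -
  note [measurable] = \<beta>_measurable
  show "(\<lambda>\<omega>. LBINT u:{s<..t}. \<beta> u \<omega>) \<in> borel_measurable M"
    "(\<lambda>\<omega>. LBINT u:{s<..t}. \<bar>\<beta> u \<omega>\<bar>) \<in> borel_measurable M"
    unfolding set_lebesgue_integral_def by (rule lborel.borel_measurable_lebesgue_integral; measurable)+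
qed

lemma drift_bounds:
  assumes "\<omega> \<in> space M" "s \<le> t"
  shows "\<bar>LBINT u:{s<..t}. \<beta> u \<omega>\<bar> \<le> (LBINT u:{s<..t}. \<bar>\<beta> u \<omega>\<bar>)"
    and "(LBINT u:{s<..t}. \<bar>\<beta> u \<omega>\<bar>) \<le> K * (t - s)"
  using abs_set_integral_le[OF \<beta>_path \<beta>_bound] set_integral_abs_le[OF \<beta>_path \<beta>_bound] assms by auto

lemma drift_integrable:
  assumes "s \<le> t"
  shows "integrable M (\<lambda>\<omega>. LBINT u:{s<..t}. \<bar>\<beta> u \<omega>\<bar>)"
proof (rule integrable_const_bound[of _ "K * (t - s)"])
  show "AE \<omega> in M. norm (LBINT u:{s<..t}. \<bar>\<beta> u \<omega>\<bar>) \<le> K * (t - s)"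
    using drift_bounds(2)[OF _ assms] order.trans[OF abs_ge_zero drift_bounds(1)[OF _ assms]]
    by (intro AE_I2) (auto simp: abs_of_nonneg)
qed (rule drift_measurable)

text \<open>The absolute value sits inside the integral because the drift is multiplied by
  \<open>\<phi>' (X s)\<close>, of which only the bound 1 is used. Half-open intervals make the
  quantity additive along the grid.\<close>

definition total_drift :: "real \<Rightarrow> real \<Rightarrow> real" where
  "total_drift s t = expectation (\<lambda>\<omega>. LBINT u:{s<..t}. \<bar>\<beta> u \<omega>\<bar>)"

lemma total_drift_add:
  assumes "0 \<le> s" "s \<le> t"
  shows "total_drift 0 s + total_drift s t = total_drift 0 t"
proof -
  have "total_drift 0 t = expectation (\<lambda>\<omega>. (LBINT u:{0<..s}. \<bar>\<beta> u \<omega>\<bar>) + (LBINT u:{s<..t}. \<bar>\<beta> u \<omega>\<bar>))"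
    unfolding total_drift_def
  proof (rule Bochner_Integration.integral_cong[OF refl], goal_cases)
    case \<omega>: (1 \<omega>)
    have "{0<..t} = {0<..s} \<union> {s<..t}" using assms by auto
    moreover have "set_integrable lborel {x<..y} (\<lambda>u. \<bar>\<beta> u \<omega>\<bar>)" for x y
      using bounded_set_integrable_Ioc[of "\<lambda>u. \<bar>\<beta> u \<omega>\<bar>" K x y] \<beta>_path[OF \<omega>] \<beta>_bound[OF \<omega>] by auto
    ultimately show ?case
      by (simp add: set_integral_Un)
  qed
  also have "\<dots> = total_drift 0 s + total_drift s t"
    unfolding total_drift_def using assms by (intro Bochner_Integration.integral_add drift_integrable)
  finally show ?thesis by simp
qed

lemma I_measurable: "0 \<le> t \<Longrightarrow> I t \<in> borel_measurable M" "0 \<le> t \<Longrightarrow> I' t \<in> borel_measurable M"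
  using ito ito' by (auto simp: has_ito_integral_def)

lemma X_measurable: "0 \<le> t \<Longrightarrow> X t \<in> borel_measurable M"
  by (rule measurable_M[OF _ X_adapted])

lemma X_integrable:
  assumes t: "0 \<le> t"
  shows "integrable M (X t)"
proof -
  have "integrable M (\<lambda>\<omega>. LBINT u:{0<..t}. \<beta> u \<omega>)"
  proof (rule integrable_const_bound[of _ "K * (t - 0)"])
    show "AE \<omega> in M. norm (LBINT u:{0<..t}. \<beta> u \<omega>) \<le> K * (t - 0)"
      using drift_bounds[OF _ t] by (intro AE_I2) (auto intro: order.trans)
  qed (rule drift_measurable)
  then have "integrable M (\<lambda>\<omega>. (I t \<omega> - I 0 \<omega>) - (I' t \<omega> - I' 0 \<omega>) + (LBINT u:{0<..t}. \<beta> u \<omega>))"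
    by (intro Bochner_Integration.integrable_add[OF Bochner_Integration.integrable_diff[OF ito_increment(2)[OF ito _ t] ito_increment(2)[OF ito' _ t]]]) auto
  moreover have "AE \<omega> in M. (I t \<omega> - I 0 \<omega>) - (I' t \<omega> - I' 0 \<omega>) + (LBINT u:{0<..t}. \<beta> u \<omega>) = X t \<omega>"
    using dX[OF order_refl t] X_0 by eventually_elim auto
  ultimately show ?thesis
    by (rule integrable_cong_AE_imp[OF _ X_measurable[OF t]])
qed

lemma noise_bound:
  assumes st: "0 \<le> s" "s \<le> t"
  defines "D \<equiv> \<lambda>\<omega>. (I t \<omega> - I s \<omega>) - (I' t \<omega> - I' s \<omega>) - (H s \<omega> - H' s \<omega>) * (W t \<omega> - W s \<omega>)"
    and "\<delta> \<equiv> nn_path_integral M s t (\<lambda>u \<omega>. (H u \<omega> - H' u \<omega> - (H s \<omega> - H' s \<omega>))\<^sup>2)"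
  shows "integrable M (\<lambda>\<omega>. (D \<omega>)\<^sup>2)" "expectation (\<lambda>\<omega>. (D \<omega>)\<^sup>2) \<le> 4 * enn2real \<delta>" "\<delta> < top"
proof -
  have t: "0 \<le> t" using st by simp
  have bd: "bounded ((\<lambda>\<omega>. H s \<omega> - H' s \<omega>) ` space M)"
    using a_bound[OF st(1)] by (auto simp: bounded_iff)
  have le: "(\<integral>\<^sup>+\<omega>. ennreal ((D \<omega>)\<^sup>2) \<partial>M) \<le> 4 * \<delta>"
    unfolding D_def \<delta>_def by (rule ito_integral_bound[OF ito ito' st a_adapted[OF st(1)] bd])
  have "\<delta> \<le> (\<integral>\<^sup>+\<omega>. ennreal ((2 * K)\<^sup>2 * (t - s)) \<partial>M)"
    unfolding \<delta>_def
  proof (rule nn_integral_mono, goal_cases)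
    case \<omega>: (1 \<omega>)
    have "(\<integral>\<^sup>+u\<in>{s..t}. ennreal ((H u \<omega> - H' u \<omega> - (H s \<omega> - H' s \<omega>))\<^sup>2) \<partial>lborel) \<le> (\<integral>\<^sup>+u. ennreal ((2 * K)\<^sup>2) * indicator {s..t} u \<partial>lborel)"
    proof (rule nn_integral_mono, goal_cases)
      case (1 u)
      have "(H u \<omega> - H' u \<omega> - (H s \<omega> - H' s \<omega>))\<^sup>2 \<le> (2 * K)\<^sup>2" if "u \<in> {s..t}"
      proof -
        have "\<bar>H u \<omega> - H' u \<omega>\<bar> \<le> K" "\<bar>H s \<omega> - H' s \<omega>\<bar> \<le> K" using a_bound[OF _ \<omega>] st that by auto
        then have "\<bar>H u \<omega> - H' u \<omega> - (H s \<omega> - H' s \<omega>)\<bar> \<le> 2 * K" by linarith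
        then show ?thesis by (metis abs_ge_zero power2_abs power_mono)
      qed
      then show ?case
        by (auto split: split_indicator intro!: ennreal_leI)
    qed
    also have "\<dots> = ennreal ((2 * K)\<^sup>2 * (t - s))"
      using st by (simp add: nn_integral_cmult_indicator ennreal_mult)
    finally show ?case .
  qed
  also have "\<dots> < top" by (simp add: emeasure_space_1)
  finally show fin: "\<delta> < top" .
  have [measurable]: "D \<in> borel_measurable M"
    using I_measurable[OF st(1)] I_measurable[OF t] W_measurable[OF st(1)] W_measurable[OF t] measurable_M[OF st(1) a_adapted[OF st(1)]]
    unfolding D_def by measurable
  have "4 * \<delta> < top" using fin by (simp add: ennreal_mult_less_top)
  then show int: "integrable M (\<lambda>\<omega>. (D \<omega>)\<^sup>2)"
    using le by (intro integrableI_nonneg) (auto intro: order.strict_trans1)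
  have "(\<integral>\<^sup>+\<omega>. ennreal ((D \<omega>)\<^sup>2) \<partial>M) = ennreal (expectation (\<lambda>\<omega>. (D \<omega>)\<^sup>2))"
    by (rule nn_integral_eq_integral[OF int]) simp
  then have "ennreal (expectation (\<lambda>\<omega>. (D \<omega>)\<^sup>2)) \<le> 4 * \<delta>" using le by simp
  also have "4 * \<delta> = ennreal (4 * enn2real \<delta>)" using fin by (simp add: ennreal_mult)
  finally show "expectation (\<lambda>\<omega>. (D \<omega>)\<^sup>2) \<le> 4 * enn2real \<delta>"
    by (simp add: ennreal_le_iff)
qed

text \<open>The rest of the estimate knows the test function only through these properties; the
  modulus of \<sigma> has been absorbed into \<open>\<psi>_small\<close>.\<close>

context
  fixes \<phi> \<phi>' \<psi> :: "real \<Rightarrow> real" and L \<kappa> :: real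
  assumes \<phi>: "\<And>x. (\<phi> has_real_derivative \<phi>' x) (at x)" "\<And>x. (\<phi>' has_real_derivative \<psi> x) (at x)"
    and \<phi>_0: "\<phi> 0 = 0" and \<phi>'_le: "\<And>x. \<bar>\<phi>' x\<bar> \<le> 1" and \<psi>_bounds: "\<And>x. 0 \<le> \<psi> x \<and> \<psi> x \<le> L"
    and \<psi>_uc: "uniformly_continuous_on UNIV \<psi>"
    and \<psi>_small: "\<And>t \<omega>. 0 \<le> t \<Longrightarrow> \<omega> \<in> space M \<Longrightarrow> \<psi> (X t \<omega>) * (H t \<omega> - H' t \<omega>)\<^sup>2 \<le> \<kappa>"
begin

lemma \<phi>_abs_le: "\<bar>\<phi> x\<bar> \<le> \<bar>x\<bar>"
proof -
  have "norm (\<phi> x - \<phi> 0) \<le> 1 * norm (x - 0)"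
    by (rule field_differentiable_bound[of UNIV \<phi> \<phi>']) (use \<phi>(1) \<phi>'_le in auto)
  then show ?thesis by (simp add: \<phi>_0)
qed

lemma \<phi>_measurable: "\<phi> \<in> borel_measurable borel" "\<phi>' \<in> borel_measurable borel"
  by (auto intro!: borel_measurable_continuous_onI DERIV_continuous_on[OF has_field_derivative_at_within] \<phi>)

lemma \<phi>_X_integrable: "0 \<le> t \<Longrightarrow> integrable M (\<lambda>\<omega>. \<phi> (X t \<omega>))"
  by (rule Bochner_Integration.integrable_bound[OF X_integrable])
     (auto intro!: measurable_compose[OF X_measurable \<phi>_measurable(1)] \<phi>_abs_le)

text \<open>One grid step of the Taylor bound, with increment \<open>g + (D + b)\<close>: frozen
  noise \<open>g\<close>, freezing error \<open>D\<close>, drift \<open>b\<close>. The linear noise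
  term has mean 0, the quadratic one is controlled by \<open>\<psi>_small\<close> and the variance
  \<open>t - s\<close>, and the remaining terms are of second order in the step or controlled by
  \<delta>.\<close>

lemma expectation_step:
  assumes st: "0 \<le> s" "s \<le> t" and C: "0 \<le> C" and \<eta>: "0 < \<eta>"
    and Taylor: "\<And>x g e. \<phi> (x + (g + e)) \<le> \<phi> x + \<phi>' x * (g + e) + \<psi> x * g\<^sup>2 / 2 + \<eta> * g\<^sup>2 + C * g^4 + C * e\<^sup>2"
  defines "\<delta> \<equiv> nn_path_integral M s t (\<lambda>u \<omega>. (H u \<omega> - H' u \<omega> - (H s \<omega> - H' s \<omega>))\<^sup>2)"
  shows "expectation (\<lambda>\<omega>. \<phi> (X t \<omega>)) \<le> expectation (\<lambda>\<omega>. \<phi> (X s \<omega>)) + total_drift s t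
     + (\<kappa> / 2 + \<eta> * K\<^sup>2) * (t - s) + C * K^4 * (3 * (t - s)\<^sup>2) + 2 * C * (4 * enn2real \<delta>) + 2 * C * K\<^sup>2 * (t - s)\<^sup>2"
proof -
  have t: "0 \<le> t" using st by simp
  define g where "g \<omega> = (H s \<omega> - H' s \<omega>) * (W t \<omega> - W s \<omega>)" for \<omega>
  define D where "D \<omega> = (I t \<omega> - I s \<omega>) - (I' t \<omega> - I' s \<omega>) - g \<omega>" for \<omega>
  define bb where "bb \<omega> = (LBINT u:{s<..t}. \<bar>\<beta> u \<omega>\<bar>)" for \<omega>
  define Z where "Z \<omega> = \<phi>' (X s \<omega>)" for \<omega>
  have Zm: "Z \<in> borel_measurable (F s)"
    unfolding Z_def by (rule measurable_compose[OF X_adapted[OF st(1)] \<phi>_measurable(2)])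
  have Zb: "bounded (Z ` space M)" using \<phi>'_le by (auto simp: bounded_iff Z_def)
  note nb = noise_bound[OF st, folded g_def, folded D_def \<delta>_def]
  have Zint: "integrable M (\<lambda>\<omega>. Z \<omega> * f \<omega>)" if "integrable M f" for f
  proof (rule Bochner_Integration.integrable_bound[OF that])
    show "AE \<omega> in M. norm (Z \<omega> * f \<omega>) \<le> norm (f \<omega>)"
      using \<phi>'_le by (intro AE_I2) (auto simp: Z_def abs_mult intro: mult_left_le_one_le)
    show "(\<lambda>\<omega>. Z \<omega> * f \<omega>) \<in> borel_measurable M"
      using measurable_M[OF st(1) Zm] that by auto
  qed
  have i1: "integrable M (\<lambda>\<omega>. \<phi> (X s \<omega>))" by (rule \<phi>_X_integrable[OF st(1)])
  have i2: "integrable M (\<lambda>\<omega>. Z \<omega> * (I t \<omega> - I s \<omega>))" "integrable M (\<lambda>\<omega>. Z \<omega> * (I' t \<omega> - I' s \<omega>))"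
    by (rule Zint[OF ito_increment(2)[OF ito st]], rule Zint[OF ito_increment(2)[OF ito' st]])
  have i3: "integrable M bb" unfolding bb_def by (rule drift_integrable[OF st(2)])
  have i4: "integrable M (\<lambda>\<omega>. (\<kappa> / 2 + \<eta> * K\<^sup>2) * (W t \<omega> - W s \<omega>)\<^sup>2)" "integrable M (\<lambda>\<omega>. C * K^4 * (W t \<omega> - W s \<omega>)^4)"
    using increment_integrable[OF st] by auto
  have i5: "integrable M (\<lambda>\<omega>. 2 * C * (D \<omega>)\<^sup>2)" using nb(1) by auto
  \<comment> \<open>The pathwise majorant is arranged so that each summand has a known or separately
    bounded expectation.\<close>
  define R where "R \<omega> = \<phi> (X s \<omega>) + (Z \<omega> * (I t \<omega> - I s \<omega>) - Z \<omega> * (I' t \<omega> - I' s \<omega>)) + bb \<omega>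
     + (\<kappa> / 2 + \<eta> * K\<^sup>2) * (W t \<omega> - W s \<omega>)\<^sup>2 + C * K^4 * (W t \<omega> - W s \<omega>)^4 + 2 * C * (D \<omega>)\<^sup>2 + 2 * C * K\<^sup>2 * (t - s)\<^sup>2" for \<omega>
  have ae: "AE \<omega> in M. \<phi> (X t \<omega>) \<le> R \<omega>"
    using dX[OF st] AE_space
  proof eventually_elim
    case (elim \<omega>)
    note eq = elim(1) and \<omega> = elim(2)
    define b where "b = (LBINT u:{s<..t}. \<beta> u \<omega>)"
    have b: "\<bar>b\<bar> \<le> bb \<omega>" "bb \<omega> \<le> K * (t - s)"
      using drift_bounds[OF \<omega> st(2)] by (auto simp: b_def bb_def)
    have X: "X t \<omega> = X s \<omega> + (g \<omega> + (D \<omega> + b))" using eq by (simp add: D_def b_def)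
    have K2: "(H s \<omega> - H' s \<omega>)\<^sup>2 \<le> K\<^sup>2" using a_bound[OF st(1) \<omega>] K_nonneg by (simp add: abs_le_square_iff[symmetric])
    have K4: "(H s \<omega> - H' s \<omega>)^4 \<le> K^4"
      using power_mono[OF K2, of 2] by (simp flip: power_mult)
    \<comment> \<open>By definition of \<open>D\<close>, the sum \<open>g + D\<close> is exactly the
      difference of the two Ito increments. The first-order term therefore contains no freezing
      error, only the drift.\<close>
    have 1: "Z \<omega> * (g \<omega> + (D \<omega> + b)) \<le> (Z \<omega> * (I t \<omega> - I s \<omega>) - Z \<omega> * (I' t \<omega> - I' s \<omega>)) + bb \<omega>"
    proof -
      have "Z \<omega> * b \<le> \<bar>Z \<omega>\<bar> * \<bar>b\<bar>" by (metis abs_ge_self abs_mult)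
      also have "\<dots> \<le> 1 * \<bar>b\<bar>" using \<phi>'_le by (intro mult_right_mono) (auto simp: Z_def)
      finally have "Z \<omega> * b \<le> bb \<omega>" using b by simp
      then show ?thesis by (simp add: D_def algebra_simps)
    qed
    have 2: "\<psi> (X s \<omega>) * (g \<omega>)\<^sup>2 \<le> \<kappa> * (W t \<omega> - W s \<omega>)\<^sup>2"
      using mult_right_mono[OF \<psi>_small[OF st(1) \<omega>], of "(W t \<omega> - W s \<omega>)\<^sup>2"] by (simp add: g_def power_mult_distrib mult.assoc)
    have 3: "\<eta> * (g \<omega>)\<^sup>2 \<le> \<eta> * K\<^sup>2 * (W t \<omega> - W s \<omega>)\<^sup>2"
      unfolding g_def power_mult_distrib mult.assoc using \<eta> K2 by (intro mult_left_mono mult_right_mono) auto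
    have 4: "C * (g \<omega>)^4 \<le> C * K^4 * (W t \<omega> - W s \<omega>)^4"
      unfolding g_def power_mult_distrib mult.assoc using C K4 by (intro mult_left_mono mult_right_mono) auto
    have "b\<^sup>2 \<le> (K * (t - s))\<^sup>2" using b by (metis abs_ge_zero order.trans power2_abs power_mono)
    moreover have "(D \<omega> + b)\<^sup>2 \<le> 2 * (D \<omega>)\<^sup>2 + 2 * b\<^sup>2"
      using zero_le_power2[of "D \<omega> - b"] by (simp add: power2_eq_square algebra_simps)
    ultimately have "(D \<omega> + b)\<^sup>2 \<le> 2 * (D \<omega>)\<^sup>2 + 2 * (K * (t - s))\<^sup>2" by linarith
    then have "C * (D \<omega> + b)\<^sup>2 \<le> C * (2 * (D \<omega>)\<^sup>2 + 2 * (K * (t - s))\<^sup>2)" using C by (rule mult_left_mono)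
    then have 5: "C * (D \<omega> + b)\<^sup>2 \<le> 2 * C * (D \<omega>)\<^sup>2 + 2 * C * K\<^sup>2 * (t - s)\<^sup>2" by (simp add: power_mult_distrib distrib_left mult_ac)
    have "\<phi> (X t \<omega>) \<le> \<phi> (X s \<omega>) + Z \<omega> * (g \<omega> + (D \<omega> + b)) + \<psi> (X s \<omega>) * (g \<omega>)\<^sup>2 / 2 + \<eta> * (g \<omega>)\<^sup>2 + C * (g \<omega>)^4 + C * (D \<omega> + b)\<^sup>2"
      unfolding X Z_def by (rule Taylor)
    then show ?case
      using 1 2 3 4 5 unfolding R_def distrib_right[of "\<kappa> / 2"] by simp
  qed
  have "expectation (\<lambda>\<omega>. \<phi> (X t \<omega>)) \<le> expectation R"
    unfolding R_def[abs_def] using i1 i2 i3 i4 i5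
    by (intro integral_mono_AE[OF \<phi>_X_integrable[OF t] _ ae[unfolded R_def]] Bochner_Integration.integrable_add Bochner_Integration.integrable_diff integrable_const)
  also have "\<dots> = expectation (\<lambda>\<omega>. \<phi> (X s \<omega>)) + (expectation (\<lambda>\<omega>. Z \<omega> * (I t \<omega> - I s \<omega>)) - expectation (\<lambda>\<omega>. Z \<omega> * (I' t \<omega> - I' s \<omega>))) + expectation bb
     + expectation (\<lambda>\<omega>. (\<kappa> / 2 + \<eta> * K\<^sup>2) * (W t \<omega> - W s \<omega>)\<^sup>2) + expectation (\<lambda>\<omega>. C * K^4 * (W t \<omega> - W s \<omega>)^4) + expectation (\<lambda>\<omega>. 2 * C * (D \<omega>)\<^sup>2) + 2 * C * K\<^sup>2 * (t - s)\<^sup>2"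
  proof -
    note int = Bochner_Integration.integrable_add Bochner_Integration.integrable_diff i1 i2 i3 i4 i5 integrable_const
    show ?thesis
      unfolding R_def[abs_def]
      by ((subst Bochner_Integration.integral_add, (intro int)+)+, subst Bochner_Integration.integral_diff, (intro int)+) (simp add: prob_space)
  qed
  also have "expectation (\<lambda>\<omega>. Z \<omega> * (I t \<omega> - I s \<omega>)) = 0" by (rule ito_increment(3)[OF ito st Zm Zb])
  also have "expectation (\<lambda>\<omega>. Z \<omega> * (I' t \<omega> - I' s \<omega>)) = 0" by (rule ito_increment(3)[OF ito' st Zm Zb])
  also have "expectation bb = total_drift s t" by (simp add: bb_def[abs_def] total_drift_def)
  also have "expectation (\<lambda>\<omega>. (\<kappa> / 2 + \<eta> * K\<^sup>2) * (W t \<omega> - W s \<omega>)\<^sup>2) = (\<kappa> / 2 + \<eta> * K\<^sup>2) * (t - s)"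
    using increment_moment_2[OF st] by simp
  also have "expectation (\<lambda>\<omega>. C * K^4 * (W t \<omega> - W s \<omega>)^4) = C * K^4 * (3 * (t - s)\<^sup>2)"
    using increment_moment_4[OF st] by simp
  also have "expectation (\<lambda>\<omega>. 2 * C * (D \<omega>)\<^sup>2) = 2 * C * expectation (\<lambda>\<omega>. (D \<omega>)\<^sup>2)" by simp
  finally have fin: "expectation (\<lambda>\<omega>. \<phi> (X t \<omega>)) \<le> expectation (\<lambda>\<omega>. \<phi> (X s \<omega>)) + (0 - 0) + total_drift s t + (\<kappa> / 2 + \<eta> * K\<^sup>2) * (t - s)
     + C * K^4 * (3 * (t - s)\<^sup>2) + 2 * C * expectation (\<lambda>\<omega>. (D \<omega>)\<^sup>2) + 2 * C * K\<^sup>2 * (t - s)\<^sup>2" .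
  have "2 * C * expectation (\<lambda>\<omega>. (D \<omega>)\<^sup>2) \<le> 2 * C * (4 * enn2real \<delta>)"
    using nb(2) C by (intro mult_left_mono) auto
  then show ?thesis using fin by linarith
qed

text \<open>Over \<open>n\<close> steps the terms quadratic in the step length add up to order
  \<open>1 / n\<close>, and the freezing errors form the Riemann error that tends to 0. What
  survives is the drift, the \<kappa>-term, and an \<eta>-term that is removed afterwards.\<close>

lemma expectation_estimate:
  assumes T: "0 \<le> T"
  shows "expectation (\<lambda>\<omega>. \<phi> (X T \<omega>)) \<le> total_drift 0 T + \<kappa> / 2 * T"
proof -
  let ?t = "\<lambda>n k. real k * (T / real n)"
  have est: "expectation (\<lambda>\<omega>. \<phi> (X T \<omega>)) \<le> total_drift 0 T + (\<kappa> / 2 + \<eta> * K\<^sup>2) * T" if \<eta>: "\<eta> > 0" for \<eta>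
  proof -
    obtain C where C: "0 \<le> C" and Taylor: "\<And>x g e. \<phi> (x + (g + e)) \<le> \<phi> x + \<phi>' x * (g + e) + \<psi> x * g\<^sup>2 / 2 + \<eta> * g\<^sup>2 + C * g^4 + C * e\<^sup>2"
      using Taylor_upper_bound[OF \<phi> \<psi>_uc \<psi>_bounds \<eta>] by blast
    define \<delta> where "\<delta> n k = nn_path_integral M (?t n k) (?t n (Suc k)) (\<lambda>u \<omega>. (H u \<omega> - H' u \<omega> - (H (?t n k) \<omega> - H' (?t n k) \<omega>))\<^sup>2)" for n k
    define c where "c n = (\<kappa> / 2 + \<eta> * K\<^sup>2) * (T / real n) + (3 * C * K^4 + 2 * C * K\<^sup>2) * (T / real n)\<^sup>2" for n
    have t0: "0 \<le> ?t n k" for k n using T by simp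
    have tS: "?t n k \<le> ?t n (Suc k)" for k n using T by (intro mult_right_mono) auto
    have diff: "?t n (Suc k) - ?t n k = T / real n" for k n
      by (simp add: algebra_simps add_divide_distrib)
    have fin: "\<delta> n k < top" for n k unfolding \<delta>_def by (rule noise_bound(3)[OF t0 tS])
    have X0: "expectation (\<lambda>\<omega>. \<phi> (X 0 \<omega>)) = 0"
    proof -
      have "expectation (\<lambda>\<omega>. \<phi> (X 0 \<omega>)) = expectation (\<lambda>\<omega>. 0)"
        by (rule integral_cong_AE) (use X_0 \<phi>_0 in \<open>auto intro!: measurable_compose[OF X_measurable \<phi>_measurable(1)]\<close>)
      then show ?thesis by simp
    qed
    have ind: "expectation (\<lambda>\<omega>. \<phi> (X (?t n k) \<omega>)) \<le> total_drift 0 (?t n k) + real k * c n + 8 * C * (\<Sum>j<k. enn2real (\<delta> n j))" for n k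
    proof (induction k)
      case 0
      have "0 \<le> total_drift 0 0" unfolding total_drift_def set_lebesgue_integral_def by simp
      then show ?case using X0 by simp
    next
      case (Suc k)
      have "expectation (\<lambda>\<omega>. \<phi> (X (?t n (Suc k)) \<omega>)) \<le> expectation (\<lambda>\<omega>. \<phi> (X (?t n k) \<omega>))
          + total_drift (?t n k) (?t n (Suc k)) + c n + 8 * C * enn2real (\<delta> n k)"
        using expectation_step[OF t0[of k n] tS[of k n] C \<eta> Taylor] unfolding diff \<delta>_def[symmetric] c_def by (simp add: algebra_simps)
      then show ?case
        using Suc.IH total_drift_add[OF t0[of k n] tS[of k n]] by (simp add: algebra_simps del: of_nat_Suc) (simp add: algebra_simps)
    qed
    have bound: "expectation (\<lambda>\<omega>. \<phi> (X T \<omega>)) \<le> total_drift 0 T + (\<kappa> / 2 + \<eta> * K\<^sup>2) * T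
        + (3 * C * K^4 + 2 * C * K\<^sup>2) * T * (T / real n) + 8 * C * enn2real (\<Sum>j<n. \<delta> n j)" if "n > 0" for n
    proof -
      have "real n * c n = (\<kappa> / 2 + \<eta> * K\<^sup>2) * T + (3 * C * K^4 + 2 * C * K\<^sup>2) * T * (T / real n)"
        using that by (simp add: c_def power2_eq_square field_simps)
      moreover have "enn2real (\<Sum>j<n. \<delta> n j) = (\<Sum>j<n. enn2real (\<delta> n j))"
        using fin by (simp add: enn2real_sum o_def)
      ultimately show ?thesis using ind[of n n] that by simp
    qed
    have "(\<lambda>n. \<Sum>j<n. \<delta> n j) \<longlonglongrightarrow> 0"
      unfolding \<delta>_def
      by (rule riemann_error_tendsto_0[where a = "\<lambda>t \<omega>. H t \<omega> - H' t \<omega>" and K = K, OF _ a_continuous a_bound T])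
         (auto intro: measurable_M a_adapted)
    then have d0: "(\<lambda>n. enn2real (\<Sum>j<n. \<delta> n j)) \<longlonglongrightarrow> 0"
      using tendsto_enn2real[of "\<lambda>n. \<Sum>j<n. \<delta> n j" 0] by (simp add: zero_ennreal_def[symmetric])
    have "(\<lambda>n. total_drift 0 T + (\<kappa> / 2 + \<eta> * K\<^sup>2) * T
        + (3 * C * K^4 + 2 * C * K\<^sup>2) * T * (T / real n) + 8 * C * enn2real (\<Sum>j<n. \<delta> n j)) \<longlonglongrightarrow>
        total_drift 0 T + (\<kappa> / 2 + \<eta> * K\<^sup>2) * T + (3 * C * K^4 + 2 * C * K\<^sup>2) * T * 0 + 8 * C * 0"
      by (intro tendsto_intros d0 lim_const_over_n)
    then have "(\<lambda>n. total_drift 0 T + (\<kappa> / 2 + \<eta> * K\<^sup>2) * T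
        + (3 * C * K^4 + 2 * C * K\<^sup>2) * T * (T / real n) + 8 * C * enn2real (\<Sum>j<n. \<delta> n j)) \<longlonglongrightarrow>
        total_drift 0 T + (\<kappa> / 2 + \<eta> * K\<^sup>2) * T" by simp
    then show ?thesis
      by (rule LIMSEQ_le_const) (use bound in \<open>auto intro!: exI[of _ 1]\<close>)
  qed
  show ?thesis
  proof (rule field_le_epsilon)
    fix e :: real assume e: "e > 0"
    \<comment> \<open>The summand 1 in the denominator covers the case
      \<open>K\<^sup>2 * T = 0\<close>.\<close>
    define \<eta> where "\<eta> = e / (K\<^sup>2 * T + 1)"
    have p: "K\<^sup>2 * T + 1 > 0" using T by (simp add: add_nonneg_pos)
    have "\<eta> * (K\<^sup>2 * T) \<le> e" using e p T by (simp add: \<eta>_def divide_simps)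
    moreover have "\<eta> > 0" using e p by (simp add: \<eta>_def)
    ultimately show "expectation (\<lambda>\<omega>. \<phi> (X T \<omega>)) \<le> total_drift 0 T + \<kappa> / 2 * T + e"
      using est[of \<eta>] by (simp add: algebra_simps)
  qed
qed

end

theorem L1_estimate:
  fixes \<rho> s :: "real \<Rightarrow> real"
  assumes pos: "\<And>x. \<rho> x > 0" and meas: "\<rho> \<in> borel_measurable borel"
    and Osgood: "\<And>d. d > 0 \<Longrightarrow> (\<integral>\<^sup>+x\<in>{0<..<d}. ennreal (1 / \<rho> x) \<partial>lborel) = \<infinity>"
    and s: "continuous_on UNIV s" "\<And>r. r > 0 \<Longrightarrow> (s r)\<^sup>2 \<le> \<rho> r"
    and a_le: "\<And>t \<omega>. 0 \<le> t \<Longrightarrow> \<omega> \<in> space M \<Longrightarrow> \<bar>H t \<omega> - H' t \<omega>\<bar> \<le> s \<bar>X t \<omega>\<bar>"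
    and T: "0 \<le> T"
  shows "expectation (\<lambda>\<omega>. \<bar>X T \<omega>\<bar>) \<le> total_drift 0 T"
proof (rule field_le_epsilon)
  fix e :: real assume e: "e > 0"
  \<comment> \<open>The budget \<open>e\<close> has to pay \<kappa> for replacing the absolute value
    by \<phi> and at most \<open>\<kappa> * T\<close> for the second-order term.\<close>
  define \<kappa> where "\<kappa> = e / (1 + T)"
  have \<kappa>: "\<kappa> > 0" using e T by (simp add: \<kappa>_def)
  obtain \<phi> \<phi>' \<psi> L where \<phi>: "\<And>x. (\<phi> has_real_derivative \<phi>' x) (at x)" "\<And>x. (\<phi>' has_real_derivative \<psi> x) (at x)"
    "\<phi> 0 = 0" "\<And>x. \<bar>\<phi>' x\<bar> \<le> 1" "\<And>x. 0 \<le> \<psi> x \<and> \<psi> x \<le> L" "uniformly_continuous_on UNIV \<psi>"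
    "\<And>x. \<psi> x * (s \<bar>x\<bar>)\<^sup>2 \<le> \<kappa>" "\<And>x. \<bar>x\<bar> - \<kappa> \<le> \<phi> x"
    using Yamada_Watanabe_function[OF pos meas Osgood s \<kappa>] by metis
  have small: "\<psi> (X t \<omega>) * (H t \<omega> - H' t \<omega>)\<^sup>2 \<le> \<kappa>" if "0 \<le> t" "\<omega> \<in> space M" for t \<omega>
  proof -
    have "(H t \<omega> - H' t \<omega>)\<^sup>2 \<le> (s \<bar>X t \<omega>\<bar>)\<^sup>2"
      using a_le[OF that] by (metis abs_ge_zero power2_abs power_mono)
    then have "\<psi> (X t \<omega>) * (H t \<omega> - H' t \<omega>)\<^sup>2 \<le> \<psi> (X t \<omega>) * (s \<bar>X t \<omega>\<bar>)\<^sup>2"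
      using \<phi>(5) by (intro mult_left_mono) auto
    then show ?thesis using \<phi>(7)[of "X t \<omega>"] by linarith
  qed
  have "expectation (\<lambda>\<omega>. \<bar>X T \<omega>\<bar>) - \<kappa> = expectation (\<lambda>\<omega>. \<bar>X T \<omega>\<bar> - \<kappa>)"
    using X_integrable[OF T] by (simp add: prob_space)
  also have "\<dots> \<le> expectation (\<lambda>\<omega>. \<phi> (X T \<omega>))"
    by (rule integral_mono[OF _ \<phi>_X_integrable[OF \<phi>(1-6) small T]]) (use X_integrable[OF T] \<phi>(8) in auto)
  also have "\<dots> \<le> total_drift 0 T + \<kappa> / 2 * T"
    by (rule expectation_estimate[OF \<phi>(1-6) small T])
  also have "\<dots> \<le> total_drift 0 T + \<kappa> * T" using \<kappa> T by simp
  finally have "expectation (\<lambda>\<omega>. \<bar>X T \<omega>\<bar>) \<le> total_drift 0 T + \<kappa> * (1 + T)" by (simp add: algebra_simps)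
  also have "\<kappa> * (1 + T) = e" using T by (simp add: \<kappa>_def)
  finally show "expectation (\<lambda>\<omega>. \<bar>X T \<omega>\<bar>) \<le> total_drift 0 T + e" .
qed

end

section \<open>Gronwall arguments and uniqueness\<close>

text \<open>Feeding the bound back into the integral inequality \<open>n\<close> times, starting
  from \<open>B\<close>, yields a constant multiple of the \<open>n\<close>-th term of the
  exponential series, which tends to 0.\<close>

lemma Gronwall_zero:
  fixes u :: "real \<Rightarrow> real"
  assumes C: "0 \<le> C" and B: "0 \<le> B" and u0: "\<And>t. 0 \<le> t \<Longrightarrow> t \<le> T \<Longrightarrow> 0 \<le> u t" and uB: "\<And>t. 0 \<le> t \<Longrightarrow> t \<le> T \<Longrightarrow> u t \<le> B"
    and int: "\<And>t. 0 \<le> t \<Longrightarrow> t \<le> T \<Longrightarrow> ennreal (u t) \<le> ennreal C * (\<integral>\<^sup>+s\<in>{0..t}. ennreal (u s) \<partial>lborel)"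
    and t: "0 \<le> t" "t \<le> T"
  shows "u t = 0"
proof -
  have bound: "u t \<le> B * (C * t) ^ n / fact n" if "0 \<le> t" "t \<le> T" for n t
    using that
  proof (induction n arbitrary: t)
    case 0
    then show ?case using uB by simp
  next
    case (Suc n)
    let ?F = "\<lambda>s. B * C ^ n * s ^ Suc n / fact (Suc n)"
    have "(\<integral>\<^sup>+s\<in>{0..t}. ennreal (u s) \<partial>lborel) \<le> (\<integral>\<^sup>+s. ennreal (B * (C * s) ^ n / fact n) * indicator {0..t} s \<partial>lborel)"
      using Suc.IH Suc.prems by (intro nn_integral_mono) (auto split: split_indicator intro!: ennreal_leI)
    also have "\<dots> = ennreal (?F t - ?F 0)"
    proof (rule nn_integral_FTC_Icc)
      fix s assume s: "s \<in> {0..t}"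
      show "0 \<le> B * (C * s) ^ n / fact n" using s B C by simp
      have 1: "(?F has_real_derivative B * C ^ n * (real (Suc n) * s ^ n) / fact (Suc n)) (at s)"
        by (auto intro!: derivative_eq_intros simp del: fact_Suc power_Suc of_nat_Suc)
      have 2: "B * C ^ n * (real (Suc n) * s ^ n) / fact (Suc n) = B * (C * s) ^ n / fact n"
        by (simp add: power_mult_distrib divide_simps del: of_nat_Suc)
      show "(?F has_real_derivative B * (C * s) ^ n / fact n) (at s)" by (rule DERIV_cong[OF 1 2])
    qed (use Suc.prems in auto)
    finally have "(\<integral>\<^sup>+s\<in>{0..t}. ennreal (u s) \<partial>lborel) \<le> ennreal (?F t)" by simp
    then have "ennreal C * (\<integral>\<^sup>+s\<in>{0..t}. ennreal (u s) \<partial>lborel) \<le> ennreal C * ennreal (?F t)"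
      by (rule mult_left_mono) simp
    also have "\<dots> = ennreal (C * ?F t)" by (rule ennreal_mult'[OF C, symmetric])
    finally have "ennreal (u t) \<le> ennreal (C * ?F t)" using int[OF Suc.prems] by (rule order.trans[rotated])
    then have "u t \<le> C * ?F t" using C B Suc.prems by (subst (asm) ennreal_le_iff) auto
    then show ?case by (simp add: power_mult_distrib mult_ac)
  qed
  have "(\<lambda>n. B * (inverse (fact n) * (C * t) ^ n)) \<longlonglongrightarrow> B * 0"
    by (intro tendsto_mult tendsto_const summable_LIMSEQ_zero summable_exp)
  then have "(\<lambda>n. B * (C * t) ^ n / fact n) \<longlonglongrightarrow> 0" by (simp add: divide_inverse mult_ac)
  then have "u t \<le> 0" by (rule LIMSEQ_le_const) (use bound[OF t] in blast)
  then show ?thesis using u0[OF t] by simp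
qed

text \<open>By Tonelli the iterated integral of \<open>f\<close> is the time integral of its
  expectation, to which the scalar inequality applies. The a priori bound \<open>B\<close> makes the
  expectations finite real numbers.\<close>

lemma (in prob_space) Gronwall_process:
  fixes f :: "real \<Rightarrow> 'a \<Rightarrow> real"
  assumes fm: "jointly_measurable M (\<lambda>u \<omega>. f (max 0 u) \<omega>)"
    and f0: "\<And>t \<omega>. 0 \<le> f t \<omega>" and C: "0 \<le> C"
    and fB: "\<And>t. 0 \<le> t \<Longrightarrow> t \<le> T \<Longrightarrow> (\<integral>\<^sup>+\<omega>. ennreal (f t \<omega>) \<partial>M) \<le> ennreal B"
    and int: "\<And>t. 0 \<le> t \<Longrightarrow> t \<le> T \<Longrightarrow>
      (\<integral>\<^sup>+\<omega>. ennreal (f t \<omega>) \<partial>M) \<le> ennreal C * nn_path_integral M 0 t f"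
    and t: "0 \<le> t" "t \<le> T"
  shows "AE \<omega> in M. f t \<omega> = 0"
proof -
  interpret pair_sigma_finite M "lborel :: real measure" ..
  note [measurable] = fm
  define u where "u s = enn2real (\<integral>\<^sup>+\<omega>. ennreal (f s \<omega>) \<partial>M)" for s
  have eu: "ennreal (u s) = (\<integral>\<^sup>+\<omega>. ennreal (f s \<omega>) \<partial>M)" if "0 \<le> s" "s \<le> T" for s
    using fB[OF that] unfolding u_def by (intro ennreal_enn2real) (auto intro: order.strict_trans1)
  have "u t = 0"
  \<comment> \<open>No sign is assumed for \<open>B\<close>, whereas the scalar version asks for a
    nonnegative starting bound.\<close>
  proof (rule Gronwall_zero[OF C, of "max 0 B" T u])
    fix r assume r: "0 \<le> r" "r \<le> T"
    show "0 \<le> u r" by (simp add: u_def)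
    have "ennreal (u r) \<le> ennreal (max 0 B)" using eu[OF r] fB[OF r] by (simp add: ennreal_max_0)
    then show "u r \<le> max 0 B" by (simp add: ennreal_le_iff del: ennreal_max_0 ennreal_max_0')
    have "(\<integral>\<^sup>+\<omega>. (\<integral>\<^sup>+s\<in>{0..r}. ennreal (f s \<omega>) \<partial>lborel) \<partial>M) = (\<integral>\<^sup>+\<omega>. (\<integral>\<^sup>+s. ennreal (f (max 0 s) \<omega>) * indicator {0..r} s \<partial>lborel) \<partial>M)"
      by (intro nn_integral_cong) (auto split: split_indicator)
    also have "\<dots> = (\<integral>\<^sup>+s. (\<integral>\<^sup>+\<omega>. ennreal (f (max 0 s) \<omega>) * indicator {0..r} s \<partial>M) \<partial>lborel)"
      by (rule Fubini'[symmetric]) measurable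
    also have "\<dots> = (\<integral>\<^sup>+s\<in>{0..r}. ennreal (u s) \<partial>lborel)"
      using r eu by (intro nn_integral_cong) (auto split: split_indicator)
    finally show "ennreal (u r) \<le> ennreal C * (\<integral>\<^sup>+s\<in>{0..r}. ennreal (u s) \<partial>lborel)"
      using int[OF r] eu[OF r] by simp
  qed (use t in auto)
  then have "(\<integral>\<^sup>+\<omega>. ennreal (f t \<omega>) \<partial>M) = 0" using eu[OF t] by simp
  moreover have "f t \<in> borel_measurable M"
    using measurable_Pair1[OF fm, of t] t by simp
  ultimately have "AE \<omega> in M. ennreal (f t \<omega>) = 0" by (simp add: nn_integral_0_iff_AE)
  then show ?thesis by eventually_elim (metis f0 ennreal_eq_0_iff order_antisym)
qed

text \<open>Countably many null sets, one for each nonnegative rational time, have a null union;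
  outside it continuity extends the equality from this dense set to all times.\<close>

lemma continuous_processes_eq_AE:
  fixes X X' :: "real \<Rightarrow> 'w \<Rightarrow> 'x::metric_space"
  assumes c: "\<And>\<omega>. \<omega> \<in> space M \<Longrightarrow> continuous_on {0..} (\<lambda>t. X t \<omega>)" "\<And>\<omega>. \<omega> \<in> space M \<Longrightarrow> continuous_on {0..} (\<lambda>t. X' t \<omega>)"
    and eq: "\<And>t. 0 \<le> t \<Longrightarrow> AE \<omega> in M. X t \<omega> = X' t \<omega>"
  shows "AE \<omega> in M. \<forall>t\<ge>0. X t \<omega> = X' t \<omega>"
proof -
  have "AE \<omega> in M. \<forall>i m::nat. X (real m / real (Suc i)) \<omega> = X' (real m / real (Suc i)) \<omega>"
    unfolding AE_all_countable by (intro allI eq) simp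
  with AE_space show ?thesis
  proof eventually_elim
    fix \<omega> assume \<omega>: "\<omega> \<in> space M" and e: "\<forall>i m::nat. X (real m / real (Suc i)) \<omega> = X' (real m / real (Suc i)) \<omega>"
    show "\<forall>t\<ge>0. X t \<omega> = X' t \<omega>"
    proof (intro allI impI)
      fix t :: real assume t: "0 \<le> t"
      define q where "q i = real (nat \<lfloor>t * real (Suc i)\<rfloor>) / real (Suc i)" for i
      have "q = (\<lambda>i. real_of_int \<lfloor>t * real (Suc i)\<rfloor> / real (Suc i))"
        using t by (auto simp: q_def fun_eq_iff simp del: of_nat_Suc)
      then have q: "q \<longlonglongrightarrow> t" using floor_grid_tendsto[of t] by simp
      have q0: "\<forall>\<^sub>F i in sequentially. q i \<in> {0..}" by (simp add: q_def)
      have "(\<lambda>i. X (q i) \<omega>) \<longlonglongrightarrow> X t \<omega>" "(\<lambda>i. X' (q i) \<omega>) \<longlonglongrightarrow> X' t \<omega>"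
        using continuous_on_tendsto_compose[OF c(1)[OF \<omega>] q _ q0] continuous_on_tendsto_compose[OF c(2)[OF \<omega>] q _ q0] t by auto
      moreover have "X (q i) \<omega> = X' (q i) \<omega>" for i using e by (simp add: q_def)
      ultimately show "X t \<omega> = X' t \<omega>" using LIMSEQ_unique by simp
    qed
  qed
qed

text \<open>Cauchy-Schwarz in time, obtained by integrating the nonnegative square of
  \<open>g - m\<close> with \<open>m\<close> the mean of \<open>g\<close> over the interval.\<close>

lemma square_set_integral_le:
  fixes g :: "real \<Rightarrow> real"
  assumes g[measurable]: "g \<in> borel_measurable borel" and K: "\<And>u. \<bar>g u\<bar> \<le> K" and t: "0 \<le> t"
  shows "ennreal ((LBINT u:{0<..t}. g u)\<^sup>2) \<le> ennreal t * (\<integral>\<^sup>+u\<in>{0..t}. ennreal ((g u)\<^sup>2) \<partial>lborel)"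
proof (cases "t = 0")
  case True
  then show ?thesis by (simp add: set_lebesgue_integral_def)
next
  case False
  then have tp: "t > 0" using t by simp
  define G where "G = (LBINT u:{0<..t}. g u)"
  define m where "m = G / t"
  have K2: "\<bar>(g u)\<^sup>2\<bar> \<le> K\<^sup>2" for u using K[of u] by (metis abs_ge_zero abs_power2 power2_abs power_mono)
  have ig: "set_integrable lborel {0<..t} g" by (rule bounded_set_integrable_Ioc[OF g K])
  have ig2: "set_integrable lborel {0<..t} (\<lambda>u. (g u)\<^sup>2)" by (rule bounded_set_integrable_Ioc[OF _ K2]) measurable
  have ic: "set_integrable lborel {0<..t} (\<lambda>u. m\<^sup>2)" by (rule bounded_set_integrable_Ioc[of _ "m\<^sup>2"]) auto
  have "(LBINT u:{0<..t}. 2 * m * g u - m\<^sup>2) \<le> (LBINT u:{0<..t}. (g u)\<^sup>2)"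
  proof (rule set_integral_mono)
    show "set_integrable lborel {0<..t} (\<lambda>u. 2 * m * g u - m\<^sup>2)" using ig ic by (intro set_integral_diff set_integrable_mult_right)
    show "2 * m * g u - m\<^sup>2 \<le> (g u)\<^sup>2" for u using zero_le_power2[of "g u - m"] by (simp add: power2_eq_square algebra_simps)
  qed (rule ig2)
  also have "(LBINT u:{0<..t}. 2 * m * g u - m\<^sup>2) = 2 * m * G - m\<^sup>2 * t"
    using ig ic t by (subst set_integral_diff(2)) (auto simp: G_def set_lebesgue_integral_def)
  also have "\<dots> = G\<^sup>2 / t" using tp by (simp add: m_def power2_eq_square field_simps)
  finally have "G\<^sup>2 \<le> t * (LBINT u:{0<..t}. (g u)\<^sup>2)" using tp by (simp add: field_simps)
  then have "ennreal (G\<^sup>2) \<le> ennreal (t * (LBINT u:{0<..t}. (g u)\<^sup>2))" by (rule ennreal_leI)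
  also have "\<dots> = ennreal t * ennreal (LBINT u:{0<..t}. (g u)\<^sup>2)" using t by (simp add: ennreal_mult')
  also have "ennreal (LBINT u:{0<..t}. (g u)\<^sup>2) = (\<integral>\<^sup>+u. ennreal (indicator {0<..t} u *\<^sub>R (g u)\<^sup>2) \<partial>lborel)"
    unfolding set_lebesgue_integral_def using ig2
    by (intro nn_integral_eq_integral[symmetric]) (auto simp: set_integrable_def)
  also have "\<dots> \<le> (\<integral>\<^sup>+u\<in>{0..t}. ennreal ((g u)\<^sup>2) \<partial>lborel)"
    by (intro nn_integral_mono) (auto split: split_indicator)
  finally show ?thesis unfolding G_def by (simp add: mult_left_mono)
qed

lemma abs_set_integral_le_nn_integral:
  fixes g :: "real \<Rightarrow> real"
  assumes g[measurable]: "g \<in> borel_measurable borel" and K: "\<And>u. \<bar>g u\<bar> \<le> K"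
  shows "ennreal (LBINT u:{0<..t}. \<bar>g u\<bar>) \<le> (\<integral>\<^sup>+u\<in>{0..t}. ennreal \<bar>g u\<bar> \<partial>lborel)"
proof -
  have i: "set_integrable lborel {0<..t} (\<lambda>u. \<bar>g u\<bar>)" by (rule bounded_set_integrable_Ioc[of _ K]) (use K in auto)
  have "ennreal (LBINT u:{0<..t}. \<bar>g u\<bar>) = (\<integral>\<^sup>+u. ennreal (indicator {0<..t} u *\<^sub>R \<bar>g u\<bar>) \<partial>lborel)"
    unfolding set_lebesgue_integral_def using i
    by (intro nn_integral_eq_integral[symmetric]) (auto simp: set_integrable_def)
  also have "\<dots> \<le> (\<integral>\<^sup>+u\<in>{0..t}. ennreal \<bar>g u\<bar> \<partial>lborel)"
    by (intro nn_integral_mono) (auto split: split_indicator)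
  finally show ?thesis .
qed

text \<open>Bridges two conventions: solutions are formulated with integrals over
  \<open>{0..t}\<close> of processes that are arbitrary at negative times, the estimates with
  half-open intervals and integrands clamped to nonnegative times.\<close>

lemma set_integral_Icc_diff:
  fixes g :: "real \<Rightarrow> real"
  assumes g: "g \<in> borel_measurable borel" and K: "\<And>u. \<bar>g u\<bar> \<le> K" and st: "0 \<le> s" "s \<le> t"
    and f: "\<And>u. 0 \<le> u \<Longrightarrow> f u = g u"
  shows "(LBINT u:{0..t}. f u) - (LBINT u:{0..s}. f u) = (LBINT u:{s<..t}. g u)"
proof -
  have fg: "(LBINT u:{0..r}. f u) = (LBINT u:{0..r}. g u)" for r
    by (rule set_lebesgue_integral_cong) (auto simp: f)
  have i: "set_integrable lborel {0..s} g"
    unfolding set_integrable_def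
    by (rule integrableI_bounded_set_indicator[where B=K]) (use g K st in auto)
  have "{0..t} = {0..s} \<union> {s<..t}" using st by auto
  then have "(LBINT u:{0..t}. g u) = (LBINT u:{0..s}. g u) + (LBINT u:{s<..t}. g u)"
    by (simp only:) (rule set_integral_Un[OF _ i bounded_set_integrable_Ioc[OF g K]], auto)
  then show ?thesis by (simp add: fg)
qed

text \<open>The constant 8 is 2 for separating noise from drift times 4 from the bound for a single
  Ito integral with \<zeta> = 0; \<open>CARD('q)\<close> comes from Cauchy-Schwarz on the finite
  sum. The factor \<open>2 * t\<close> is that same 2 times Cauchy-Schwarz in time.\<close>

lemma ito_sum_L2_estimate:
  fixes J J' G G' :: "'q::finite \<Rightarrow> real \<Rightarrow> 'w \<Rightarrow> real" and V \<gamma> :: "real \<Rightarrow> 'w \<Rightarrow> real"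
  assumes bf: "\<And>k. brownian_filtration M F (W k)"
    and ito: "\<And>k. has_ito_integral M F (W k) (G k) (J k)" "\<And>k. has_ito_integral M F (W k) (G' k) (J' k)"
    and \<gamma>m: "jointly_measurable M \<gamma>"
    and \<gamma>K: "\<And>u \<omega>. \<omega> \<in> space M \<Longrightarrow> \<bar>\<gamma> u \<omega>\<bar> \<le> K" and t: "0 \<le> t"
    and V: "AE \<omega> in M. V t \<omega> = (\<Sum>k\<in>UNIV. (J k t \<omega> - J k 0 \<omega>) - (J' k t \<omega> - J' k 0 \<omega>)) + (LBINT u:{0<..t}. \<gamma> u \<omega>)"
  shows "(\<integral>\<^sup>+\<omega>. ennreal ((V t \<omega>)\<^sup>2) \<partial>M) \<le> ennreal (8 * real CARD('q)) * (\<Sum>k\<in>UNIV. nn_path_integral M 0 t (\<lambda>u \<omega>. (G k u \<omega> - G' k u \<omega>)\<^sup>2))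
     + ennreal (2 * t) * nn_path_integral M 0 t (\<lambda>u \<omega>. (\<gamma> u \<omega>)\<^sup>2)"
proof -
  define N where "N k \<omega> = (J k t \<omega> - J k 0 \<omega>) - (J' k t \<omega> - J' k 0 \<omega>)" for k \<omega>
  have Jm[measurable]: "J k 0 \<in> borel_measurable M" "J k t \<in> borel_measurable M"
      "J' k 0 \<in> borel_measurable M" "J' k t \<in> borel_measurable M" for k
    using ito(1)[of k] ito(2)[of k] t by (simp_all add: has_ito_integral_def)
  have Nm[measurable]: "N k \<in> borel_measurable M" for k
    unfolding N_def by measurable
  note [measurable] = \<gamma>m
  have Nb: "(\<integral>\<^sup>+\<omega>. ennreal ((N k \<omega>)\<^sup>2) \<partial>M) \<le> 4 * nn_path_integral M 0 t (\<lambda>u \<omega>. (G k u \<omega> - G' k u \<omega>)\<^sup>2)" for k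
    using brownian_filtration.ito_integral_bound[OF bf ito order_refl t, of "\<lambda>_. 0" k] by (simp add: N_def image_constant_conv)
  have m2[measurable]: "(\<lambda>\<omega>. \<integral>\<^sup>+u\<in>{0..t}. ennreal ((\<gamma> u \<omega>)\<^sup>2) \<partial>lborel) \<in> borel_measurable M"
    by (rule lborel.borel_measurable_nn_integral) measurable
  have "AE \<omega> in M. ennreal ((V t \<omega>)\<^sup>2) \<le> ennreal (2 * real CARD('q)) * (\<Sum>k\<in>UNIV. ennreal ((N k \<omega>)\<^sup>2)) + ennreal (2 * t) * (\<integral>\<^sup>+u\<in>{0..t}. ennreal ((\<gamma> u \<omega>)\<^sup>2) \<partial>lborel)"
    using V AE_space
  proof eventually_elim
    case (elim \<omega>)
    note eq = elim(1) and \<omega> = elim(2)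
    define w where "w = (LBINT u:{0<..t}. \<gamma> u \<omega>)"
    define S where "S = (\<Sum>k\<in>UNIV. N k \<omega>)"
    have "V t \<omega> = S + w" using eq by (simp add: S_def w_def N_def)
    then have "(V t \<omega>)\<^sup>2 \<le> 2 * S\<^sup>2 + 2 * w\<^sup>2"
      using zero_le_power2[of "S - w"] by (simp add: power2_eq_square algebra_simps)
    moreover have "S\<^sup>2 \<le> (\<Sum>k\<in>UNIV. (N k \<omega>)\<^sup>2) * CARD('q)"
      unfolding S_def by (rule sum_squared_le_sum_of_squares)
    ultimately have "(V t \<omega>)\<^sup>2 \<le> 2 * real CARD('q) * (\<Sum>k\<in>UNIV. (N k \<omega>)\<^sup>2) + 2 * w\<^sup>2" by (simp add: mult_ac)
    then have "ennreal ((V t \<omega>)\<^sup>2) \<le> ennreal (2 * real CARD('q) * (\<Sum>k\<in>UNIV. (N k \<omega>)\<^sup>2) + 2 * w\<^sup>2)" by (rule ennreal_leI)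
    also have "\<dots> = ennreal (2 * real CARD('q)) * (\<Sum>k\<in>UNIV. ennreal ((N k \<omega>)\<^sup>2)) + 2 * ennreal (w\<^sup>2)"
      by (subst ennreal_plus) (auto simp: ennreal_mult sum_nonneg mult.assoc intro!: sum_nonneg)
    also have "\<dots> \<le> ennreal (2 * real CARD('q)) * (\<Sum>k\<in>UNIV. ennreal ((N k \<omega>)\<^sup>2)) + 2 * (ennreal t * (\<integral>\<^sup>+u\<in>{0..t}. ennreal ((\<gamma> u \<omega>)\<^sup>2) \<partial>lborel))"
    proof (intro add_left_mono mult_left_mono)
      have "(\<lambda>u. \<gamma> u \<omega>) \<in> borel_measurable borel" using measurable_Pair2[OF \<gamma>m \<omega>] by simp
      then show "ennreal (w\<^sup>2) \<le> ennreal t * (\<integral>\<^sup>+u\<in>{0..t}. ennreal ((\<gamma> u \<omega>)\<^sup>2) \<partial>lborel)"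
        unfolding w_def by (rule square_set_integral_le[OF _ \<gamma>K[OF \<omega>] t])
    qed simp
    finally show ?case
      using t by (simp add: ennreal_mult mult.assoc)
  qed
  then have "(\<integral>\<^sup>+\<omega>. ennreal ((V t \<omega>)\<^sup>2) \<partial>M) \<le> (\<integral>\<^sup>+\<omega>. ennreal (2 * real CARD('q)) * (\<Sum>k\<in>UNIV. ennreal ((N k \<omega>)\<^sup>2)) + ennreal (2 * t) * (\<integral>\<^sup>+u\<in>{0..t}. ennreal ((\<gamma> u \<omega>)\<^sup>2) \<partial>lborel) \<partial>M)"
    by (rule nn_integral_mono_AE)
  also have "\<dots> = ennreal (2 * real CARD('q)) * (\<Sum>k\<in>UNIV. \<integral>\<^sup>+\<omega>. ennreal ((N k \<omega>)\<^sup>2) \<partial>M) + ennreal (2 * t) * nn_path_integral M 0 t (\<lambda>u \<omega>. (\<gamma> u \<omega>)\<^sup>2)"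
    by (simp add: nn_integral_add nn_integral_cmult nn_integral_sum del: sum_ennreal)
  also have "\<dots> \<le> ennreal (2 * real CARD('q)) * (\<Sum>k\<in>UNIV. 4 * nn_path_integral M 0 t (\<lambda>u \<omega>. (G k u \<omega> - G' k u \<omega>)\<^sup>2)) + ennreal (2 * t) * nn_path_integral M 0 t (\<lambda>u \<omega>. (\<gamma> u \<omega>)\<^sup>2)"
    by (intro add_right_mono mult_left_mono sum_mono Nb) simp
  also have "ennreal (2 * real CARD('q)) * (\<Sum>k\<in>UNIV. 4 * nn_path_integral M 0 t (\<lambda>u \<omega>. (G k u \<omega> - G' k u \<omega>)\<^sup>2))
    = ennreal (8 * real CARD('q)) * (\<Sum>k\<in>UNIV. nn_path_integral M 0 t (\<lambda>u \<omega>. (G k u \<omega> - G' k u \<omega>)\<^sup>2))"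
  proof -
    have "ennreal (8 * real CARD('q)) = ennreal (2 * real CARD('q)) * 4"
      by (simp add: ennreal_mult'[symmetric] flip: ennreal_numeral)
    then show ?thesis by (simp add: sum_distrib_left[symmetric] mult.assoc)
  qed
  finally show ?thesis .
qed

text \<open>Only the clamped process is known to be jointly measurable, so the integrand is replaced
  by its clamped version before the constant is pulled out.\<close>

lemma nn_integral_path_cmult:
  fixes f :: "real \<Rightarrow> 'w \<Rightarrow> real"
  assumes fm[measurable]: "jointly_measurable M (\<lambda>u \<omega>. f (max 0 u) \<omega>)" and C: "0 \<le> C"
  shows "nn_path_integral M 0 t (\<lambda>u \<omega>. C * f u \<omega>)
    = ennreal C * nn_path_integral M 0 t f"
proof -
  have eq: "(\<integral>\<^sup>+u\<in>{0..t}. ennreal (f u \<omega>) \<partial>lborel) = (\<integral>\<^sup>+u\<in>{0..t}. ennreal (f (max 0 u) \<omega>) \<partial>lborel)" for \<omega>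
    by (intro nn_integral_cong) (auto split: split_indicator)
  have "nn_path_integral M 0 t (\<lambda>u \<omega>. C * f u \<omega>) = (\<integral>\<^sup>+\<omega>. ennreal C * (\<integral>\<^sup>+u\<in>{0..t}. ennreal (f u \<omega>) \<partial>lborel) \<partial>M)"
  proof (rule nn_integral_cong, goal_cases)
    case \<omega>: (1 \<omega>)
    have [measurable]: "(\<lambda>u. f (max 0 u) \<omega>) \<in> borel_measurable lborel"
      using measurable_Pair2[OF fm \<omega>] by simp
    have "(\<integral>\<^sup>+u\<in>{0..t}. ennreal (C * f u \<omega>) \<partial>lborel) = (\<integral>\<^sup>+u. ennreal C * (ennreal (f (max 0 u) \<omega>) * indicator {0..t} u) \<partial>lborel)"
      using C by (intro nn_integral_cong) (auto simp: ennreal_mult' split: split_indicator)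
    also have "\<dots> = ennreal C * (\<integral>\<^sup>+u\<in>{0..t}. ennreal (f u \<omega>) \<partial>lborel)"
      unfolding eq by (rule nn_integral_cmult) measurable
    finally show ?case .
  qed
  also have "\<dots> = ennreal C * nn_path_integral M 0 t f"
    unfolding eq by (intro nn_integral_cmult lborel.borel_measurable_nn_integral) measurable
  finally show ?thesis .
qed

text \<open>The \<open>ennreal\<close> form in which Gronwall consumes the estimate: the first bound
  gives the integral inequality, the second the a priori finiteness.\<close>

lemma (in ito_difference)
  fixes \<rho> s :: "real \<Rightarrow> real"
  assumes pos: "\<And>x. \<rho> x > 0" and meas: "\<rho> \<in> borel_measurable borel"
    and Osgood: "\<And>d. d > 0 \<Longrightarrow> (\<integral>\<^sup>+x\<in>{0<..<d}. ennreal (1 / \<rho> x) \<partial>lborel) = \<infinity>"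
    and s: "continuous_on UNIV s" "\<And>r. r > 0 \<Longrightarrow> (s r)\<^sup>2 \<le> \<rho> r"
    and a_le: "\<And>t \<omega>. 0 \<le> t \<Longrightarrow> \<omega> \<in> space M \<Longrightarrow> \<bar>H t \<omega> - H' t \<omega>\<bar> \<le> s \<bar>X t \<omega>\<bar>"
    and T: "0 \<le> T"
  shows nn_L1_estimate: "(\<integral>\<^sup>+\<omega>. ennreal \<bar>X T \<omega>\<bar> \<partial>M) \<le> nn_path_integral M 0 T (\<lambda>u \<omega>. \<bar>\<beta> u \<omega>\<bar>)"
    and nn_L1_bound: "(\<integral>\<^sup>+\<omega>. ennreal \<bar>X T \<omega>\<bar> \<partial>M) \<le> ennreal (K * T)"
proof -
  have "(\<integral>\<^sup>+\<omega>. ennreal \<bar>X T \<omega>\<bar> \<partial>M) = ennreal (expectation (\<lambda>\<omega>. \<bar>X T \<omega>\<bar>))"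
    using X_integrable[OF T] by (intro nn_integral_eq_integral) auto
  also have "\<dots> \<le> ennreal (total_drift 0 T)"
    by (rule ennreal_leI[OF L1_estimate[OF assms]])
  also have "\<dots> = (\<integral>\<^sup>+\<omega>. ennreal (LBINT u:{0<..T}. \<bar>\<beta> u \<omega>\<bar>) \<partial>M)"
    unfolding total_drift_def using drift_integrable[OF T]
    by (intro nn_integral_eq_integral[symmetric]) (auto simp: set_lebesgue_integral_def)
  finally have le: "(\<integral>\<^sup>+\<omega>. ennreal \<bar>X T \<omega>\<bar> \<partial>M) \<le> (\<integral>\<^sup>+\<omega>. ennreal (LBINT u:{0<..T}. \<bar>\<beta> u \<omega>\<bar>) \<partial>M)" .
  also have "\<dots> \<le> nn_path_integral M 0 T (\<lambda>u \<omega>. \<bar>\<beta> u \<omega>\<bar>)"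
    by (rule nn_integral_mono) (rule abs_set_integral_le_nn_integral[OF \<beta>_path \<beta>_bound])
  finally show "(\<integral>\<^sup>+\<omega>. ennreal \<bar>X T \<omega>\<bar> \<partial>M) \<le> nn_path_integral M 0 T (\<lambda>u \<omega>. \<bar>\<beta> u \<omega>\<bar>)" .
  have "(\<integral>\<^sup>+\<omega>. ennreal (LBINT u:{0<..T}. \<bar>\<beta> u \<omega>\<bar>) \<partial>M) \<le> (\<integral>\<^sup>+\<omega>. ennreal (K * T) \<partial>M)"
    using drift_bounds(2)[OF _ T] by (intro nn_integral_mono ennreal_leI) simp
  also have "\<dots> = ennreal (K * T)" by (simp add: emeasure_space_1)
  finally show "(\<integral>\<^sup>+\<omega>. ennreal \<bar>X T \<omega>\<bar> \<partial>M) \<le> ennreal (K * T)" using le by (rule order.trans[rotated])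
qed

section \<open>Uniqueness in the two equations\<close>

text \<open>The scalar estimate applies to each coordinate because \<open>\<sigma> i\<close> depends
  on that coordinate only. Summing over coordinates gives the \<open>L\<^sup>1\<close> distance of
  the two solutions, in terms of which the Lipschitz drifts close the Gronwall inequality.\<close>

lemma sde_Y_unique:
  fixes b :: "'p::finite \<Rightarrow> real ^ 'p \<Rightarrow> real"
    and c :: "'q::finite \<Rightarrow> (real ^ 'p) \<times> (real ^ 'r) \<Rightarrow> real"
    and d :: "'r::finite \<Rightarrow> (real ^ 'p) \<times> (real ^ 'r) \<Rightarrow> real"
    and \<sigma> \<rho> :: "'p \<Rightarrow> real \<Rightarrow> real"
  assumes b_bounded: "\<And>i. bounded (range (b i))"
    and b_continuous: "\<And>i. continuous_on UNIV (b i)"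
    and b_Lipschitz: "\<And>i y1 y2. \<bar>b i y1 - b i y2\<bar> \<le> A * norm (y1 - y2)"
    and \<sigma>_bounded: "\<And>i. bounded (range (\<sigma> i))"
    and \<sigma>_modulus: "\<And>i x y. x \<noteq> y \<Longrightarrow> \<bar>\<sigma> i x - \<sigma> i y\<bar>\<^sup>2 \<le> \<rho> i \<bar>x - y\<bar>"
    and \<rho>_pos: "\<And>i x. \<rho> i x > 0" and \<rho>_Borel: "\<And>i. \<rho> i \<in> borel_measurable borel"
    and \<rho>_Osgood: "\<And>i \<epsilon>. \<epsilon> > 0 \<Longrightarrow> (\<integral>\<^sup>+x\<in>{0<..<\<epsilon>}. ennreal (1 / \<rho> i x) \<partial>lborel) = \<infinity>"
    and filt: "filtered_prob_space M F" and bm: "\<And>k. brownian_motion M F (B k)"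
    and sol: "sde_solution M F B \<sigma> b c d Y Z" and sol': "sde_solution M F B \<sigma> b c d Y' Z'"
    and init: "AE \<omega> in M. Y 0 \<omega> = Y' 0 \<omega>"
  shows "AE \<omega> in M. \<forall>t\<ge>0. Y t \<omega> = Y' t \<omega>"
proof -
  interpret prob_space M using filt by (simp add: filtered_prob_space_def)
  have bf: "brownian_filtration M F (B k)" for k
    using filt bm by (intro brownian_filtration.intro brownian_filtration_axioms.intro prob_space_axioms)
  obtain I where I: "\<And>i. has_ito_integral M F (B (Inl i)) (\<lambda>t \<omega>. \<sigma> i (Y t \<omega> $ i)) (I i)"
    and eq: "\<And>i. AE \<omega> in M. \<forall>t\<ge>0. Y t \<omega> $ i = Y 0 \<omega> $ i + I i t \<omega> + (LBINT s:{0..t}. b i (Y s \<omega>))"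
    using sol unfolding sde_solution_def by blast
  obtain I' where I': "\<And>i. has_ito_integral M F (B (Inl i)) (\<lambda>t \<omega>. \<sigma> i (Y' t \<omega> $ i)) (I' i)"
    and eq': "\<And>i. AE \<omega> in M. \<forall>t\<ge>0. Y' t \<omega> $ i = Y' 0 \<omega> $ i + I' i t \<omega> + (LBINT s:{0..t}. b i (Y' s \<omega>))"
    using sol' unfolding sde_solution_def by blast
  have Ya: "Y t \<in> borel_measurable (F t)" "Y' t \<in> borel_measurable (F t)" if "0 \<le> t" for t
    using sol sol' that by (auto simp: sde_solution_def adapted_process_def)
  have Yc: "continuous_on {0..} (\<lambda>t. Y t \<omega>)" "continuous_on {0..} (\<lambda>t. Y' t \<omega>)" if "\<omega> \<in> space M" for \<omega>
    using sol sol' that by (auto simp: sde_solution_def)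
  have nthm: "(\<lambda>y::real^'p. y $ i) \<in> borel_measurable borel" for i
    by (intro borel_measurable_continuous_onI continuous_intros)
  have Yia: "(\<lambda>\<omega>. Y t \<omega> $ i) \<in> borel_measurable (F t)" "(\<lambda>\<omega>. Y' t \<omega> $ i) \<in> borel_measurable (F t)" if "0 \<le> t" for t i
    using measurable_compose[OF Ya(1)[OF that] nthm] measurable_compose[OF Ya(2)[OF that] nthm] by auto
  have toM: "f \<in> borel_measurable M" if "f \<in> borel_measurable (F t)" "0 \<le> t" for f :: "'a \<Rightarrow> real" and t
    by (rule brownian_filtration.measurable_M[OF bf that(2,1)])
  have "\<exists>Kb. \<forall>i. 0 \<le> Kb i \<and> (\<forall>y. \<bar>b i y\<bar> \<le> Kb i)"
  proof (rule choice, rule allI)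
    fix i
    obtain k where "\<And>y. \<bar>b i y\<bar> \<le> k" using b_bounded[of i] by (auto simp: bounded_iff)
    then show "\<exists>k. 0 \<le> k \<and> (\<forall>y. \<bar>b i y\<bar> \<le> k)" using order.trans[OF abs_ge_zero] by blast
  qed
  then obtain Kb where Kb: "\<And>i. 0 \<le> Kb i" "\<And>i y. \<bar>b i y\<bar> \<le> Kb i" by blast
  have "\<exists>Ks. \<forall>i. \<forall>y. \<bar>\<sigma> i y\<bar> \<le> Ks i"
  proof (rule choice, rule allI)
    show "\<exists>k. \<forall>y. \<bar>\<sigma> i y\<bar> \<le> k" for i using \<sigma>_bounded[of i] by (auto simp: bounded_iff)
  qed
  then obtain Ks where Ks: "\<And>i y. \<bar>\<sigma> i y\<bar> \<le> Ks i" by blast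
  have Ks0: "0 \<le> Ks i" for i using Ks[of i 0] by linarith
  \<comment> \<open>A single constant has to bound both a difference of two drifts and a difference
    of two diffusion coefficients.\<close>
  define K where "K i = 2 * Kb i + 2 * Ks i" for i
  have "\<exists>s. \<forall>i. continuous_on UNIV (s i) \<and> (\<forall>r>0. (s i r)\<^sup>2 \<le> \<rho> i r) \<and> (\<forall>x y. \<bar>\<sigma> i x - \<sigma> i y\<bar> \<le> s i \<bar>x - y\<bar>)"
  proof (rule choice, rule allI)
    fix i
    show "\<exists>s. continuous_on UNIV s \<and> (\<forall>r>0. (s r)\<^sup>2 \<le> \<rho> i r) \<and> (\<forall>x y. \<bar>\<sigma> i x - \<sigma> i y\<bar> \<le> s \<bar>x - y\<bar>)"
    proof (rule continuous_modulus_below[OF \<sigma>_modulus[where i = i] \<rho>_pos \<rho>_Borel \<rho>_Osgood[OF zero_less_one] \<sigma>_bounded])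
      fix s assume "continuous_on UNIV s" "\<And>r. r > 0 \<Longrightarrow> (s r)\<^sup>2 \<le> \<rho> i r" "\<And>x y. \<bar>\<sigma> i x - \<sigma> i y\<bar> \<le> s \<bar>x - y\<bar>"
      then show ?thesis by (intro exI[of _ s]) simp
    qed
  qed
  then obtain s where s: "\<And>i. continuous_on UNIV (s i)" "\<And>i r. r > 0 \<Longrightarrow> (s i r)\<^sup>2 \<le> \<rho> i r"
    "\<And>i x y. \<bar>\<sigma> i x - \<sigma> i y\<bar> \<le> s i \<bar>x - y\<bar>" by blast
  \<comment> \<open>Continuity of \<sigma> itself, not only of its modulus, makes the coefficient
    difference continuous along paths, as the freezing argument requires.\<close>
  have \<sigma>c: "continuous_on UNIV (\<sigma> i)" for i
    unfolding continuous_on_iff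
  proof (intro ballI allI impI)
    fix x e :: real assume e: "0 < e"
    obtain \<delta> where "\<delta> > 0" "\<And>x y. \<bar>x - y\<bar> < \<delta> \<Longrightarrow> \<bar>\<sigma> i x - \<sigma> i y\<bar> < e"
      by (rule uniformly_continuous_of_Osgood_modulus[OF \<sigma>_modulus[where i = i] \<rho>_pos \<rho>_Borel \<rho>_Osgood[OF zero_less_one] e]) blast+
    then show "\<exists>d>0. \<forall>x'\<in>UNIV. dist x' x < d \<longrightarrow> dist (\<sigma> i x') (\<sigma> i x) < e"
      by (auto simp: dist_real_def)
  qed
  have Yic: "continuous_on {0..} (\<lambda>t. Y t \<omega> $ i)" "continuous_on {0..} (\<lambda>t. Y' t \<omega> $ i)" if "\<omega> \<in> space M" for \<omega> i
    using Yc[OF that] by (auto intro!: continuous_intros)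
  have bYm: "jointly_measurable M (\<lambda>u \<omega>. b i (Y (max 0 u) \<omega>))"
      "jointly_measurable M (\<lambda>u \<omega>. b i (Y' (max 0 u) \<omega>))" for i
  proof -
    have bm: "b i \<in> borel_measurable borel" by (rule borel_measurable_continuous_onI[OF b_continuous])
    show "jointly_measurable M (\<lambda>u \<omega>. b i (Y (max 0 u) \<omega>))"
      by (rule continuous_process_measurable[of "\<lambda>t \<omega>. b i (Y t \<omega>)"])
         (auto intro!: toM measurable_compose[OF Ya(1) bm] continuous_on_compose2[OF b_continuous Yc(1)])
    show "jointly_measurable M (\<lambda>u \<omega>. b i (Y' (max 0 u) \<omega>))"
      by (rule continuous_process_measurable[of "\<lambda>t \<omega>. b i (Y' t \<omega>)"])
         (auto intro!: toM measurable_compose[OF Ya(2) bm] continuous_on_compose2[OF b_continuous Yc(2)])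
  qed
  have bYp: "(\<lambda>u. b i (Y (max 0 u) \<omega>)) \<in> borel_measurable borel" "(\<lambda>u. b i (Y' (max 0 u) \<omega>)) \<in> borel_measurable borel" if "\<omega> \<in> space M" for i \<omega>
    using measurable_Pair2[OF bYm(1) that] measurable_Pair2[OF bYm(2) that] by auto
  have ID: "ito_difference M F (B (Inl i)) (\<lambda>t \<omega>. \<sigma> i (Y t \<omega> $ i)) (\<lambda>t \<omega>. \<sigma> i (Y' t \<omega> $ i)) (I i) (I' i)
      (\<lambda>t \<omega>. Y t \<omega> $ i - Y' t \<omega> $ i) (\<lambda>u \<omega>. b i (Y (max 0 u) \<omega>) - b i (Y' (max 0 u) \<omega>)) (K i)" for i
  proof (intro ito_difference.intro[OF bf] ito_difference_axioms.intro I I')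
    have \<sigma>m: "\<sigma> i \<in> borel_measurable borel" by (rule borel_measurable_continuous_onI[OF \<sigma>c])
    show "(\<lambda>\<omega>. Y t \<omega> $ i - Y' t \<omega> $ i) \<in> borel_measurable (F t)" if "0 \<le> t" for t
      using Yia[OF that] by (rule borel_measurable_diff)
    show "AE \<omega> in M. Y 0 \<omega> $ i - Y' 0 \<omega> $ i = 0" using init by eventually_elim simp
    show "jointly_measurable M (\<lambda>u \<omega>. b i (Y (max 0 u) \<omega>) - b i (Y' (max 0 u) \<omega>))"
      using borel_measurable_diff[OF bYm] by (simp add: split_beta')
    show "\<bar>b i (Y (max 0 u) \<omega>) - b i (Y' (max 0 u) \<omega>)\<bar> \<le> K i" for u \<omega>
      using Kb(2)[of i "Y (max 0 u) \<omega>"] Kb(2)[of i "Y' (max 0 u) \<omega>"] Ks0[of i] by (simp add: K_def)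
    show "(\<lambda>\<omega>. \<sigma> i (Y t \<omega> $ i) - \<sigma> i (Y' t \<omega> $ i)) \<in> borel_measurable (F t)" if "0 \<le> t" for t
      using measurable_compose[OF Yia(1)[OF that] \<sigma>m] measurable_compose[OF Yia(2)[OF that] \<sigma>m] by (rule borel_measurable_diff)
    show "continuous_on {0..} (\<lambda>t. \<sigma> i (Y t \<omega> $ i) - \<sigma> i (Y' t \<omega> $ i))" if "\<omega> \<in> space M" for \<omega>
      by (intro continuous_on_diff continuous_on_compose2[OF \<sigma>c Yic(1)[OF that]] continuous_on_compose2[OF \<sigma>c Yic(2)[OF that]]) auto
    show "\<bar>\<sigma> i (Y t \<omega> $ i) - \<sigma> i (Y' t \<omega> $ i)\<bar> \<le> K i" for t \<omega>
      using Ks[of i "Y t \<omega> $ i"] Ks[of i "Y' t \<omega> $ i"] Kb(1)[of i] by (simp add: K_def)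
    show "0 \<le> K i" using Kb(1) Ks0 by (simp add: K_def)
    fix v t :: real assume vt: "0 \<le> v" "v \<le> t"
    show "AE \<omega> in M. (Y t \<omega> $ i - Y' t \<omega> $ i) - (Y v \<omega> $ i - Y' v \<omega> $ i) = (I i t \<omega> - I i v \<omega>) - (I' i t \<omega> - I' i v \<omega>)
        + (LBINT u:{v<..t}. b i (Y (max 0 u) \<omega>) - b i (Y' (max 0 u) \<omega>))"
      using eq[of i] eq'[of i] AE_space
    proof eventually_elim
      case (elim \<omega>)
      note e = elim(1,2) and \<omega> = elim(3)
      have 1: "(LBINT u:{0..t}. b i (Y u \<omega>)) - (LBINT u:{0..v}. b i (Y u \<omega>)) = (LBINT u:{v<..t}. b i (Y (max 0 u) \<omega>))"
        by (rule set_integral_Icc_diff[OF bYp(1)[OF \<omega>] Kb(2) vt]) simp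
      have 2: "(LBINT u:{0..t}. b i (Y' u \<omega>)) - (LBINT u:{0..v}. b i (Y' u \<omega>)) = (LBINT u:{v<..t}. b i (Y' (max 0 u) \<omega>))"
        by (rule set_integral_Icc_diff[OF bYp(2)[OF \<omega>] Kb(2) vt]) simp
      have 3: "(LBINT u:{v<..t}. b i (Y (max 0 u) \<omega>) - b i (Y' (max 0 u) \<omega>)) = (LBINT u:{v<..t}. b i (Y (max 0 u) \<omega>)) - (LBINT u:{v<..t}. b i (Y' (max 0 u) \<omega>))"
        by (rule set_integral_diff(2)[OF bounded_set_integrable_Ioc[OF bYp(1)[OF \<omega>] Kb(2)] bounded_set_integrable_Ioc[OF bYp(2)[OF \<omega>] Kb(2)]])
      have t0: "0 \<le> t" using vt by simp
      show ?case
        using e(1)[rule_format, OF t0] e(1)[rule_format, OF vt(1)] e(2)[rule_format, OF t0] e(2)[rule_format, OF vt(1)] 1 2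
        unfolding 3 by linarith
    qed
  qed
  define f where "f t \<omega> = (\<Sum>i\<in>UNIV. \<bar>Y t \<omega> $ i - Y' t \<omega> $ i\<bar>)" for t \<omega>
  have Xm: "(\<lambda>\<omega>. Y t \<omega> $ i - Y' t \<omega> $ i) \<in> borel_measurable M" if "0 \<le> t" for t i
    using borel_measurable_diff[OF Yia[OF that]] that by (rule toM)
  have fm: "jointly_measurable M (\<lambda>u \<omega>. f (max 0 u) \<omega>)"
  proof (rule continuous_process_measurable)
    show "f t \<in> borel_measurable M" if "0 \<le> t" for t
      unfolding f_def using Xm[OF that] by (intro borel_measurable_sum borel_measurable_abs) auto
    show "continuous_on {0..} (\<lambda>t. f t \<omega>)" if "\<omega> \<in> space M" for \<omega>
      unfolding f_def by (intro continuous_on_sum continuous_on_rabs continuous_on_diff Yic[OF that])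
  qed
  have f0: "0 \<le> f t \<omega>" for t \<omega> by (simp add: f_def sum_nonneg)
  have fsum: "(\<integral>\<^sup>+\<omega>. ennreal (f t \<omega>) \<partial>M) = (\<Sum>i\<in>UNIV. \<integral>\<^sup>+\<omega>. ennreal \<bar>Y t \<omega> $ i - Y' t \<omega> $ i\<bar> \<partial>M)" if "0 \<le> t" for t
    using Xm[OF that] by (subst nn_integral_sum[symmetric]) (simp_all add: f_def)
  have a_le: "\<bar>\<sigma> i (Y t \<omega> $ i) - \<sigma> i (Y' t \<omega> $ i)\<bar> \<le> s i \<bar>Y t \<omega> $ i - Y' t \<omega> $ i\<bar>" for i t \<omega>
    by (rule s(3))
  have est: "(\<integral>\<^sup>+\<omega>. ennreal \<bar>Y T \<omega> $ i - Y' T \<omega> $ i\<bar> \<partial>M) \<le>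
      nn_path_integral M 0 T (\<lambda>u \<omega>. \<bar>b i (Y (max 0 u) \<omega>) - b i (Y' (max 0 u) \<omega>)\<bar>)"
    "(\<integral>\<^sup>+\<omega>. ennreal \<bar>Y T \<omega> $ i - Y' T \<omega> $ i\<bar> \<partial>M) \<le> ennreal (K i * T)" if "0 \<le> T" for i T
    by (rule ito_difference.nn_L1_estimate[OF ID \<rho>_pos \<rho>_Borel \<rho>_Osgood s(1,2) a_le that], assumption, assumption)
       (rule ito_difference.nn_L1_bound[OF ID \<rho>_pos \<rho>_Borel \<rho>_Osgood s(1,2) a_le that])
  have "AE \<omega> in M. f t \<omega> = 0" if t: "0 \<le> t" for t
  \<comment> \<open>Each of the \<open>CARD('p)\<close> coordinates contributes the Lipschitz
    constant once; its absolute value is taken because no sign of \<open>A\<close> is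
    assumed.\<close>
  proof (rule Gronwall_process[OF fm f0, where C = "real CARD('p) * \<bar>A\<bar>" and T = t and B = "\<Sum>i\<in>UNIV. K i * t"])
    fix r assume r: "0 \<le> r" "r \<le> t"
    have K0: "0 \<le> K i" for i using Kb(1) Ks0 by (simp add: K_def)
    have "(\<integral>\<^sup>+\<omega>. ennreal (f r \<omega>) \<partial>M) \<le> (\<Sum>i\<in>UNIV. ennreal (K i * t))"
      unfolding fsum[OF r(1)]
      by (rule sum_mono, rule order.trans[OF est(2)[OF r(1)]]) (auto intro!: ennreal_leI mult_left_mono K0 r)
    also have "\<dots> = ennreal (\<Sum>i\<in>UNIV. K i * t)" using K0 t by (intro sum_ennreal) simp
    finally show "(\<integral>\<^sup>+\<omega>. ennreal (f r \<omega>) \<partial>M) \<le> ennreal (\<Sum>i\<in>UNIV. K i * t)" .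
    let ?\<Phi> = "nn_path_integral M 0 r f"
    have "(\<integral>\<^sup>+\<omega>. ennreal (f r \<omega>) \<partial>M) \<le> (\<Sum>i\<in>(UNIV::'p set). ennreal \<bar>A\<bar> * ?\<Phi>)"
      unfolding fsum[OF r(1)]
    proof (rule sum_mono)
      fix i
      have "(\<integral>\<^sup>+\<omega>. ennreal \<bar>Y r \<omega> $ i - Y' r \<omega> $ i\<bar> \<partial>M) \<le>
          nn_path_integral M 0 r (\<lambda>u \<omega>. \<bar>b i (Y (max 0 u) \<omega>) - b i (Y' (max 0 u) \<omega>)\<bar>)"
        by (rule est(1)[OF r(1)])
      also have "\<dots> \<le> nn_path_integral M 0 r (\<lambda>u \<omega>. \<bar>A\<bar> * f u \<omega>)"
      proof (intro nn_integral_mono)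
        fix \<omega> u
        have "\<bar>b i (Y u \<omega>) - b i (Y' u \<omega>)\<bar> \<le> \<bar>A\<bar> * f u \<omega>"
        proof -
          have "\<bar>b i (Y u \<omega>) - b i (Y' u \<omega>)\<bar> \<le> A * norm (Y u \<omega> - Y' u \<omega>)" by (rule b_Lipschitz)
          also have "\<dots> \<le> \<bar>A\<bar> * norm (Y u \<omega> - Y' u \<omega>)" by (intro mult_right_mono) auto
          also have "\<dots> \<le> \<bar>A\<bar> * f u \<omega>"
            using norm_le_l1_cart[of "Y u \<omega> - Y' u \<omega>"] by (intro mult_left_mono) (auto simp: f_def)
          finally show ?thesis .
        qed
        then show "ennreal \<bar>b i (Y (max 0 u) \<omega>) - b i (Y' (max 0 u) \<omega>)\<bar> * indicator {0..r} u \<le> ennreal (\<bar>A\<bar> * f u \<omega>) * indicator {0..r} u"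
          by (auto split: split_indicator intro!: ennreal_leI)
      qed
      also have "\<dots> = ennreal \<bar>A\<bar> * ?\<Phi>" by (rule nn_integral_path_cmult[OF fm]) simp
      finally show "(\<integral>\<^sup>+\<omega>. ennreal \<bar>Y r \<omega> $ i - Y' r \<omega> $ i\<bar> \<partial>M) \<le> ennreal \<bar>A\<bar> * ?\<Phi>" .
    qed
    also have "\<dots> = ennreal (real CARD('p) * \<bar>A\<bar>) * ?\<Phi>"
      by (simp add: ennreal_of_nat_eq_real_of_nat ennreal_mult mult.assoc)
    finally show "(\<integral>\<^sup>+\<omega>. ennreal (f r \<omega>) \<partial>M) \<le> ennreal (real CARD('p) * \<bar>A\<bar>) * ?\<Phi>" .
  qed (use t in auto)
  then have "AE \<omega> in M. Y t \<omega> = Y' t \<omega>" if "0 \<le> t" for t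
  proof (rule AE_mp[OF _ AE_I2, rule_format])
    show "0 \<le> t" by fact
    fix \<omega> assume "f t \<omega> = 0"
    then have "\<forall>i. \<bar>Y t \<omega> $ i - Y' t \<omega> $ i\<bar> = 0"
      unfolding f_def by (subst (asm) sum_nonneg_eq_0_iff) auto
    then show "Y t \<omega> = Y' t \<omega>" by (simp add: vec_eq_iff)
  qed
  then show ?thesis by (intro continuous_processes_eq_AE Yc)
qed

text \<open>Once \<open>Y\<close> and \<open>Y'\<close> are indistinguishable, the coefficient
  differences are almost surely Lipschitz in \<open>Z - Z'\<close> alone. The
  \<open>L\<^sup>2\<close> bound for the noise then closes a Gronwall inequality for the expected
  squared distance.\<close>

lemma sde_Z_unique:
  fixes b :: "'p::finite \<Rightarrow> real ^ 'p \<Rightarrow> real"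
    and c :: "'q::finite \<Rightarrow> (real ^ 'p) \<times> (real ^ 'r) \<Rightarrow> real"
    and d :: "'r::finite \<Rightarrow> (real ^ 'p) \<times> (real ^ 'r) \<Rightarrow> real"
    and \<sigma> :: "'p \<Rightarrow> real \<Rightarrow> real"
  assumes c_bounded: "\<And>k. bounded (range (c k))"
    and d_bounded: "\<And>j. bounded (range (d j))"
    and d_continuous: "\<And>j. continuous_on UNIV (d j)"
    and c_Lipschitz: "\<And>k y z1 z2. \<bar>c k (y, z1) - c k (y, z2)\<bar> \<le> A * norm (z1 - z2)"
    and d_Lipschitz: "\<And>j y z1 z2. \<bar>d j (y, z1) - d j (y, z2)\<bar> \<le> A * norm (z1 - z2)"
    and filt: "filtered_prob_space M F" and bm: "\<And>k. brownian_motion M F (B k)"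
    and sol: "sde_solution M F B \<sigma> b c d Y Z" and sol': "sde_solution M F B \<sigma> b c d Y' Z'"
    and init: "AE \<omega> in M. Z 0 \<omega> = Z' 0 \<omega>" and YY': "AE \<omega> in M. \<forall>t\<ge>0. Y t \<omega> = Y' t \<omega>"
  shows "AE \<omega> in M. \<forall>t\<ge>0. Z t \<omega> = Z' t \<omega>"
proof -
  interpret prob_space M using filt by (simp add: filtered_prob_space_def)
  have bf: "brownian_filtration M F (B k)" for k
    using filt bm by (intro brownian_filtration.intro brownian_filtration_axioms.intro prob_space_axioms)
  obtain J where J: "\<And>k. has_ito_integral M F (B (Inr k)) (\<lambda>t \<omega>. c k (Y t \<omega>, Z t \<omega>)) (J k)"
    and eq: "\<And>j. AE \<omega> in M. \<forall>t\<ge>0. Z t \<omega> $ j = Z 0 \<omega> $ j + (\<Sum>k\<in>UNIV. J k t \<omega>) + (LBINT s:{0..t}. d j (Y s \<omega>, Z s \<omega>))"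
    using sol unfolding sde_solution_def by blast
  obtain J' where J': "\<And>k. has_ito_integral M F (B (Inr k)) (\<lambda>t \<omega>. c k (Y' t \<omega>, Z' t \<omega>)) (J' k)"
    and eq': "\<And>j. AE \<omega> in M. \<forall>t\<ge>0. Z' t \<omega> $ j = Z' 0 \<omega> $ j + (\<Sum>k\<in>UNIV. J' k t \<omega>) + (LBINT s:{0..t}. d j (Y' s \<omega>, Z' s \<omega>))"
    using sol' unfolding sde_solution_def by blast
  have toM: "f \<in> measurable M N" if "f \<in> measurable (F t) N" "0 \<le> t" for f :: "'a \<Rightarrow> 'x" and t N
    using filt that measurable_from_subalg unfolding filtered_prob_space_def by blast
  have m: "Y t \<in> borel_measurable M" "Y' t \<in> borel_measurable M" if "0 \<le> t" for t
  proof -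
    have "Y t \<in> borel_measurable (F t)" "Y' t \<in> borel_measurable (F t)"
      using sol sol' that by (simp_all add: sde_solution_def adapted_process_def)
    then show "Y t \<in> borel_measurable M" "Y' t \<in> borel_measurable M"
      using toM that by blast+
  qed
  have Zm: "Z t \<in> borel_measurable M" "Z' t \<in> borel_measurable M" if "0 \<le> t" for t
  proof -
    have "Z t \<in> borel_measurable (F t)" "Z' t \<in> borel_measurable (F t)"
      using sol sol' that by (simp_all add: sde_solution_def adapted_process_def)
    then show "Z t \<in> borel_measurable M" "Z' t \<in> borel_measurable M"
      using toM that by blast+
  qed
  have Yc: "continuous_on {0..} (\<lambda>t. Y t \<omega>)" "continuous_on {0..} (\<lambda>t. Y' t \<omega>)" if "\<omega> \<in> space M" for \<omega>
    using sol sol' that by (auto simp: sde_solution_def)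
  have Zc: "continuous_on {0..} (\<lambda>t. Z t \<omega>)" "continuous_on {0..} (\<lambda>t. Z' t \<omega>)" if "\<omega> \<in> space M" for \<omega>
    using sol sol' that by (auto simp: sde_solution_def)
  have "bounded ((\<Union>k. range (c k)) \<union> (\<Union>j. range (d j)))"
    using c_bounded d_bounded by (intro bounded_Un[THEN iffD2] conjI bounded_UN) auto
  then obtain K where "\<forall>x\<in>(\<Union>k. range (c k)) \<union> (\<Union>j. range (d j)). norm x \<le> K"
    unfolding bounded_iff by blast
  then have K: "\<bar>c k y\<bar> \<le> K" "\<bar>d j y\<bar> \<le> K" for k j y
    unfolding real_norm_def by blast+
  have dPm: "jointly_measurable M (\<lambda>u \<omega>. d j (P (max 0 u) \<omega>, Q (max 0 u) \<omega>))"
    if P: "\<And>t. 0 \<le> t \<Longrightarrow> P t \<in> borel_measurable M" "\<And>\<omega>. \<omega> \<in> space M \<Longrightarrow> continuous_on {0..} (\<lambda>t. P t \<omega>)"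
      and Q: "\<And>t. 0 \<le> t \<Longrightarrow> Q t \<in> borel_measurable M" "\<And>\<omega>. \<omega> \<in> space M \<Longrightarrow> continuous_on {0..} (\<lambda>t. Q t \<omega>)" for j P Q
  proof (rule continuous_process_measurable[of "\<lambda>t \<omega>. d j (P t \<omega>, Q t \<omega>)"])
    show "(\<lambda>\<omega>. d j (P t \<omega>, Q t \<omega>)) \<in> borel_measurable M" if "0 \<le> t" for t
      by (rule measurable_compose[OF borel_measurable_Pair[OF P(1)[OF that] Q(1)[OF that]] borel_measurable_continuous_onI[OF d_continuous]])
    show "continuous_on {0..} (\<lambda>t. d j (P t \<omega>, Q t \<omega>))" if "\<omega> \<in> space M" for \<omega>
      by (rule continuous_on_compose2[OF d_continuous continuous_on_Pair[OF P(2)[OF that] Q(2)[OF that]]]) simp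
  qed
  note dm = dPm[OF m(1) Yc(1) Zm(1) Zc(1)] dPm[OF m(2) Yc(2) Zm(2) Zc(2)]
  have dp: "(\<lambda>u. d j (Y (max 0 u) \<omega>, Z (max 0 u) \<omega>)) \<in> borel_measurable borel" "(\<lambda>u. d j (Y' (max 0 u) \<omega>, Z' (max 0 u) \<omega>)) \<in> borel_measurable borel"
    if "\<omega> \<in> space M" for j \<omega>
    using measurable_Pair2[OF dm(1) that] measurable_Pair2[OF dm(2) that] by auto
  define \<gamma> where "\<gamma> j u \<omega> = d j (Y (max 0 u) \<omega>, Z (max 0 u) \<omega>) - d j (Y' (max 0 u) \<omega>, Z' (max 0 u) \<omega>)" for j u \<omega>
  define \<theta> where "\<theta> k u \<omega> = c k (Y u \<omega>, Z u \<omega>) - c k (Y' u \<omega>, Z' u \<omega>)" for k u \<omega>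
  have \<gamma>m: "jointly_measurable M (\<gamma> j)" for j
    using borel_measurable_diff[OF dm] by (simp add: \<gamma>_def split_beta')
  have \<gamma>K: "\<bar>\<gamma> j u \<omega>\<bar> \<le> 2 * K" for j u \<omega>
    using K(2)[of j "(Y (max 0 u) \<omega>, Z (max 0 u) \<omega>)"] K(2)[of j "(Y' (max 0 u) \<omega>, Z' (max 0 u) \<omega>)"] unfolding \<gamma>_def by linarith
  have \<theta>K: "\<bar>\<theta> k u \<omega>\<bar> \<le> 2 * K" for k u \<omega>
    using K(1)[of k "(Y u \<omega>, Z u \<omega>)"] K(1)[of k "(Y' u \<omega>, Z' u \<omega>)"] unfolding \<theta>_def by linarith
  have V: "AE \<omega> in M. Z t \<omega> $ j - Z' t \<omega> $ j = (\<Sum>k\<in>UNIV. (J k t \<omega> - J k 0 \<omega>) - (J' k t \<omega> - J' k 0 \<omega>)) + (LBINT u:{0<..t}. \<gamma> j u \<omega>)"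
    if t: "0 \<le> t" for t j
    using eq[of j] eq'[of j] init AE_space
  proof eventually_elim
    case (elim \<omega>)
    note e = elim(1,2) and z = elim(3) and \<omega> = elim(4)
    have 1: "(LBINT u:{0..t}. d j (Y u \<omega>, Z u \<omega>)) - (LBINT u:{0..0}. d j (Y u \<omega>, Z u \<omega>)) = (LBINT u:{0<..t}. d j (Y (max 0 u) \<omega>, Z (max 0 u) \<omega>))"
      by (rule set_integral_Icc_diff[OF dp(1)[OF \<omega>] K(2) order_refl t]) simp
    have 2: "(LBINT u:{0..t}. d j (Y' u \<omega>, Z' u \<omega>)) - (LBINT u:{0..0}. d j (Y' u \<omega>, Z' u \<omega>)) = (LBINT u:{0<..t}. d j (Y' (max 0 u) \<omega>, Z' (max 0 u) \<omega>))"
      by (rule set_integral_Icc_diff[OF dp(2)[OF \<omega>] K(2) order_refl t]) simp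
    have 3: "(LBINT u:{0<..t}. \<gamma> j u \<omega>) = (LBINT u:{0<..t}. d j (Y (max 0 u) \<omega>, Z (max 0 u) \<omega>)) - (LBINT u:{0<..t}. d j (Y' (max 0 u) \<omega>, Z' (max 0 u) \<omega>))"
      unfolding \<gamma>_def
      by (rule set_integral_diff(2)[OF bounded_set_integrable_Ioc[OF dp(1)[OF \<omega>] K(2)] bounded_set_integrable_Ioc[OF dp(2)[OF \<omega>] K(2)]])
    \<comment> \<open>Subtracting the equations at time 0 introduces \<open>J k 0\<close> and
      \<open>J' k 0\<close>, which are not taken to be 0.\<close>
    show ?case
      using e(1)[rule_format, OF t] e(1)[rule_format, of 0] e(2)[rule_format, OF t] e(2)[rule_format, of 0] 1 2 z
      unfolding 3 sum_subtractf by simp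
  qed
  define f where "f t \<omega> = (norm (Z t \<omega> - Z' t \<omega>))\<^sup>2" for t \<omega>
  have fm: "jointly_measurable M (\<lambda>u \<omega>. f (max 0 u) \<omega>)"
  proof (rule continuous_process_measurable)
    show "f t \<in> borel_measurable M" if "0 \<le> t" for t
      unfolding f_def using Zm[OF that] by measurable
    show "continuous_on {0..} (\<lambda>t. f t \<omega>)" if "\<omega> \<in> space M" for \<omega>
      unfolding f_def using Zc[OF that] by (intro continuous_intros)
  qed
  have f0: "0 \<le> f t \<omega>" for t \<omega> by (simp add: f_def)
  have fsum: "(\<integral>\<^sup>+\<omega>. ennreal (f t \<omega>) \<partial>M) = (\<Sum>j\<in>UNIV. \<integral>\<^sup>+\<omega>. ennreal ((Z t \<omega> $ j - Z' t \<omega> $ j)\<^sup>2) \<partial>M)" if "0 \<le> t" for t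
  proof -
    have nthm: "(\<lambda>y::real^'r. y $ i) \<in> borel_measurable borel" for i
      by (intro borel_measurable_continuous_onI continuous_intros)
    have "(\<lambda>\<omega>. Z t \<omega> $ j) \<in> borel_measurable M" "(\<lambda>\<omega>. Z' t \<omega> $ j) \<in> borel_measurable M" for j
      using measurable_compose[OF Zm(1)[OF that] nthm] measurable_compose[OF Zm(2)[OF that] nthm] by auto
    moreover have "f t \<omega> = (\<Sum>j\<in>UNIV. (Z t \<omega> $ j - Z' t \<omega> $ j)\<^sup>2)" for \<omega>
      by (simp add: f_def norm_vec_def L2_set_def sum_nonneg)
    ultimately show ?thesis by (subst nn_integral_sum[symmetric]) simp_all
  qed
  define Q where "Q g r = nn_path_integral M 0 r (\<lambda>u \<omega>. (g u \<omega>)\<^sup>2)" for g :: "real \<Rightarrow> 'a \<Rightarrow> real" and r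
  have QK: "Q g r \<le> ennreal ((2 * K)\<^sup>2 * t)" if g: "\<And>u \<omega>. \<bar>g u \<omega>\<bar> \<le> 2 * K" and r: "0 \<le> r" "r \<le> t" for g r t
  proof -
    have "Q g r \<le> (\<integral>\<^sup>+\<omega>. (\<integral>\<^sup>+u. ennreal ((2 * K)\<^sup>2) * indicator {0..r} u \<partial>lborel) \<partial>M)"
      unfolding Q_def
    proof (intro nn_integral_mono mult_right_mono ennreal_leI)
      show "(g u \<omega>)\<^sup>2 \<le> (2 * K)\<^sup>2" for u \<omega> using g[of u \<omega>] by (metis abs_ge_zero power2_abs power_mono)
    qed simp
    also have "\<dots> = ennreal ((2 * K)\<^sup>2 * r)" using r(1) by (simp add: nn_integral_cmult_indicator emeasure_space_1 ennreal_mult)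
    also have "\<dots> \<le> ennreal ((2 * K)\<^sup>2 * t)" using r(2) by (intro ennreal_leI mult_left_mono) auto
    finally show ?thesis .
  qed
  have Qf: "Q g r \<le> ennreal (A\<^sup>2) * nn_path_integral M 0 r f"
    if g: "AE \<omega> in M. \<forall>u\<ge>0. \<bar>g u \<omega>\<bar> \<le> A * norm (Z u \<omega> - Z' u \<omega>)" for g r
  proof -
    have "Q g r \<le> nn_path_integral M 0 r (\<lambda>u \<omega>. A\<^sup>2 * f u \<omega>)"
      unfolding Q_def
    proof (rule nn_integral_mono_AE, use g in eventually_elim)
      fix \<omega> assume g: "\<forall>u\<ge>0. \<bar>g u \<omega>\<bar> \<le> A * norm (Z u \<omega> - Z' u \<omega>)"
      show "(\<integral>\<^sup>+u\<in>{0..r}. ennreal ((g u \<omega>)\<^sup>2) \<partial>lborel) \<le> (\<integral>\<^sup>+u\<in>{0..r}. ennreal (A\<^sup>2 * f u \<omega>) \<partial>lborel)"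
      proof (rule nn_integral_mono)
        fix u
        have "(g u \<omega>)\<^sup>2 \<le> A\<^sup>2 * f u \<omega>" if "0 \<le> u"
        proof -
          have "\<bar>g u \<omega>\<bar>\<^sup>2 \<le> (A * norm (Z u \<omega> - Z' u \<omega>))\<^sup>2" using g that by (intro power_mono) auto
          then show ?thesis by (simp add: f_def power_mult_distrib)
        qed
        then show "ennreal ((g u \<omega>)\<^sup>2) * indicator {0..r} u \<le> ennreal (A\<^sup>2 * f u \<omega>) * indicator {0..r} u"
          by (auto split: split_indicator intro!: ennreal_leI)
      qed
    qed
    also have "\<dots> = ennreal (A\<^sup>2) * nn_path_integral M 0 r f"
      by (rule nn_integral_path_cmult[OF fm]) simp
    finally show ?thesis .
  qed
  have \<theta>f: "AE \<omega> in M. \<forall>u\<ge>0. \<bar>\<theta> k u \<omega>\<bar> \<le> A * norm (Z u \<omega> - Z' u \<omega>)" for k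
    using YY' by eventually_elim (auto simp: \<theta>_def intro: c_Lipschitz)
  have \<gamma>f: "AE \<omega> in M. \<forall>u\<ge>0. \<bar>\<gamma> j u \<omega>\<bar> \<le> A * norm (Z u \<omega> - Z' u \<omega>)" for j
    using YY' by eventually_elim (auto simp: \<gamma>_def intro: d_Lipschitz)
  \<comment> \<open>There are \<open>CARD('r)\<close> coordinates; in each, the noise constant
    \<open>8 * CARD('q)\<close> multiplies a sum of \<open>CARD('q)\<close> integrals, and the drift
    adds \<open>2 * t\<close>.\<close>
  let ?N = "\<lambda>t. real CARD('r) * (8 * real CARD('q) * real CARD('q) + 2 * t)"
  \<comment> \<open>The common bound \<open>e\<close> is instantiated twice: with a constant from
    the boundedness of the coefficients for the a priori bound, and with the Lipschitz bound for the
    integral inequality.\<close>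
  have main: "(\<integral>\<^sup>+\<omega>. ennreal (f r \<omega>) \<partial>M) \<le> ennreal (?N t) * e"
    if r: "0 \<le> r" "r \<le> t" and e: "\<And>k. Q (\<theta> k) r \<le> e" "\<And>j. Q (\<gamma> j) r \<le> e" for r t e
  proof -
    have "(\<integral>\<^sup>+\<omega>. ennreal (f r \<omega>) \<partial>M) \<le> (\<Sum>j\<in>(UNIV::'r set). ennreal (8 * real CARD('q)) * (\<Sum>k\<in>(UNIV::'q set). e) + ennreal (2 * t) * e)"
      unfolding fsum[OF r(1)]
    proof (rule sum_mono)
      fix j :: 'r
      have "(\<integral>\<^sup>+\<omega>. ennreal ((Z r \<omega> $ j - Z' r \<omega> $ j)\<^sup>2) \<partial>M) \<le> ennreal (8 * real CARD('q)) * (\<Sum>k\<in>UNIV. Q (\<theta> k) r) + ennreal (2 * r) * Q (\<gamma> j) r"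
        unfolding Q_def \<theta>_def
        by (rule ito_sum_L2_estimate[OF bf J J' \<gamma>m \<gamma>K r(1), where V = "\<lambda>t \<omega>. Z t \<omega> $ j - Z' t \<omega> $ j"]) (rule V[OF r(1)])
      also have "\<dots> \<le> ennreal (8 * real CARD('q)) * (\<Sum>k\<in>(UNIV::'q set). e) + ennreal (2 * t) * e"
        using r by (intro add_mono mult_mono sum_mono e ennreal_leI) auto
      finally show "(\<integral>\<^sup>+\<omega>. ennreal ((Z r \<omega> $ j - Z' r \<omega> $ j)\<^sup>2) \<partial>M) \<le> \<dots>" .
    qed
    also have "\<dots> = ennreal (?N t) * e"
    proof -
      have "ennreal (?N t) = ennreal (real CARD('r)) * (ennreal (8 * real CARD('q)) * ennreal (real CARD('q)) + ennreal (2 * t))"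
        using r by (simp add: ennreal_mult'[symmetric] ennreal_plus[symmetric] del: ennreal_plus)
      then show ?thesis by (simp add: ennreal_of_nat_eq_real_of_nat[symmetric] distrib_right distrib_left mult.assoc)
    qed
    finally show ?thesis by simp
  qed
  have "AE \<omega> in M. f t \<omega> = 0" if t: "0 \<le> t" for t
  proof (rule Gronwall_process[OF fm f0, where T = t
        and C = "?N t * A\<^sup>2"
        and B = "?N t * ((2 * K)\<^sup>2 * t)"])
    fix r assume r: "0 \<le> r" "r \<le> t"
    show "(\<integral>\<^sup>+\<omega>. ennreal (f r \<omega>) \<partial>M) \<le> ennreal (?N t * ((2 * K)\<^sup>2 * t))"
    proof (subst ennreal_mult)
      show "(\<integral>\<^sup>+\<omega>. ennreal (f r \<omega>) \<partial>M) \<le> ennreal (?N t) * ennreal ((2 * K)\<^sup>2 * t)"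
        by (rule main[OF r]) (rule QK[OF _ r], rule \<theta>K \<gamma>K)+
    qed (use t in auto)
    show "(\<integral>\<^sup>+\<omega>. ennreal (f r \<omega>) \<partial>M) \<le> ennreal (?N t * A\<^sup>2)
        * nn_path_integral M 0 r f"
    proof (subst ennreal_mult)
      show "(\<integral>\<^sup>+\<omega>. ennreal (f r \<omega>) \<partial>M) \<le> ennreal (?N t) * ennreal (A\<^sup>2)
          * nn_path_integral M 0 r f"
        unfolding mult.assoc[of "ennreal _"] by (rule main[OF r]) (rule Qf[OF \<theta>f] Qf[OF \<gamma>f])+
    qed (use t in auto)
  qed (use t in auto)
  then have "AE \<omega> in M. Z t \<omega> = Z' t \<omega>" if "0 \<le> t" for t
    using that by (force simp: f_def)
  then show ?thesis by (intro continuous_processes_eq_AE Zc)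
qed

theorem theorem2:
  fixes b :: "'p::finite \<Rightarrow> real ^ 'p \<Rightarrow> real"
    and c :: "'q::finite \<Rightarrow> (real ^ 'p) \<times> (real ^ 'r) \<Rightarrow> real"
    and d :: "'r::finite \<Rightarrow> (real ^ 'p) \<times> (real ^ 'r) \<Rightarrow> real"
    and \<sigma> \<rho> :: "'p \<Rightarrow> real \<Rightarrow> real"
    and A :: real
  assumes b_bounded: "\<And>i. bounded (range (b i))"
    and b_continuous: "\<And>i. continuous_on UNIV (b i)"
    and c_bounded: "\<And>k. bounded (range (c k))"
    and c_continuous: "\<And>k. continuous_on UNIV (c k)"
    and d_bounded: "\<And>j. bounded (range (d j))"
    and d_continuous: "\<And>j. continuous_on UNIV (d j)"
    and b_Lipschitz: "\<And>i y1 y2. \<bar>b i y1 - b i y2\<bar> \<le> A * norm (y1 - y2)"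
    and c_Lipschitz: "\<And>k y1 z1 y2 z2.
      \<bar>c k (y1, z1) - c k (y2, z2)\<bar> \<le> A * norm ((y1, z1) - (y2, z2))"
    and d_Lipschitz: "\<And>j y1 z1 y2 z2.
      \<bar>d j (y1, z1) - d j (y2, z2)\<bar> \<le> A * norm ((y1, z1) - (y2, z2))"
    and \<sigma>_bounded: "\<And>i. bounded (range (\<sigma> i))"
    and \<sigma>_Borel: "\<And>i. \<sigma> i \<in> borel_measurable borel"
    and \<sigma>_modulus: "\<And>i x y. x \<noteq> y \<Longrightarrow> \<bar>\<sigma> i x - \<sigma> i y\<bar>\<^sup>2 \<le> \<rho> i \<bar>x - y\<bar>"
    and \<rho>_pos: "\<And>i x. x > 0 \<Longrightarrow> \<rho> i x > 0"
    and \<rho>_Borel: "\<And>i. \<rho> i \<in> borel_measurable (restrict_space borel {0<..})"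
    and \<rho>_Osgood: "\<And>i \<epsilon>. \<epsilon> > 0 \<Longrightarrow> (\<integral>\<^sup>+x\<in>{0<..<\<epsilon>}. ennreal (1 / \<rho> i x) \<partial>lborel) = \<infinity>"
  shows "pathwise_uniqueness TYPE('w) \<sigma> b c d"
  unfolding pathwise_uniqueness_def
proof (intro allI impI)
  fix M :: "'w measure" and F B Y Z Y' Z'
  assume filt: "filtered_prob_space M F" and ind: "independent_brownian_motions M F B"
    and sol: "sde_solution M F B \<sigma> b c d Y Z" and sol': "sde_solution M F B \<sigma> b c d Y' Z'"
    and init: "AE \<omega> in M. Y 0 \<omega> = Y' 0 \<omega> \<and> Z 0 \<omega> = Z' 0 \<omega>"
  have bm: "brownian_motion M F (B k)" for k
    using ind by (simp add: independent_brownian_motions_def)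
  \<comment> \<open>The modulus is given on the positive half-line only; the value 1 elsewhere makes
    it positive and Borel on the whole line without affecting Osgood's condition.\<close>
  define \<rho>' where "\<rho>' i x = (if 0 < x then \<rho> i x else 1)" for i x
  have \<rho>'_Borel: "\<rho>' i \<in> borel_measurable borel" for i
    unfolding \<rho>'_def using \<rho>_Borel[of i]
    by (subst measurable_If_restrict_space_iff) (auto simp: greaterThan_def)
  have \<rho>'_Osgood: "(\<integral>\<^sup>+x\<in>{0<..<\<epsilon>}. ennreal (1 / \<rho>' i x) \<partial>lborel) = \<infinity>" if "\<epsilon> > 0" for i \<epsilon>
    unfolding \<rho>_Osgood[OF that, of i, symmetric]
    by (rule nn_integral_cong) (simp add: \<rho>'_def split: split_indicator)
  have Y0: "AE \<omega> in M. Y 0 \<omega> = Y' 0 \<omega>" using init by eventually_elim simp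
  have YY': "AE \<omega> in M. \<forall>t\<ge>0. Y t \<omega> = Y' t \<omega>"
  proof (rule sde_Y_unique[OF b_bounded b_continuous b_Lipschitz \<sigma>_bounded _ _ \<rho>'_Borel _ filt bm sol sol' Y0])
    show "\<bar>\<sigma> i x - \<sigma> i y\<bar>\<^sup>2 \<le> \<rho>' i \<bar>x - y\<bar>" if "x \<noteq> y" for i x y
      using \<sigma>_modulus[OF that] that by (simp add: \<rho>'_def)
    show "0 < \<rho>' i x" for i x using \<rho>_pos by (simp add: \<rho>'_def)
  qed (rule \<rho>'_Osgood)
  have Z0: "AE \<omega> in M. Z 0 \<omega> = Z' 0 \<omega>" using init by eventually_elim simp
  have "AE \<omega> in M. \<forall>t\<ge>0. Z t \<omega> = Z' t \<omega>"
  proof (rule sde_Z_unique[OF c_bounded d_bounded d_continuous _ _ filt bm sol sol' Z0 YY'])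
    show "\<bar>c k (y, z1) - c k (y, z2)\<bar> \<le> A * norm (z1 - z2)" for k y z1 z2
      using c_Lipschitz[of k y z1 y z2] by (simp add: norm_Pair)
    show "\<bar>d j (y, z1) - d j (y, z2)\<bar> \<le> A * norm (z1 - z2)" for j y z1 z2
      using d_Lipschitz[of j y z1 y z2] by (simp add: norm_Pair)
  qed
  with YY' show "AE \<omega> in M. \<forall>t\<ge>0. (Y t \<omega>, Z t \<omega>) = (Y' t \<omega>, Z' t \<omega>)"
    by eventually_elim simp
qed


end
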